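(* Let $(V,\omega,\Gamma)$ be an indecomposable symplectic triple, $t\in\mathbb{C}$, $c:S\to\mathbb{C}$ a conjugation-invariant function on the set $S$ of symplectic reflections of $\Gamma$, and $\mathbf{H}_{t,c}$ the associated symplectic reflection algebra. Then $\mathbf{H}_{t,c}$ is $LD$-stable and $LD\,\mathbf{H}_{t,c}=\dim V$.
   Context: $V$ is a complex vector space of dimension $2n$ with a non-degenerate skew-symmetric form $\omega$; $\Gamma\subset Sp(V)$ is a finite group generated by symplectic reflections (elements $g$ with $\operatorname{rank}(1-g)=2$). The triple is indecomposable if $V$ is not a direct sum of two nonzero $\Gamma$-invariant subspaces $V_1,V_2$ with $\omega(V_1,V_2)=0$. For $s\in S$, $\omega_s$ is the skew form with radical $\ker(1-s)$ that agrees with $\omega$ on $\operatorname{im}(1-s)$. $\mathbf{H}_{t,c}$ is the quotient of the skew group ring $T(V)*\Gamma$ by the relations $[x,y]=t\,\omega(x,y)+\sum_{s\in S}c(s)\omega_s(x,y)s$ for $x,y\in V$. $GK$ is Gelfand–Kirillov dimension over $\mathbb{C}$: $GK\,A=\sup_W\limsup_m\log(\dim W^m)/\log m$ over subframes $W$ (finite-dimensional subspaces containing $1$). Lower transcendence degree $LD$: if every subframe $W$ admits a finite-dimensional nonzero $X$ with $\dim WX=\dim X$, then $LD\,A=0$; otherwise $LD\,A=\sup_W\sup\{d>0:\exists c'>0,\ \dim WX\ge\dim X+c'(\dim X)^{(d-1)/d}\text{ for all finite-dimensional }X\neq0\}$. $A$ is $LD$-stable if $LD\,A=GK\,A$. 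*)

theory Defs
  imports "HOL-Analysis.Analysis" "HOL-Library.Function_Algebras"
begin

record 'a calg =
  ca_carrier :: "'a set"
  ca_add :: "'a \<Rightarrow> 'a \<Rightarrow> 'a"
  ca_smul :: "complex \<Rightarrow> 'a \<Rightarrow> 'a"
  ca_mul :: "'a \<Rightarrow> 'a \<Rightarrow> 'a"
  ca_zero :: "'a"
  ca_one :: "'a"

fun lincomb :: "'a calg \<Rightarrow> (complex \<times> 'a) list \<Rightarrow> 'a" where
  "lincomb A [] = ca_zero A"
| "lincomb A ((c, x) # xs) = ca_add A (ca_smul A c x) (lincomb A xs)"

definition cspan :: "'a calg \<Rightarrow> 'a set \<Rightarrow> 'a set" where
  "cspan A F = {lincomb A xs | xs. set xs \<subseteq> UNIV \<times> F}"

definition csubspace :: "'a calg \<Rightarrow> 'a set \<Rightarrow> bool" where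
  "csubspace A U \<longleftrightarrow> U \<subseteq> ca_carrier A \<and> cspan A U = U"

definition lin_indep :: "'a calg \<Rightarrow> 'a set \<Rightarrow> bool" where
  "lin_indep A F \<longleftrightarrow> (\<forall>xs cs. distinct xs \<and> set xs \<subseteq> F \<and> length cs = length xs \<and>
      lincomb A (zip cs xs) = ca_zero A \<longrightarrow> (\<forall>c\<in>set cs. c = 0))"

definition fd_subspace :: "'a calg \<Rightarrow> 'a set \<Rightarrow> bool" where
  "fd_subspace A U \<longleftrightarrow> csubspace A U \<and> (\<exists>F. finite F \<and> F \<subseteq> U \<and> cspan A F = U)"

definition cdim :: "'a calg \<Rightarrow> 'a set \<Rightarrow> nat" where
  "cdim A U = (THE k. \<exists>F. finite F \<and> F \<subseteq> U \<and> lin_indep A F \<and> cspan A F = U \<and> card F = k)"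

definition set_prod :: "'a calg \<Rightarrow> 'a set \<Rightarrow> 'a set \<Rightarrow> 'a set" where
  "set_prod A W X = cspan A {ca_mul A w x | w x. w \<in> W \<and> x \<in> X}"

fun set_pow :: "'a calg \<Rightarrow> 'a set \<Rightarrow> nat \<Rightarrow> 'a set" where
  "set_pow A W 0 = cspan A {ca_one A}"
| "set_pow A W (Suc m) = set_prod A W (set_pow A W m)"

definition subframe :: "'a calg \<Rightarrow> 'a set \<Rightarrow> bool" where
  "subframe A W \<longleftrightarrow> fd_subspace A W \<and> ca_one A \<in> W"

definition GKdim :: "'a calg \<Rightarrow> ereal" where
  "GKdim A = (SUP W\<in>{W. subframe A W}.
      limsup (\<lambda>m. ereal (ln (real (cdim A (set_pow A W m))) / ln (real m))))"

definition LDdeg :: "'a calg \<Rightarrow> ereal" where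
  "LDdeg A =
    (if (\<forall>W. subframe A W \<longrightarrow>
          (\<exists>X. fd_subspace A X \<and> X \<noteq> {ca_zero A} \<and> cdim A (set_prod A W X) = cdim A X))
     then 0
     else (SUP W\<in>{W. subframe A W}. Sup (ereal ` {d::real. d > 0 \<and>
             (\<exists>c'>0. \<forall>X. fd_subspace A X \<and> X \<noteq> {ca_zero A} \<longrightarrow>
                real (cdim A (set_prod A W X)) \<ge>
                  real (cdim A X) + c' * (real (cdim A X)) powr ((d - 1) / d))})))"

definition LD_stable :: "'a calg \<Rightarrow> bool" where
  "LD_stable A \<longleftrightarrow> LDdeg A = GKdim A"

type_synonym 'n cmat = "complex^'n^'n"

definition cbilinear :: "(complex^'n::finite \<Rightarrow> complex^'n \<Rightarrow> complex) \<Rightarrow> bool" where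
  "cbilinear f \<longleftrightarrow>
     (\<forall>x y z. f (x + y) z = f x z + f y z) \<and> (\<forall>x y z. f x (y + z) = f x y + f x z) \<and>
     (\<forall>c x y. f (c *s x) y = c * f x y) \<and> (\<forall>c x y. f x (c *s y) = c * f x y)"

definition symplectic_form :: "(complex^'n::finite \<Rightarrow> complex^'n \<Rightarrow> complex) \<Rightarrow> bool" where
  "symplectic_form om \<longleftrightarrow> cbilinear om \<and> (\<forall>x y. om x y = - om y x) \<and>
     (\<forall>x. (\<forall>y. om x y = 0) \<longrightarrow> x = 0)"

definition in_Sp :: "(complex^('n::finite) \<Rightarrow> complex^'n \<Rightarrow> complex) \<Rightarrow> 'n cmat \<Rightarrow> bool" where
  "in_Sp om g \<longleftrightarrow> invertible g \<and> (\<forall>x y. om (g *v x) (g *v y) = om x y)"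

definition symp_refl :: "('n::finite) cmat \<Rightarrow> bool" where
  "symp_refl g \<longleftrightarrow> rank (mat 1 - g) = 2"

inductive_set gen_group :: "('n::finite) cmat set \<Rightarrow> 'n cmat set" for S where
  gen_one: "mat 1 \<in> gen_group S"
| gen_base: "s \<in> S \<Longrightarrow> s \<in> gen_group S"
| gen_mult: "a \<in> gen_group S \<Longrightarrow> b \<in> gen_group S \<Longrightarrow> a ** b \<in> gen_group S"
| gen_inv: "a \<in> gen_group S \<Longrightarrow> matrix_inv a \<in> gen_group S"

definition refls :: "('n::finite) cmat set \<Rightarrow> 'n cmat set" where
  "refls G = {g\<in>G. symp_refl g}"

definition symplectic_triple ::
  "(complex^('n::finite) \<Rightarrow> complex^'n \<Rightarrow> complex) \<Rightarrow> 'n cmat set \<Rightarrow> bool" where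
  "symplectic_triple om G \<longleftrightarrow> symplectic_form om \<and> finite G \<and>
     mat 1 \<in> G \<and> (\<forall>a\<in>G. \<forall>b\<in>G. a ** b \<in> G) \<and> (\<forall>a\<in>G. matrix_inv a \<in> G) \<and>
     (\<forall>g\<in>G. in_Sp om g) \<and> G = gen_group (refls G)"

definition indecomposable ::
  "(complex^('n::finite) \<Rightarrow> complex^'n \<Rightarrow> complex) \<Rightarrow> 'n cmat set \<Rightarrow> bool" where
  "indecomposable om G \<longleftrightarrow> \<not> (\<exists>V1 V2. vec.subspace V1 \<and> vec.subspace V2 \<and>
      V1 \<noteq> {0} \<and> V2 \<noteq> {0} \<and> V1 \<inter> V2 = {0} \<and> {x + y | x y. x \<in> V1 \<and> y \<in> V2} = UNIV \<and>
      (\<forall>g\<in>G. \<forall>x\<in>V1. g *v x \<in> V1) \<and> (\<forall>g\<in>G. \<forall>x\<in>V2. g *v x \<in> V2) \<and>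
      (\<forall>x\<in>V1. \<forall>y\<in>V2. om x y = 0))"

definition omega_s ::
  "(complex^('n::finite) \<Rightarrow> complex^'n \<Rightarrow> complex) \<Rightarrow> 'n cmat \<Rightarrow> complex^'n \<Rightarrow> complex^'n \<Rightarrow> complex" where
  "omega_s om s = (THE f. cbilinear f \<and> (\<forall>x y. f x y = - f y x) \<and>
      {x. \<forall>y. f x y = 0} = {x. (mat 1 - s) *v x = 0} \<and>
      (\<forall>x\<in>range (\<lambda>v. (mat 1 - s) *v v). \<forall>y\<in>range (\<lambda>v. (mat 1 - s) *v v). f x y = om x y))"

text \<open>Elements of T(V)*Gamma: finitely supported coefficient functions on the basis
  e_w g, where w is a word in the standard basis of V (a tensor monomial) and g in Gamma.\<close>
type_synonym 'n tg = "'n list \<times> 'n cmat \<Rightarrow> complex"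

definition supp :: "('n::finite) tg \<Rightarrow> ('n list \<times> 'n cmat) set" where
  "supp a = {p. a p \<noteq> 0}"

definition TG_carrier :: "('n::finite) cmat set \<Rightarrow> 'n tg set" where
  "TG_carrier G = {a. finite (supp a) \<and> supp a \<subseteq> UNIV \<times> G}"

text \<open>coefficient of e_u in g(e_w), where g e_j = sum_i g$i$j e_i\<close>
definition act_coeff :: "('n::finite) cmat \<Rightarrow> 'n list \<Rightarrow> 'n list \<Rightarrow> complex" where
  "act_coeff g w u = (if length u = length w then (\<Prod>k<length w. g $ (u ! k) $ (w ! k)) else 0)"

text \<open>(e_w1 g1)(e_w2 g2) = e_w1 (g1 e_w2) (g1 g2)\<close>
definition tg_mult :: "('n::finite) tg \<Rightarrow> 'n tg \<Rightarrow> 'n tg" where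
  "tg_mult a b = (\<lambda>(u, h). \<Sum>(w1, g1)\<in>supp a. \<Sum>(w2, g2)\<in>supp b.
      (if g1 ** g2 = h \<and> length u = length w1 + length w2 \<and> take (length w1) u = w1
       then a (w1, g1) * b (w2, g2) * act_coeff g1 w2 (drop (length w1) u) else 0))"

definition tg_one :: "('n::finite) tg" where
  "tg_one = (\<lambda>p. if p = ([], mat 1) then 1 else 0)"

definition tg_smul :: "complex \<Rightarrow> ('n::finite) tg \<Rightarrow> 'n tg" where
  "tg_smul c a = (\<lambda>p. c * a p)"

definition tg_vec :: "complex^('n::finite) \<Rightarrow> 'n tg" where
  "tg_vec x = (\<lambda>(w, g). if g = mat 1 \<and> length w = 1 then x $ (hd w) else 0)"

definition tg_grp :: "('n::finite) cmat \<Rightarrow> 'n tg" where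
  "tg_grp g = (\<lambda>p. if p = ([], g) then 1 else 0)"

definition sra_rel ::
  "(complex^('n::finite) \<Rightarrow> complex^'n \<Rightarrow> complex) \<Rightarrow> 'n cmat set \<Rightarrow> complex \<Rightarrow> ('n cmat \<Rightarrow> complex)
     \<Rightarrow> complex^'n \<Rightarrow> complex^'n \<Rightarrow> 'n tg" where
  "sra_rel om G t c x y =
     tg_mult (tg_vec x) (tg_vec y) - tg_mult (tg_vec y) (tg_vec x)
     - tg_smul (t * om x y) tg_one
     - (\<Sum>s\<in>refls G. tg_smul (c s * omega_s om s x y) (tg_grp s))"

inductive_set sra_ideal ::
  "(complex^('n::finite) \<Rightarrow> complex^'n \<Rightarrow> complex) \<Rightarrow> 'n cmat set \<Rightarrow> complex \<Rightarrow> ('n cmat \<Rightarrow> complex)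
     \<Rightarrow> 'n tg set" for om G t c where
  id_zero: "0 \<in> sra_ideal om G t c"
| id_gen: "a \<in> TG_carrier G \<Longrightarrow> b \<in> TG_carrier G \<Longrightarrow>
     tg_mult (tg_mult a (sra_rel om G t c x y)) b \<in> sra_ideal om G t c"
| id_add: "i \<in> sra_ideal om G t c \<Longrightarrow> j \<in> sra_ideal om G t c \<Longrightarrow> i + j \<in> sra_ideal om G t c"
| id_smul: "i \<in> sra_ideal om G t c \<Longrightarrow> tg_smul k i \<in> sra_ideal om G t c"

definition coset :: "('n::finite) tg set \<Rightarrow> 'n tg \<Rightarrow> 'n tg set" where
  "coset I a = {a + i | i. i \<in> I}"

definition rep :: "('n::finite) tg set \<Rightarrow> 'n tg" where
  "rep X = (SOME a. a \<in> X)"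

definition SRA ::
  "(complex^('n::finite) \<Rightarrow> complex^'n \<Rightarrow> complex) \<Rightarrow> 'n cmat set \<Rightarrow> complex \<Rightarrow> ('n cmat \<Rightarrow> complex)
     \<Rightarrow> 'n tg set calg" where
  "SRA om G t c = (let I = sra_ideal om G t c in
     \<lparr> ca_carrier = coset I ` TG_carrier G,
       ca_add = (\<lambda>X Y. coset I (rep X + rep Y)),
       ca_smul = (\<lambda>k X. coset I (tg_smul k (rep X))),
       ca_mul = (\<lambda>X Y. coset I (tg_mult (rep X) (rep Y))),
       ca_zero = coset I 0,
       ca_one = coset I tg_one \<rparr>)"

end

theory Submission
  imports Defs "HOL-Library.List_Lexorder"
begin

text \<open>The algebra has the Poincare-Birkhoff-Witt property: rewriting the words \<open>e_b e_a\<close> into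
  \<open>e_a e_b\<close> plus the bracket is confluent, because the overlaps \<open>e_c e_b e_a\<close> are resolved by a
  Jacobi identity that holds for each reflection separately (\<open>omega_s\<close> lives on a space of
  dimension two) and because the bracket is \<open>G\<close>-equivariant. Hence sorted words times group
  elements form a basis, and the filtration by word length bounds the Gelfand-Kirillov
  dimension by \<open>dim V\<close>.

  For the lower bound take \<open>W\<close> spanned by \<open>1\<close> and the basis of \<open>V\<close>, and pass from a subspace \<open>X\<close>
  to the set \<open>A\<close> of its leading exponents. The exponents of \<open>WX\<close> contain \<open>A\<close> and its unit shifts,
  and the shift in direction \<open>i\<close> adds at least as many points as the \<open>i\<close>-th coordinate
  projection of \<open>A\<close> has. By the Loomis-Whitney inequality some projection has at least
  \<open>|A|^((d-1)/d) / d\<close> points, where \<open>d = dim V\<close>. Conversely, an isoperimetric inequality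
  of exponent \<open>d\<close> for one \<open>W\<close> forces \<open>dim W^m\<close> to grow like \<open>m^d\<close>, so \<open>LD\<close> cannot exceed
  the Gelfand-Kirillov dimension.\<close>

section \<open>The skew tensor algebra\<close>

text \<open>The linear normal form map \<open>N\<close> vanishes, within the skew tensor algebra
  over \<open>G\<close>, exactly on the ideal. It therefore identifies the quotient, given by cosets
  with arbitrarily chosen representatives, with an explicit space \<open>NF\<close> of finitely
  supported functions whose product is \<open>N (a \<odot> b)\<close>; all dimensions are computed
  there. The obstacle in the confluence proof is that two disjoint rewritings commute only modulo
  relations. These relations stand in shorter words, because a bracket replaces two letters by group
  elements, so an induction on the word length closes the circle. The overlaps on three letters are
  exact identities in the skew tensor algebra. The group does not spoil the combinatorics. It
  occupies one additional coordinate of the exponent, which left multiplication by vectors leaves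
  alone in the leading term, and the projection inequality is valid for sets with coordinates beyond
  those that are projected away.\<close>

interpretation tgv: vector_space "tg_smul :: complex \<Rightarrow> ('n::finite) tg \<Rightarrow> 'n tg"
  by unfold_locales (auto simp: fun_eq_iff algebra_simps tg_smul_def)

text \<open>As simp rules these would eta-expand function-valued arguments.\<close>

declare plus_fun_apply [simp del] zero_fun_apply [simp del] minus_apply [simp del]
  uminus_apply [simp del]

lemmas tg_apply = plus_fun_apply zero_fun_apply minus_apply uminus_apply tg_smul_def

abbreviation fs :: "('n::finite) tg \<Rightarrow> bool" where "fs a \<equiv> finite (supp a)"

definition bas :: "('n::finite) list \<times> 'n cmat \<Rightarrow> 'n tg" where
  "bas p = (\<lambda>q. if q = p then 1 else 0)"

lemma sum_fun_apply: "(\<Sum>i\<in>I. f i) x = (\<Sum>i\<in>I. f i x)"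
  by (induction I rule: infinite_finite_induct) (auto simp: tg_apply)

lemma supp_zero [simp]: "supp 0 = {}"
  by (simp add: supp_def tg_apply)

lemma supp_bas [simp]: "supp (bas p) = {p}"
  by (auto simp: supp_def bas_def)

lemma supp_add: "supp (a + b) \<subseteq> supp a \<union> supp b"
  by (auto simp: supp_def tg_apply)

lemma supp_diff: "supp (a - b) \<subseteq> supp a \<union> supp b"
  by (auto simp: supp_def tg_apply)

lemma supp_smul: "supp (tg_smul k a) \<subseteq> supp a"
  by (auto simp: supp_def tg_apply)

lemma fs_add: "fs a \<Longrightarrow> fs b \<Longrightarrow> fs (a + b)"
  by (rule finite_subset[OF supp_add]) auto

lemma fs_diff: "fs a \<Longrightarrow> fs b \<Longrightarrow> fs (a - b)"
  by (rule finite_subset[OF supp_diff]) auto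

lemma fs_smul: "fs a \<Longrightarrow> fs (tg_smul k a)"
  by (rule finite_subset[OF supp_smul])

lemma fs_sum: "(\<And>i. i \<in> I \<Longrightarrow> fs (f i)) \<Longrightarrow> fs (\<Sum>i\<in>I. f i)"
  by (induction I rule: infinite_finite_induct) (auto intro: fs_add)

lemma fs_bas: "fs (bas p)"
  by simp

lemma tg_decomp:
  assumes "finite S" "supp a \<subseteq> S"
  shows "a = (\<Sum>p\<in>S. tg_smul (a p) (bas p))"
proof
  fix q
  have "(\<Sum>p\<in>S. tg_smul (a p) (bas p)) q = (\<Sum>p\<in>S. if p = q then a p else 0)"
    unfolding sum_fun_apply by (intro sum.cong) (auto simp: bas_def tg_apply)
  also have "\<dots> = a q"
    using assms by (auto simp: supp_def tg_apply)
  finally show "a q = (\<Sum>p\<in>S. tg_smul (a p) (bas p)) q" by simp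
qed

text \<open>Reduces a statement additive in \<open>a\<close> to scalar multiples of monomials. The
  set \<open>P\<close> carries side conditions on the monomials, such as a degree bound, through the
  induction.\<close>

lemma fs_induct [consumes 2, case_names zero add bas]:
  assumes "fs a" "supp a \<subseteq> P"
    and "Q 0"
    and add: "\<And>x y. fs x \<Longrightarrow> fs y \<Longrightarrow> Q x \<Longrightarrow> Q y \<Longrightarrow> Q (x + y)"
    and bas: "\<And>k p. p \<in> P \<Longrightarrow> Q (tg_smul k (bas p))"
  shows "Q a"
proof -
  have "S \<subseteq> P \<Longrightarrow> Q (\<Sum>p\<in>S. tg_smul (a p) (bas p))" if "finite S" for S
    using that
  proof (induction S rule: finite_induct)
    case (insert x F)
    show ?case unfolding sum.insert[OF insert.hyps]
      by (rule add; (intro fs_sum fs_smul fs_bas)?) (use insert bas in blast)+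
  qed (simp add: assms)
  from this[OF assms(1,2)] show ?thesis using tg_decomp[OF assms(1)] by simp
qed

definition mcf :: "('n::finite) list \<times> 'n cmat \<Rightarrow> 'n list \<times> 'n cmat \<Rightarrow> 'n tg" where
  "mcf p q = (\<lambda>(u, h). if snd p ** snd q = h \<and> length u = length (fst p) + length (fst q)
     \<and> take (length (fst p)) u = fst p
     then act_coeff (snd p) (fst q) (drop (length (fst p)) u) else 0)"

text \<open>\<open>tg_mult\<close> sums over exact supports, which change under addition and
  scaling. Any finite supersets may index the sum instead, since the additional coefficients are
  zero; different arguments can then share one index set, and bilinearity becomes a termwise
  identity.\<close>

lemma tg_mult_eq:
  assumes "finite S" "supp a \<subseteq> S" "finite T" "supp b \<subseteq> T"
  shows "tg_mult a b = (\<Sum>p\<in>S. \<Sum>q\<in>T. tg_smul (a p * b q) (mcf p q))"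
proof
  fix r
  have "tg_mult a b r = (\<Sum>p\<in>supp a. \<Sum>q\<in>supp b. a p * b q * mcf p q r)"
    unfolding tg_mult_def
    by (cases r) (auto intro!: sum.cong simp: mcf_def split_beta)
  also have "\<dots> = (\<Sum>p\<in>supp a. \<Sum>q\<in>T. a p * b q * mcf p q r)"
    using assms by (intro sum.cong sum.mono_neutral_left) (auto simp: supp_def)
  also have "\<dots> = (\<Sum>p\<in>S. \<Sum>q\<in>T. a p * b q * mcf p q r)"
    using assms by (intro sum.mono_neutral_left) (auto simp: supp_def)
  finally show "tg_mult a b r = (\<Sum>p\<in>S. \<Sum>q\<in>T. tg_smul (a p * b q) (mcf p q)) r"
    by (simp add: sum_fun_apply tg_apply)
qed

lemma tg_mult_add_left:
  assumes "fs a" "fs b" "fs d"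
  shows "tg_mult (a + b) d = tg_mult a d + tg_mult b d"
proof -
  let ?S = "supp a \<union> supp b"
  have f: "finite ?S" using assms by simp
  show ?thesis
    using assms supp_add[of a b]
    by (subst (1 2 3) tg_mult_eq[OF f _ assms(3) subset_refl])
      (auto simp: sum.distrib distrib_right tgv.scale_left_distrib plus_fun_apply)
qed

lemma tg_mult_add_right:
  assumes "fs a" "fs b" "fs d"
  shows "tg_mult d (a + b) = tg_mult d a + tg_mult d b"
proof -
  let ?S = "supp a \<union> supp b"
  have f: "finite ?S" using assms by simp
  show ?thesis
    using assms supp_add[of a b]
    by (subst (1 2 3) tg_mult_eq[OF assms(3) subset_refl f])
      (auto simp: sum.distrib distrib_left tgv.scale_left_distrib plus_fun_apply)
qed

lemma tg_mult_smul_left: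
  assumes "fs a" "fs d"
  shows "tg_mult (tg_smul k a) d = tg_smul k (tg_mult a d)"
  unfolding tg_mult_eq[OF assms(1) supp_smul assms(2) subset_refl, of k]
    tg_mult_eq[OF assms(1) subset_refl assms(2) subset_refl] tgv.scale_sum_right tgv.scale_scale
  by (intro sum.cong refl) (simp add: tg_smul_def mult.assoc)

lemma tg_mult_smul_right:
  assumes "fs a" "fs d"
  shows "tg_mult d (tg_smul k a) = tg_smul k (tg_mult d a)"
  unfolding tg_mult_eq[OF assms(2) subset_refl assms(1) supp_smul, of k]
    tg_mult_eq[OF assms(2) subset_refl assms(1) subset_refl] tgv.scale_sum_right tgv.scale_scale
  by (intro sum.cong refl) (simp add: tg_smul_def mult.left_commute)

lemma tg_mult_zero [simp]: "tg_mult 0 a = 0" "tg_mult a 0 = 0"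
  by (auto simp: tg_mult_def fun_eq_iff tg_apply)

lemma tg_mult_uminus_left: "fs a \<Longrightarrow> fs d \<Longrightarrow> tg_mult (- a) d = - tg_mult a d"
  using tg_mult_smul_left[of a d "-1"] by (simp add: tgv.scale_minus_left)

lemma tg_mult_uminus_right: "fs a \<Longrightarrow> fs d \<Longrightarrow> tg_mult d (- a) = - tg_mult d a"
  using tg_mult_smul_right[of a d "-1"] by (simp add: tgv.scale_minus_left)

lemma fs_uminus: "fs a \<Longrightarrow> fs (- a)"
  using fs_smul[of a "-1"] by (simp add: tgv.scale_minus_left)

lemma tg_mult_diff_left:
  "fs a \<Longrightarrow> fs b \<Longrightarrow> fs d \<Longrightarrow> tg_mult (a - b) d = tg_mult a d - tg_mult b d"
  using tg_mult_add_left[of a "- b" d] by (simp add: tg_mult_uminus_left fs_uminus)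

lemma tg_mult_diff_right:
  "fs a \<Longrightarrow> fs b \<Longrightarrow> fs d \<Longrightarrow> tg_mult d (a - b) = tg_mult d a - tg_mult d b"
  using tg_mult_add_right[of a "- b" d] by (simp add: tg_mult_uminus_right fs_uminus)

lemma tg_mult_sum_left:
  assumes "\<And>i. i \<in> I \<Longrightarrow> fs (f i)" "fs d"
  shows "tg_mult (\<Sum>i\<in>I. f i) d = (\<Sum>i\<in>I. tg_mult (f i) d)"
  using assms
  by (induction I rule: infinite_finite_induct) (auto simp: tg_mult_add_left fs_sum)

lemma tg_mult_sum_right:
  assumes "\<And>i. i \<in> I \<Longrightarrow> fs (f i)" "fs d"
  shows "tg_mult d (\<Sum>i\<in>I. f i) = (\<Sum>i\<in>I. tg_mult d (f i))"
  using assms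
  by (induction I rule: infinite_finite_induct) (auto simp: tg_mult_add_right fs_sum)

definition words :: "nat \<Rightarrow> ('n::finite) list set" where
  "words k = {w. length w = k}"

lemma finite_words [simp]: "finite (words k)"
  using finite_lists_length_eq[of "UNIV :: 'a set" k] by (simp add: words_def)

lemma words_Suc: "words (Suc k) = (\<lambda>(x, w). x # w) ` (UNIV \<times> words k)"
  by (auto simp: words_def length_Suc_conv image_iff)

lemma act_coeff_Nil [simp]: "act_coeff g [] u = (if u = [] then 1 else 0)"
  by (auto simp: act_coeff_def)

lemma act_coeff_Cons [simp]:
  "act_coeff g (x # w) (y # u) = g $ y $ x * act_coeff g w u"
  by (auto simp: act_coeff_def prod.lessThan_Suc_shift simp del: prod.lessThan_Suc)

lemma act_coeff_append:
  "length u = length w \<Longrightarrow> act_coeff g (w @ w') (u @ u') = act_coeff g w u * act_coeff g w' u'"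
  by (induction u w rule: list_induct2) auto

lemma act_coeff_one: "act_coeff (mat 1) w u = (if u = w then 1 else 0)"
proof (cases "length u = length w")
  case True
  then show ?thesis by (induction u w rule: list_induct2) (auto simp: mat_def)
qed (auto simp: act_coeff_def)

lemma sum_words_Suc: "(\<Sum>w\<in>words (Suc k). f w) = (\<Sum>x\<in>UNIV. \<Sum>w\<in>words k. f (x # w))"
  unfolding words_Suc
  by (subst sum.reindex) (auto simp: inj_on_def sum.cartesian_product split_beta)

text \<open>\<open>act_coeff g\<close> is the matrix of the tensor power of \<open>g\<close> on
  words of a fixed length, so this is functoriality of tensor powers. The first letters contribute
  one entry of the matrix product, and the sum over intermediate words splits accordingly.\<close>

lemma act_coeff_mult:
  "length u = length w \<Longrightarrow>
   act_coeff (g ** h) w u = (\<Sum>v\<in>words (length w). act_coeff g v u * act_coeff h w v)"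
proof (induction u w rule: list_induct2)
  case Nil
  then show ?case by (simp add: words_def)
next
  case (Cons y u x w)
  have "act_coeff (g ** h) (x # w) (y # u) =
     (\<Sum>k\<in>UNIV. g $ y $ k * h $ k $ x) * (\<Sum>v\<in>words (length w). act_coeff g v u * act_coeff h w v)"
    by (simp add: Cons.IH) (simp add: matrix_matrix_mult_def)
  also have "\<dots> = (\<Sum>k\<in>UNIV. \<Sum>v\<in>words (length w). (g $ y $ k * h $ k $ x) * (act_coeff g v u * act_coeff h w v))"
    by (simp add: sum_product)
  finally show ?case by (simp add: sum_words_Suc ac_simps)
qed

lemma bas_mult_mcf: "tg_mult (bas p) (bas q) = mcf p q"
  by (subst tg_mult_eq[of "{p}" _ "{q}"]) (simp_all, simp add: bas_def mcf_def tg_apply)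

lemma bas_mult:
  "tg_mult (bas (u, g)) (bas (v, h)) =
     (\<Sum>w\<in>words (length v). tg_smul (act_coeff g v w) (bas (u @ w, g ** h)))"
proof
  fix r :: "'a list \<times> 'a cmat"
  obtain x k where r: "r = (x, k)" by force
  have "(\<Sum>w\<in>words (length v). tg_smul (act_coeff g v w) (bas (u @ w, g ** h))) r =
    (\<Sum>w\<in>words (length v). if w = drop (length u) x then mcf (u,g) (v,h) r else 0)"
    unfolding sum_fun_apply
    by (intro sum.cong)
       (auto simp: r bas_def mcf_def words_def tg_apply, metis append_take_drop_id)
  also have "\<dots> = mcf (u,g) (v,h) r"
    by (simp only: sum.delta[OF finite_words]) (auto simp: words_def r mcf_def)
  finally show "tg_mult (bas (u, g)) (bas (v, h)) r =
     (\<Sum>w\<in>words (length v). tg_smul (act_coeff g v w) (bas (u @ w, g ** h))) r"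
    by (simp add: bas_mult_mcf)
qed

lemma fs_mult:
  assumes "fs a" "fs b"
  shows "fs (tg_mult a b)"
proof -
  have "fs (mcf p q)" for p q :: "'a list \<times> 'a cmat"
    unfolding bas_mult_mcf[symmetric]
    by (cases p; cases q) (auto simp: bas_mult intro!: fs_sum fs_smul fs_bas)
  then show ?thesis
    by (subst tg_mult_eq[OF assms(1) subset_refl assms(2) subset_refl])
      (auto intro!: fs_sum fs_smul)
qed

lemmas fs_intros = fs_add fs_diff fs_uminus fs_smul fs_sum fs_bas fs_mult

text \<open>Bracketing to the left applies \<open>g ** h\<close> to \<open>w\<close> at once;
  bracketing to the right applies \<open>h\<close> and then \<open>g\<close>, through an
  intermediate word \<open>y\<close>. The two agree by \<open>act_coeff_mult\<close>, and the action
  of \<open>g\<close> on \<open>v @ y\<close> factors by \<open>act_coeff_append\<close>.\<close>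

lemma tg_mult_assoc_bas:
  "tg_mult (tg_mult (bas (u,g)) (bas (v,h))) (bas (w,k)) =
   tg_mult (bas (u,g)) (tg_mult (bas (v,h)) (bas (w,k)))"
proof -
  let ?V = "words (length v)" and ?W = "words (length w)"
  have bij: "bij_betw (\<lambda>(x,y). x @ y) (?V \<times> ?W) (words (length v + length w))"
    by (rule bij_betw_byWitness[where f' = "\<lambda>z. (take (length v) z, drop (length v) z)"])
       (auto simp: words_def)
  have R: "tg_mult (bas (u,g)) (bas (v @ y, h ** k)) = (\<Sum>x\<in>?V. \<Sum>z\<in>?W.
     tg_smul (act_coeff g v x * act_coeff g y z) (bas (u @ x @ z, g ** h ** k)))"
    if y: "y \<in> ?W" for y
  proof -
    have "tg_mult (bas (u,g)) (bas (v @ y, h ** k)) =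
       (\<Sum>x\<in>words (length v + length w). tg_smul (act_coeff g (v @ y) x) (bas (u @ x, g ** (h ** k))))"
      using y by (simp add: bas_mult words_def)
    also have "\<dots> = (\<Sum>(x,z)\<in>?V \<times> ?W. tg_smul (act_coeff g (v @ y) (x @ z)) (bas (u @ x @ z, g ** (h ** k))))"
      by (subst sum.reindex_bij_betw[OF bij, symmetric]) (simp add: split_beta)
    also have "\<dots> = (\<Sum>(x,z)\<in>?V \<times> ?W. tg_smul (act_coeff g v x * act_coeff g y z) (bas (u @ x @ z, g ** h ** k)))"
      by (intro sum.cong) (auto simp: words_def act_coeff_append matrix_mul_assoc)
    finally show ?thesis by (simp add: sum.cartesian_product)
  qed
  have "tg_mult (tg_mult (bas (u,g)) (bas (v,h))) (bas (w,k)) =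
     (\<Sum>x\<in>?V. tg_smul (act_coeff g v x) (\<Sum>z\<in>?W. tg_smul (act_coeff (g ** h) w z) (bas ((u @ x) @ z, g ** h ** k))))"
    unfolding bas_mult[of u g v h]
    by (subst tg_mult_sum_left) (auto intro!: fs_intros sum.cong simp: tg_mult_smul_left bas_mult)
  also have "\<dots> = (\<Sum>x\<in>?V. \<Sum>z\<in>?W. \<Sum>y\<in>?W.
       tg_smul (act_coeff h w y) (tg_smul (act_coeff g v x * act_coeff g y z) (bas (u @ x @ z, g ** h ** k))))"
    by (intro sum.cong refl)
      (simp add: tgv.scale_sum_right act_coeff_mult words_def tgv.scale_sum_left sum_distrib_left ac_simps)
  also have "\<dots> = (\<Sum>y\<in>?W. tg_smul (act_coeff h w y) (\<Sum>x\<in>?V. \<Sum>z\<in>?W.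
        tg_smul (act_coeff g v x * act_coeff g y z) (bas (u @ x @ z, g ** h ** k))))"
    apply (simp only: tgv.scale_sum_right)
    apply (subst sum.swap[where A = ?W and B = ?V])
    apply (rule sum.cong[OF refl])
    apply (rule sum.swap)
    done
  also have "\<dots> = (\<Sum>y\<in>?W. tg_smul (act_coeff h w y) (tg_mult (bas (u,g)) (bas (v @ y, h ** k))))"
    by (intro sum.cong refl) (simp add: R)
  also have "\<dots> = tg_mult (bas (u,g)) (tg_mult (bas (v,h)) (bas (w,k)))"
    unfolding bas_mult[of v h w k]
    by (subst tg_mult_sum_right) (auto intro!: fs_intros sum.cong simp: tg_mult_smul_right)
  finally show ?thesis .
qed

lemma tg_mult_assoc:
  assumes "fs a" "fs b" "fs d"
  shows "tg_mult (tg_mult a b) d = tg_mult a (tg_mult b d)"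
  using assms(1) subset_UNIV
proof (induction a rule: fs_induct)
  case (bas k p)
  show ?case using assms(2) subset_UNIV
  proof (induction b rule: fs_induct)
    case (bas k' q)
    show ?case using assms(3) subset_UNIV
    proof (induction d rule: fs_induct)
      case (bas k'' r)
      show ?case
        using tg_mult_assoc_bas[of "fst p" "snd p" "fst q" "snd q" "fst r" "snd r"]
        by (simp add: tg_mult_smul_right tg_mult_smul_left fs_intros)
    qed (simp_all add: tg_mult_add_right fs_intros)
  qed (simp_all add: tg_mult_add_right tg_mult_add_left fs_intros assms)
qed (simp_all add: tg_mult_add_left fs_intros assms)

lemma tg_one_bas: "tg_one = bas ([], mat 1)"
  by (auto simp: tg_one_def bas_def)

lemma tg_grp_bas: "tg_grp g = bas ([], g)"
  by (auto simp: tg_grp_def bas_def)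

lemma words_0 [simp]: "words 0 = {[]}"
  by (auto simp: words_def)

lemma bas_mult_grp: "tg_mult (bas (w, g)) (bas ([], h)) = bas (w, g ** h)"
  by (simp add: bas_mult)

lemma bas_mult_word: "tg_mult (bas (u, mat 1)) (bas (v, h)) = bas (u @ v, h)"
proof -
  have "tg_mult (bas (u, mat 1)) (bas (v, h)) = (\<Sum>w\<in>words (length v). if w = v then bas (u @ v, h) else 0)"
    unfolding bas_mult by (intro sum.cong) (auto simp: act_coeff_one)
  also have "\<dots> = bas (u @ v, h)"
    by (simp only: sum.delta'[OF finite_words] sum.delta[OF finite_words]) (simp add: words_def)
  finally show ?thesis .
qed

lemma tg_mult_one_left: "fs a \<Longrightarrow> tg_mult tg_one a = a"
proof (induction a rule: fs_induct[OF _ subset_UNIV, consumes 1, case_names zero add bas])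
  case (bas k p)
  then show ?case
    using bas_mult_word[of "[]" "fst p" "snd p"] by (simp add: tg_one_bas tg_mult_smul_right)
qed (simp_all add: tg_mult_add_right tg_one_bas)

lemma tg_mult_one_right: "fs a \<Longrightarrow> tg_mult a tg_one = a"
proof (induction a rule: fs_induct[OF _ subset_UNIV, consumes 1, case_names zero add bas])
  case (bas k p)
  then show ?case
    using bas_mult_grp[of "fst p" "snd p" "mat 1"] by (simp add: tg_one_bas tg_mult_smul_left)
qed (simp_all add: tg_mult_add_left tg_one_bas)

lemma tg_vec_sum: "tg_vec x = (\<Sum>i\<in>UNIV. tg_smul (x $ i) (bas ([i], mat 1)))"
proof
  fix r :: "'a list \<times> 'a cmat"
  have "(\<Sum>i\<in>UNIV. tg_smul (x $ i) (bas ([i], mat 1))) r =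
     (\<Sum>i\<in>UNIV. if i = hd (fst r) then tg_vec x r else 0)"
    unfolding sum_fun_apply
    by (intro sum.cong) (auto simp: bas_def tg_vec_def split_beta length_Suc_conv prod_eq_iff tg_apply)
  then show "tg_vec x r = (\<Sum>i\<in>UNIV. tg_smul (x $ i) (bas ([i], mat 1))) r" by simp
qed

lemma fs_vec: "fs (tg_vec x)"
  unfolding tg_vec_sum by (intro fs_intros)

lemma fs_one: "fs tg_one" by (simp add: tg_one_bas)
lemma fs_grp: "fs (tg_grp g)" by (simp add: tg_grp_bas)

lemma tg_vec_axis: "tg_vec (axis i 1) = bas ([i], mat 1)"
  by (auto simp: tg_vec_def bas_def axis_def fun_eq_iff length_Suc_conv)

lemma tg_vec_add: "tg_vec (x + y) = tg_vec x + tg_vec y"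
  by (auto simp: tg_vec_def fun_eq_iff tg_apply)

lemma tg_vec_smul: "tg_vec (k *s x) = tg_smul k (tg_vec x)"
  by (auto simp: tg_vec_def fun_eq_iff tg_apply)

lemma grp_mult_vec: "tg_mult (tg_grp g) (tg_vec x) = tg_mult (tg_vec (g *v x)) (tg_grp g)"
proof -
  have 1: "tg_mult (bas ([], g)) (bas ([i], mat 1)) = (\<Sum>j\<in>UNIV. tg_smul (g $ j $ i) (bas ([j], g)))" for i
    by (subst bas_mult) (simp add: sum_words_Suc)
  have "tg_mult (tg_grp g) (tg_vec x) = (\<Sum>i\<in>UNIV. \<Sum>j\<in>UNIV. tg_smul (x $ i * g $ j $ i) (bas ([j], g)))"
    unfolding tg_vec_sum tg_grp_bas
    by (subst tg_mult_sum_right)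
      (auto intro!: fs_intros sum.cong simp: tg_mult_smul_right 1 tgv.scale_sum_right)
  also have "\<dots> = (\<Sum>j\<in>UNIV. tg_smul ((g *v x) $ j) (bas ([j], g)))"
    by (subst sum.swap) (simp add: matrix_vector_mult_def tgv.scale_sum_left mult.commute)
  also have "\<dots> = tg_mult (tg_vec (g *v x)) (tg_grp g)"
    unfolding tg_vec_sum tg_grp_bas
    by (subst tg_mult_sum_left)
      (auto intro!: fs_intros sum.cong simp: tg_mult_smul_left bas_mult_grp)
  finally show ?thesis .
qed

lemma grp_mult_grp: "tg_mult (tg_grp g) (tg_grp h) = tg_grp (g ** h)"
  by (simp add: tg_grp_bas bas_mult_grp)

section \<open>The filtration by word length\<close>

definition Fil :: "('n::finite) cmat set \<Rightarrow> nat \<Rightarrow> 'n tg set" where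
  "Fil G k = {a \<in> TG_carrier G. \<forall>p\<in>supp a. length (fst p) \<le> k}"

lemma Fil_iff: "a \<in> Fil G k \<longleftrightarrow> fs a \<and> (\<forall>p\<in>supp a. length (fst p) \<le> k \<and> snd p \<in> G)"
  by (auto simp: Fil_def TG_carrier_def)

lemma Fil_mono: "a \<in> Fil G k \<Longrightarrow> k \<le> l \<Longrightarrow> a \<in> Fil G l"
  by (force simp: Fil_iff)

lemma TG_carrier_Fil: "a \<in> TG_carrier G \<longleftrightarrow> (\<exists>k. a \<in> Fil G k)"
proof
  assume a: "a \<in> TG_carrier G"
  then have f: "finite ((\<lambda>p. length (fst p)) ` supp a)" by (auto simp: TG_carrier_def)
  show "\<exists>k. a \<in> Fil G k"
    using a Max_ge[OF f] by (auto simp: Fil_def)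
qed (auto simp: Fil_def)

lemma subspace_Fil: "tgv.subspace (Fil G k)"
proof (rule tgv.subspaceI)
  show "x + y \<in> Fil G k" if "x \<in> Fil G k" "y \<in> Fil G k" for x y
    using that supp_add[of x y] by (auto simp: Fil_iff intro!: fs_add)
  show "tg_smul r x \<in> Fil G k" if "x \<in> Fil G k" for x r
    using that supp_smul[of r x] by (auto simp: Fil_iff intro!: fs_smul)
qed (simp add: Fil_iff)

lemma subspace_TG: "tgv.subspace (TG_carrier G)"
proof (rule tgv.subspaceI)
  show "x + y \<in> TG_carrier G" if "x \<in> TG_carrier G" "y \<in> TG_carrier G" for x y
    using that supp_add[of x y] by (auto simp: TG_carrier_def intro!: fs_add)
  show "tg_smul r x \<in> TG_carrier G" if "x \<in> TG_carrier G" for x r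
    using that supp_smul[of r x] by (auto simp: TG_carrier_def intro!: fs_smul)
qed (simp add: TG_carrier_def)

lemma bas_Fil: "length (fst p) \<le> k \<Longrightarrow> snd p \<in> G \<Longrightarrow> bas p \<in> Fil G k"
  by (simp add: Fil_iff)

lemma Fil_fs: "a \<in> Fil G k \<Longrightarrow> fs a" by (simp add: Fil_iff)
lemma TG_fs: "a \<in> TG_carrier G \<Longrightarrow> fs a" by (simp add: TG_carrier_def)

lemma Fil_mult:
  assumes G: "\<And>g h. g \<in> G \<Longrightarrow> h \<in> G \<Longrightarrow> g ** h \<in> G" and a: "a \<in> Fil G k" and b: "b \<in> Fil G l"
  shows "tg_mult a b \<in> Fil G (k + l)"
proof -
  note s = subspace_Fil[of G "k + l"]
  have "mcf p q \<in> Fil G (k + l)" if "p \<in> supp a" "q \<in> supp b" for p q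
  proof -
    obtain u g v h where pq: "p = (u,g)" "q = (v,h)" by force
    have "bas (u @ w, g ** h) \<in> Fil G (k + l)" if "w \<in> words (length v)" for w
      using a b that \<open>p \<in> supp a\<close> \<open>q \<in> supp b\<close>
      by (intro bas_Fil) (force simp: pq Fil_iff words_def intro: G add_mono)+
    then show ?thesis
      unfolding bas_mult_mcf[symmetric] pq bas_mult
      by (intro tgv.subspace_sum[OF s] tgv.subspace_scale[OF s])
  qed
  then show ?thesis
    by (subst tg_mult_eq[OF Fil_fs[OF a] subset_refl Fil_fs[OF b] subset_refl])
      (intro tgv.subspace_sum[OF s] tgv.subspace_scale[OF s])
qed

section \<open>The forms attached to symplectic reflections\<close>

lemma rank_mult_le_right:
  fixes A :: "'a::field^'n^'m" and B :: "'a^'k^'n"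
  shows "rank (A ** B) \<le> rank B"
proof -
  have "row i (A ** B) = (\<Sum>k\<in>UNIV. A $ i $ k *s row k B)" for i
    by (simp add: vec_eq_iff row_def matrix_matrix_mult_def)
  then have "row i (A ** B) \<in> vec.span (rows B)" for i
    by (simp only:) (intro vec.span_sum vec.span_scale vec.span_base, auto simp: rows_def)
  then show ?thesis
    unfolding row_rank_def_gen by (intro vec.dim_mono) (auto simp: rows_def)
qed

lemma rank_mult_le_left:
  fixes A :: "'a::field^'n^'m" and B :: "'a^'k^'n"
  shows "rank (A ** B) \<le> rank A"
proof -
  have "row i (A ** B) = transpose B *v row i A" for i
    by (simp add: vec_eq_iff row_def matrix_matrix_mult_def matrix_vector_mult_def transpose_def mult.commute)
  then have "rows (A ** B) = (*v) (transpose B) ` rows A"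
    by (auto simp: rows_def)
  then show ?thesis
    unfolding row_rank_def_gen
    by (metis vec.dim_image_le matrix_vector_mul_linear_gen)
qed

lemma matrix_diff_ldistrib: "A ** (B - C) = A ** B - A ** C"
  for A :: "'a::ring_1^'n^'m"
  by (vector matrix_matrix_mult_def sum_subtractf right_diff_distrib)

lemma matrix_diff_rdistrib: "(B - C) ** A = B ** A - C ** A"
  for A :: "'a::ring_1^'n^'m"
  by (vector matrix_matrix_mult_def sum_subtractf left_diff_distrib)

text \<open>Two vectors \<open>u\<close>, \<open>v\<close> spanning the row space write the matrix
  as a sum of two products of a column and a row; the two columns then span the range.\<close>

lemma rank_two_range:
  fixes A :: "'a::field^'n^'m"
  assumes "rank A = 2"
  shows "\<exists>p q. \<forall>x. \<exists>a b. A *v x = a *s p + b *s q"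
proof -
  obtain B where B: "rows A \<subseteq> vec.span B" "card B = 2"
    using vec.basis_exists[of "rows A"] assms unfolding row_rank_def_gen by metis
  then obtain u v where uv: "B = {u, v}" by (meson card_2_iff)
  have "\<exists>a b. row i A = a *s u + b *s v" for i
  proof -
    have "row i A \<in> vec.span {u, v}" using B uv by (auto simp: rows_def)
    then obtain a where "row i A - a *s u \<in> vec.span {v}"
      by (auto simp: vec.span_breakdown_eq)
    then obtain b where "row i A - a *s u - b *s v \<in> vec.span {}"
      by (auto simp: vec.span_breakdown_eq)
    then have "row i A = a *s u + b *s v" by (simp add: algebra_simps)
    then show ?thesis by blast
  qed
  then obtain a b where ab: "\<And>i. row i A = a i *s u + b i *s v" by metis
  have "A $ i $ j = a i * u $ j + b i * v $ j" for i j
    using ab[of i] by (simp add: vec_eq_iff row_def)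
  then have "A *v x = (\<Sum>j\<in>UNIV. u $ j * x $ j) *s (\<chi> i. a i) + (\<Sum>j\<in>UNIV. v $ j * x $ j) *s (\<chi> i. b i)" for x
    by (simp add: vec_eq_iff matrix_vector_mult_def sum_distrib_right distrib_right sum.distrib)
      (simp add: sum_distrib_left sum.distrib[symmetric] algebra_simps)
  then show ?thesis by blast
qed

text \<open>The property inside the description operator of \<open>omega_s\<close>, named so that
  its existence and uniqueness can be proved.\<close>

definition omega_char ::
  "(complex^('n::finite) \<Rightarrow> complex^'n \<Rightarrow> complex) \<Rightarrow> 'n cmat \<Rightarrow> (complex^'n \<Rightarrow> complex^'n \<Rightarrow> complex) \<Rightarrow> bool" where
  "omega_char om s f \<longleftrightarrow> cbilinear f \<and> (\<forall>x y. f x y = - f y x) \<and>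
      {x. \<forall>y. f x y = 0} = {x. (mat 1 - s) *v x = 0} \<and>
      (\<forall>x\<in>range (\<lambda>v. (mat 1 - s) *v v). \<forall>y\<in>range (\<lambda>v. (mat 1 - s) *v v). f x y = om x y)"

lemma cbilinearD:
  assumes "cbilinear f"
  shows "f (x + y) z = f x z + f y z" "f x (y + z) = f x y + f x z"
    "f (k *s x) y = k * f x y" "f x (k *s y) = k * f x y"
    "f 0 y = 0" "f x 0 = 0" "f (x - y) z = f x z - f y z" "f x (y - z) = f x y - f x z"
proof -
  have b: "f (x + y) z = f x z + f y z" "f x (y + z) = f x y + f x z"
    "f (k *s x) y = k * f x y" "f x (k *s y) = k * f x y" for x y z k
    using assms by (auto simp: cbilinear_def)
  show "f (x + y) z = f x z + f y z" "f x (y + z) = f x y + f x z"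
    "f (k *s x) y = k * f x y" "f x (k *s y) = k * f x y" by fact+
  show z: "f 0 y = 0" "f x 0 = 0" using b(1)[of 0 0 y] b(2)[of x 0 0] by auto
  show "f (x - y) z = f x z - f y z" using b(1)[of "x - y" y z] by simp
  show "f x (y - z) = f x y - f x z" using b(2)[of x "y - z" z] by simp
qed

lemma mat1_diff_apply: "(mat 1 - s) *v x = x - s *v x" for s :: "('n::finite) cmat"
  by (simp add: matrix_vector_mult_diff_rdistrib)

text \<open>\<open>Q\<close> is the projection onto the image of \<open>1 - s\<close> along the
  fixed space of \<open>s\<close>.\<close>

definition fixed_projection :: "('n::finite) cmat \<Rightarrow> (complex^'n \<Rightarrow> complex^'n) \<Rightarrow> bool" where
  "fixed_projection s Q \<longleftrightarrow> (\<forall>x y. Q (x + y) = Q x + Q y) \<and> (\<forall>k x. Q (k *s x) = k *s Q x) \<and>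
     (\<forall>x. s *v (x - Q x) = x - Q x) \<and> (\<forall>x. s *v x = x \<longrightarrow> Q x = 0) \<and>
     (\<forall>x. \<exists>y. Q x = y - s *v y) \<and> (\<forall>y. Q (y - s *v y) = y - s *v y)"

text \<open>Averaging over the powers of an operator of finite order projects onto its fixed space;
  \<open>Q\<close> is the complementary projection. The division by \<open>N\<close> uses
  characteristic zero.\<close>

lemma fixed_projection_exists:
  fixes s :: "('n::finite) cmat"
  assumes N: "N > 0" "\<And>x. (((*v) s) ^^ N) x = x"
  shows "\<exists>Q. fixed_projection s Q"
proof -
  define f where "f = (*v) s"
  have f_add: "f (x + y) = f x + f y" and f_smul: "f (k *s x) = k *s f x"
    and f_diff: "f (x - y) = f x - f y" for x y k
    by (simp_all add: f_def matrix_vector_right_distrib matrix_vector_mult_diff_distrib vector_scalar_commute)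
  have fk_add: "(f ^^ k) (x + y) = (f ^^ k) x + (f ^^ k) y" 
    and fk_smul: "(f ^^ k) (a *s x) = a *s (f ^^ k) x" 
    and fk_diff: "(f ^^ k) (x - y) = (f ^^ k) x - (f ^^ k) y" for k x y a
    by (induction k) (simp_all add: f_add f_smul f_diff)
  define S where "S x = (\<Sum>k<N. (f ^^ k) x)" for x
  define a :: complex where "a = 1 / of_nat N"
  have aN: "a *s (of_nat N *s x) = x" for x :: "complex^'n"
    using N by (simp add: a_def vector_smult_assoc)
  define Q where "Q x = x - a *s S x" for x
  have S_add: "S (x + y) = S x + S y" and S_smul: "S (k *s x) = k *s S x" 
    and S_diff: "S (x - y) = S x - S y" for x y k
    by (simp_all add: S_def fk_add fk_smul fk_diff sum.distrib vec.scale_sum_right sum_subtractf)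
  have fsum: "f (\<Sum>k\<in>I. h k) = (\<Sum>k\<in>I. f (h k))" for I :: "nat set" and h
    by (induction I rule: infinite_finite_induct) (use f_add f_smul[of 0 0] in auto)
  have tele: "(\<Sum>k<n. (f ^^ k) (y - f y)) = y - (f ^^ n) y" for n y
    by (induction n) (simp_all add: fk_diff funpow_swap1)
  have S_im: "S (y - f y) = 0" for y
    using tele[of y N] N(2)[of y] by (simp add: S_def f_def)
  have fS: "f (S x) = S x" for x
  proof -
    have "f (S x) = S (f x)" by (simp add: S_def fsum funpow_swap1)
    also have "\<dots> = S x" using S_im[of x] by (simp add: S_diff)
    finally show ?thesis .
  qed
  have S_fix: "S x = of_nat N *s x" if "f x = x" for x
  proof -
    have "(f ^^ k) x = x" for k by (induction k) (simp_all add: that)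
    then show ?thesis by (simp add: S_def vec_eq_iff)
  qed
  have imk: "\<exists>y. x - (f ^^ k) x = y - f y" for x k
    using tele[of x k] by (intro exI[of _ "\<Sum>j<k. (f ^^ j) x"]) (simp add: fsum fk_diff sum_subtractf funpow_swap1)
  \<comment> \<open>The difference is the sum of all \<open>x - s^k x\<close> for
    \<open>k < n\<close>; each lies in the image of \<open>1 - s\<close> by telescoping.\<close>
  have imS: "\<exists>y. of_nat n *s x - (\<Sum>k<n. (f ^^ k) x) = y - f y" for n x
  proof (induction n)
    case 0
    show ?case by (intro exI[of _ 0]) (use f_smul[of 0 0] in auto)
  next
    case (Suc n)
    then obtain y where y: "of_nat n *s x - (\<Sum>k<n. (f ^^ k) x) = y - f y" by auto
    obtain z where z: "x - (f ^^ n) x = z - f z" using imk by blast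
    have "of_nat (Suc n) *s x - (\<Sum>k<Suc n. (f ^^ k) x) =
       (of_nat n *s x - (\<Sum>k<n. (f ^^ k) x)) + (x - (f ^^ n) x)"
      by (simp add: vec.scale_left_distrib)
    also have "\<dots> = (y + z) - f (y + z)" by (simp add: y z f_add)
    finally show ?case by blast
  qed
  show ?thesis
    unfolding fixed_projection_def
  proof (intro exI[of _ Q] conjI allI impI)
    show "Q (x + y) = Q x + Q y" "Q (k *s x) = k *s Q x" for x y k
      by (simp_all add: Q_def S_add S_smul vec.scale_right_distrib vec.scale_right_diff_distrib vec.scale_left_commute)
    show "s *v (x - Q x) = x - Q x" for x
      using f_smul[of a "S x"] by (simp add: Q_def fS flip: f_def)
    show "Q x = 0" if "s *v x = x" for x
      using that aN[of x] by (simp add: Q_def S_fix flip: f_def)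
    show "\<exists>y. Q x = y - s *v y" for x
    proof -
      obtain y where y: "of_nat N *s x - S x = y - f y" using imS[of N x] by (auto simp: S_def)
      have "Q x = a *s (of_nat N *s x - S x)"
        by (simp only: Q_def vec.scale_right_diff_distrib aN)
      also have "\<dots> = a *s y - f (a *s y)" by (simp only: y f_smul vec.scale_right_diff_distrib)
      finally show ?thesis by (auto simp: f_def)
    qed
    show "Q (y - s *v y) = y - s *v y" for y
      using S_im[of y] by (simp add: Q_def f_def)
  qed
qed

text \<open>The witness is \<open>om (Q x) (Q y)\<close>. Since \<open>s\<close> preserves
  \<open>om\<close>, the image of \<open>1 - s\<close> is orthogonal to the fixed space, so
  non-degeneracy makes the radical exactly the fixed space. Uniqueness follows from
  \<open>x = (x - Q x) + Q x\<close>: the first summand lies in the radical, and on the second the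
  form is prescribed.\<close>

lemma omega_char_ex1:
  fixes s :: "('n::finite) cmat"
  assumes om: "symplectic_form om" and Sp: "in_Sp om s"
    and N: "N > 0" "\<And>x. (((*v) s) ^^ N) x = x"
  shows "\<exists>!f. omega_char om s f"
proof -
  obtain Q where Q: "fixed_projection s Q" using fixed_projection_exists[OF N] by blast
  then have Q_add: "\<And>x y. Q (x + y) = Q x + Q y" and Q_smul: "\<And>k x. Q (k *s x) = k *s Q x"
    and Q_fix: "\<And>x. s *v (x - Q x) = x - Q x" and Q_ker: "\<And>x. s *v x = x \<Longrightarrow> Q x = 0"
    and Q_im: "\<And>x. \<exists>y. Q x = y - s *v y" and Q_id: "\<And>y. Q (y - s *v y) = y - s *v y"
    unfolding fixed_projection_def by blast+
  have bil: "cbilinear om" and skew: "\<And>x y. om x y = - om y x"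
    and nd: "\<And>x. (\<And>y. om x y = 0) \<Longrightarrow> x = 0"
    using om unfolding symplectic_form_def by blast+
  note b = cbilinearD[OF bil]
  have inv: "om (s *v x) (s *v y) = om x y" for x y
    using Sp by (auto simp: in_Sp_def)
  have orth: "om (y - s *v y) z = 0" if "s *v z = z" for y z
    using inv[of y z] that by (simp add: b)
  define f where "f x y = om (Q x) (Q y)" for x y
  have f_bil: "cbilinear f"
    unfolding cbilinear_def by (simp add: f_def Q_add Q_smul b)
  have "omega_char om s f"
    unfolding omega_char_def
  proof (intro conjI allI ballI f_bil)
    show "f x y = - f y x" for x y unfolding f_def by (rule skew)
    show "{x. \<forall>y. f x y = 0} = {x. (mat 1 - s) *v x = 0}"
    proof (intro set_eqI iffI CollectI; clarsimp simp: mat1_diff_apply)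
      fix x assume 0: "\<forall>y. f x y = 0"
      have "om (Q x) y = 0" for y
      proof -
        obtain z where z: "Q x = z - s *v z" using Q_im by blast
        have "om (Q x) (y - Q y) = 0" unfolding z by (rule orth) (rule Q_fix)
        then show ?thesis using 0 by (simp add: b f_def)
      qed
      then have "Q x = 0" by (rule nd)
      then show "x = s *v x" using Q_fix[of x] by simp
    next
      fix x y assume "x = s *v x"
      then have "Q x = 0" using Q_ker[of x] by simp
      then show "f x y = 0" by (simp add: f_def b)
    qed
    show "f x y = om x y" if "x \<in> range ((*v) (mat 1 - s))" "y \<in> range ((*v) (mat 1 - s))" for x y
      using that by (auto simp: f_def mat1_diff_apply Q_id)
  qed
  moreover have "h = f" if h: "omega_char om s h" for h
  proof (intro ext)
    fix x y
    have hb: "cbilinear h" and hs: "\<And>x y. h x y = - h y x" 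
      using h unfolding omega_char_def by blast+
    note hb = cbilinearD[OF hb]
    have hk: "h z w = 0" if "s *v z = z" for z w
    proof -
      have "z \<in> {x. (mat 1 - s) *v x = 0}" using that by (simp add: mat1_diff_apply)
      then show ?thesis using h unfolding omega_char_def by blast
    qed
    have hk': "h w z = 0" if "s *v z = z" for z w
      using hk[OF that, of w] hs[of w z] by simp
    have R: "Q x \<in> range ((*v) (mat 1 - s))" for x
      using Q_im[of x] by (auto simp: mat1_diff_apply)
    have "h x y = h ((x - Q x) + Q x) ((y - Q y) + Q y)" by simp
    also have "\<dots> = h (Q x) (Q y)" by (simp only: hb(1,2) hk[OF Q_fix] hk'[OF Q_fix] add_0)
    also have "\<dots> = om (Q x) (Q y)" using h R unfolding omega_char_def by blast
    finally show "h x y = f x y" by (simp add: f_def)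
  qed
  ultimately show ?thesis by blast
qed

lemma omega_s_eq: "omega_s om s = (THE f. omega_char om s f)"
  by (simp add: omega_s_def omega_char_def)

section \<open>Invariance of the reflection forms under the group\<close>

locale sra =
  fixes om :: "complex^('n::finite) \<Rightarrow> complex^'n \<Rightarrow> complex"
    and G :: "'n cmat set" and t :: complex and c :: "'n cmat \<Rightarrow> complex"
  assumes triple: "symplectic_triple om G"
    and c_conj: "\<And>g s. g \<in> G \<Longrightarrow> s \<in> refls G \<Longrightarrow> c (g ** s ** matrix_inv g) = c s"
begin

lemma form: "symplectic_form om" and finite_G: "finite G" and one_G: "mat 1 \<in> G"
  and mult_G: "\<And>a b. a \<in> G \<Longrightarrow> b \<in> G \<Longrightarrow> a ** b \<in> G"
  and inv_G: "\<And>a. a \<in> G \<Longrightarrow> matrix_inv a \<in> G"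
  and Sp_G: "\<And>g. g \<in> G \<Longrightarrow> in_Sp om g"
  using triple unfolding symplectic_triple_def by blast+

lemma om_bil: "cbilinear om" and om_skew: "om x y = - om y x"
  using form unfolding symplectic_form_def by blast+

lemma refls_G: "s \<in> refls G \<Longrightarrow> s \<in> G"
  by (simp add: refls_def)

lemma inverse_G:
  assumes "g \<in> G"
  shows "g ** matrix_inv g = mat 1" "matrix_inv g ** g = mat 1"
    "g *v (matrix_inv g *v x) = x" "matrix_inv g *v (g *v x) = x"
proof -
  have "invertible g" using Sp_G[OF assms] by (simp add: in_Sp_def)
  then have "\<exists>A'. g ** A' = mat 1 \<and> A' ** g = mat 1" by (simp add: invertible_def)
  then have "g ** matrix_inv g = mat 1 \<and> matrix_inv g ** g = mat 1"
    unfolding matrix_inv_def by (rule someI_ex)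
  then show "g ** matrix_inv g = mat 1" "matrix_inv g ** g = mat 1" by auto
  then show "g *v (matrix_inv g *v x) = x" "matrix_inv g *v (g *v x) = x"
    by (simp_all add: matrix_vector_mul_assoc)
qed

text \<open>Two powers of \<open>s\<close> coincide because \<open>G\<close> is finite; injectivity
  of \<open>s\<close> cancels the smaller one.\<close>

lemma finite_order:
  assumes s: "s \<in> G"
  obtains N where "N > 0" "\<And>x. (((*v) s) ^^ N) x = x"
proof -
  define mp where "mp k = ((**) s ^^ k) (mat 1)" for k
  have mpG: "mp k \<in> G" for k
    by (induction k) (simp_all add: mp_def one_G mult_G s)
  have mpv: "(((*v) s) ^^ k) x = mp k *v x" for k x
    by (induction k) (simp_all add: mp_def matrix_vector_mul_assoc)
  have "\<not> inj mp"
    using finite_subset[of "range mp" G] mpG finite_G range_inj_infinite[of mp] by blast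
  then obtain i j where "mp i = mp j" "i \<noteq> j" by (auto simp: inj_on_def)
  then obtain i j where ij: "mp i = mp j" "i < j" by (metis nat_neq_iff)
  have inj: "inj ((*v) s)" by (rule inj_on_inverseI[of _ "(*v) (matrix_inv s)"]) (simp add: inverse_G[OF s])
  have "(((*v) s) ^^ (j - i)) x = x" for x
  proof -
    have "(((*v) s) ^^ i) ((((*v) s) ^^ (j - i)) x) = (((*v) s) ^^ i) x"
      using ij funpow_add[of i "j - i" "(*v) s"] by (simp add: mpv fun_eq_iff)
    then show ?thesis using inj_fn[OF inj, of i] by (simp add: inj_eq)
  qed
  moreover have "j - i > 0" using ij by simp
  ultimately show thesis by (rule that[rotated])
qed

lemma omega_ex1: "s \<in> G \<Longrightarrow> \<exists>!f. omega_char om s f"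
  by (rule finite_order) (assumption, rule omega_char_ex1[OF form Sp_G])

lemma omega_s_char: "s \<in> G \<Longrightarrow> omega_char om s (omega_s om s)"
  unfolding omega_s_eq by (rule theI'[OF omega_ex1])

lemma omega_s_unique: "s \<in> G \<Longrightarrow> omega_char om s f \<Longrightarrow> omega_s om s = f"
  using omega_ex1 omega_s_char by blast

lemma omega_s_bil: "s \<in> G \<Longrightarrow> cbilinear (omega_s om s)"
  and omega_s_skew: "s \<in> G \<Longrightarrow> omega_s om s x y = - omega_s om s y x"
  using omega_s_char[of s] unfolding omega_char_def by blast+

lemma omega_s_ker:
  assumes "s \<in> G" "s *v x = x"
  shows "omega_s om s x y = 0" "omega_s om s y x = 0"
proof -
  have "x \<in> {x. (mat 1 - s) *v x = 0}" using assms(2) by (simp add: mat1_diff_apply)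
  then show *: "omega_s om s x y = 0" for y
    using omega_s_char[OF assms(1)] unfolding omega_char_def by blast
  then show "omega_s om s y x = 0" using omega_s_skew[OF assms(1), of y x] by simp
qed

lemma conj_G: "g \<in> G \<Longrightarrow> s \<in> G \<Longrightarrow> g ** s ** matrix_inv g \<in> G"
  by (simp add: mult_G inv_G)

text \<open>The form of the conjugate, pulled back along \<open>g\<close>, has the defining property
  for \<open>s\<close>: \<open>g\<close> carries the fixed space of \<open>s\<close> and the image
  of \<open>1 - s\<close> to those of the conjugate, and it preserves \<open>om\<close>. Uniqueness
  does the rest.\<close>

lemma omega_s_conj:
  assumes g: "g \<in> G" and s: "s \<in> G"
  shows "omega_s om (g ** s ** matrix_inv g) (g *v x) (g *v y) = omega_s om s x y"
proof -
  let ?s = "g ** s ** matrix_inv g"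
  let ?f = "\<lambda>x y. omega_s om ?s (g *v x) (g *v y)"
  note ch = omega_s_char[OF conj_G[OF g s]]
  have sg: "?s *v (g *v x) = g *v (s *v x)" for x
    by (simp add: inverse_G[OF g] flip: matrix_vector_mul_assoc)
  have gi: "g *v x = g *v y \<longleftrightarrow> x = y" for x y by (metis inverse_G(4)[OF g])
  have "omega_char om s ?f"
    unfolding omega_char_def
  proof (intro conjI allI ballI)
    show "cbilinear ?f"
      unfolding cbilinear_def
      by (simp add: cbilinearD[OF omega_s_bil[OF conj_G[OF g s]]] matrix_vector_right_distrib vector_scalar_commute)
    show "?f x y = - ?f y x" for x y
      by (rule omega_s_skew[OF conj_G[OF g s]])
    have ker: "(\<forall>y. omega_s om ?s x y = 0) \<longleftrightarrow> x - ?s *v x = 0" for x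
      using ch unfolding omega_char_def set_eq_iff mem_Collect_eq mat1_diff_apply by blast
    show "{x. \<forall>y. ?f x y = 0} = {x. (mat 1 - s) *v x = 0}"
    proof (intro Collect_cong)
      fix x
      have "(\<forall>y. ?f x y = 0) \<longleftrightarrow> (\<forall>y. omega_s om ?s (g *v x) y = 0)"
        using inverse_G(3)[OF g] by metis
      also have "\<dots> \<longleftrightarrow> g *v x = g *v (s *v x)"
        unfolding ker sg by simp
      also have "\<dots> \<longleftrightarrow> (mat 1 - s) *v x = 0"
        unfolding gi mat1_diff_apply by simp
      finally show "(\<forall>y. ?f x y = 0) \<longleftrightarrow> (mat 1 - s) *v x = 0" .
    qed
    fix x y assume "x \<in> range ((*v) (mat 1 - s))" "y \<in> range ((*v) (mat 1 - s))"
    then obtain v w where vw: "x = v - s *v v" "y = w - s *v w" by (auto simp: mat1_diff_apply)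
    have agree: "omega_s om ?s x y = om x y"
      if "x \<in> range ((*v) (mat 1 - ?s))" "y \<in> range ((*v) (mat 1 - ?s))" for x y
      using ch that unfolding omega_char_def by blast
    have "g *v (v - s *v v) = (mat 1 - ?s) *v (g *v v)" for v
      by (simp add: mat1_diff_apply sg matrix_vector_mult_diff_distrib)
    then have "?f x y = om (g *v x) (g *v y)"
      unfolding vw by (intro agree) auto
    then show "?f x y = om x y" using Sp_G[OF g] by (simp add: in_Sp_def)
  qed
  from omega_s_unique[OF s this] show ?thesis by metis
qed

lemma refls_conj:
  assumes g: "g \<in> G" and s: "s \<in> refls G"
  shows "g ** s ** matrix_inv g \<in> refls G"
proof -
  have "mat 1 - g ** s ** matrix_inv g = g ** (mat 1 - s) ** matrix_inv g"
    by (simp add: matrix_diff_ldistrib matrix_diff_rdistrib inverse_G[OF g])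
  moreover have "rank (g ** (mat 1 - s) ** matrix_inv g) = rank (mat 1 - s)"
  proof (rule antisym)
    show "rank (g ** (mat 1 - s) ** matrix_inv g) \<le> rank (mat 1 - s)"
      by (meson rank_mult_le_left rank_mult_le_right order_trans)
    have "mat 1 - s = matrix_inv g ** (g ** (mat 1 - s) ** matrix_inv g) ** g"
      by (simp add: matrix_mul_assoc inverse_G[OF g]) 
        (simp add: inverse_G[OF g] flip: matrix_mul_assoc)
    then show "rank (mat 1 - s) \<le> rank (g ** (mat 1 - s) ** matrix_inv g)"
      by (metis rank_mult_le_left rank_mult_le_right order_trans)
  qed
  ultimately show ?thesis
    using s conj_G[OF g] by (auto simp: refls_def symp_refl_def)
qed

text \<open>Every term depends only on the images of \<open>x\<close>, \<open>y\<close>,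
  \<open>z\<close> under the projection \<open>Q\<close>, and by the rank condition these lie in the
  span of \<open>p\<close> and \<open>q\<close>. The cyclic sum is alternating in three vectors of a
  space of dimension at most two, hence zero; in coordinates it is a polynomial identity.\<close>

lemma jacobi:
  assumes s: "s \<in> refls G"
  shows "omega_s om s x y *s (z - s *v z) + omega_s om s y z *s (x - s *v x)
       + omega_s om s z x *s (y - s *v y) = 0"
proof -
  have sG: "s \<in> G" using s by (rule refls_G)
  obtain N where N: "N > 0" "\<And>x. (((*v) s) ^^ N) x = x" using finite_order[OF sG] by blast
  obtain Q where Q: "fixed_projection s Q" using fixed_projection_exists[OF N] by blast
  then have Q_fix: "\<And>x. s *v (x - Q x) = x - Q x" and Q_im: "\<And>x. \<exists>y. Q x = y - s *v y"
    unfolding fixed_projection_def by blast+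
  obtain p q where pq: "\<And>x. \<exists>a b. (mat 1 - s) *v x = a *s p + b *s q"
    using s rank_two_range[of "mat 1 - s"] unfolding refls_def symp_refl_def by blast
  then have ex: "\<exists>a b. Q x = a *s p + b *s q" for x
    using Q_im[of x] by (auto simp: mat1_diff_apply)
  obtain x1 x2 y1 y2 z1 z2 where xyz: "Q x = x1 *s p + x2 *s q" "Q y = y1 *s p + y2 *s q" "Q z = z1 *s p + z2 *s q"
    using ex by metis
  note ob = cbilinearD[OF omega_s_bil[OF sG]]
  have oQ: "omega_s om s x y = omega_s om s (Q x) (Q y)" for x y
  proof -
    have "omega_s om s ((x - Q x) + Q x) ((y - Q y) + Q y) = omega_s om s (Q x) (Q y)"
      by (simp only: ob(1,2) omega_s_ker[OF sG Q_fix] add_0)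
    then show ?thesis by simp
  qed
  have dQ: "x - s *v x = Q x - s *v Q x" for x
    using Q_fix[of x] by (simp add: matrix_vector_mult_diff_distrib algebra_simps)
  have "omega_s om s p p = 0" "omega_s om s q q = 0"
    using omega_s_skew[OF sG, of p p] omega_s_skew[OF sG, of q q] by simp_all
  then show ?thesis
    unfolding oQ[of x y] oQ[of y z] oQ[of z x] dQ[of x] dQ[of y] dQ[of z] xyz
    using omega_s_skew[OF sG, of q p]
    by (simp add: ob matrix_vector_right_distrib vector_scalar_commute vec_eq_iff)
       (simp add: algebra_simps)
qed

end

section \<open>Reduction to normal words\<close>

declare fs_intros [simp] fs_vec [simp] fs_one [simp] fs_grp [simp]

notation tg_mult (infixl "\<odot>" 70)

definition sortw :: "('n::finite) list \<Rightarrow> bool" where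
  "sortw w \<longleftrightarrow> sorted (map to_nat w)"

text \<open>A letter counts more the further left it stands, so moving the larger letter of a
  descent to the right lowers the sum.\<close>

fun mu :: "('n::finite) list \<Rightarrow> nat" where
  "mu [] = 0"
| "mu (x # xs) = to_nat x * Suc (length xs) + mu xs"

lemma mu_swap: "to_nat b < to_nat a \<Longrightarrow> mu (u @ b # a # v) < mu (u @ a # b # v)"
  by (induction u) auto

lemma not_sortw_descent:
  "\<not> sortw w \<Longrightarrow> \<exists>u a b v. w = u @ a # b # v \<and> to_nat b < to_nat a"
proof (induction w)
  case (Cons x w)
  show ?case
  proof (cases "sortw w")
    case True
    with Cons.prems obtain y w' where w: "w = y # w'" "to_nat y < to_nat x"
      by (cases w) (auto simp: sortw_def)
    then show ?thesis by (intro exI[of _ "[]"]) auto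
  next
    case False
    then obtain u a b v where "w = u @ a # b # v" "to_nat b < to_nat a" using Cons.IH by blast
    then show ?thesis by (intro exI[of _ "x # u"]) auto
  qed
qed (simp add: sortw_def)

lemma append_two_cases:
  assumes "u @ a # b # v = u' @ a' # b' # v'" "length u \<le> length u'"
  obtains "u = u'" "a = a'" "b = b'" "v = v'"
  | "u' = u @ [a]" "a' = b" "v = b' # v'"
  | z where "u' = u @ a # b # z" "v = z @ a' # b' # v'"
proof -
  from assms obtain y where y: "u' = u @ y" by (auto simp: append_eq_append_conv_if) (metis append_take_drop_id)
  show thesis
  proof (cases y)
    case Nil
    then show ?thesis using assms y that(1) by simp
  next
    case (Cons x y')
    then show ?thesis using assms y that(2,3) by (cases y') auto
  qed
qed

text \<open>Solvability of the equations \<open>F w - F w' = f\<close> for adjacent transpositions \<open>w'\<close> of \<open>w\<close>: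
  the hypotheses on \<open>f\<close> are the cocycle conditions for the Coxeter relations, and a function
  that satisfies one equation at a descent of each unsorted word satisfies all of them.\<close>

lemma swap_cocycle:
  fixes F :: "('n::finite) list \<Rightarrow> 'v::ab_group_add"
  assumes step: "\<And>w. length w = m \<Longrightarrow> \<not> sortw w \<Longrightarrow>
      \<exists>u a b v. w = u @ a # b # v \<and> to_nat b < to_nat a \<and> F w = F (u @ b # a # v) + f u a b v"
    and idem: "\<And>u a v. length u + length v + 2 = m \<Longrightarrow> f u a a v = 0"
    and anti: "\<And>u a b v. length u + length v + 2 = m \<Longrightarrow> f u b a v = - f u a b v"
    and comm: "\<And>u a b v d e z. length u + length v + length z + 4 = m \<Longrightarrow>
      f u a b (v @ d # e # z) + f (u @ b # a # v) d e z = f (u @ a # b # v) d e z + f u a b (v @ e # d # z)"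
    and braid: "\<And>u a b d v. length u + length v + 3 = m \<Longrightarrow>
      f u a b (d # v) + f (u @ [b]) a d v + f u b d (a # v)
        = f (u @ [a]) b d v + f u a d (b # v) + f (u @ [d]) a b v"
    and len: "length u + length v + 2 = m"
  shows "F (u @ a # b # v) = F (u @ b # a # v) + f u a b v"
proof -
  have desc: "F w = F (u @ b # a # v) + f u a b v"
    if "length w = m" "w = u @ a # b # v" "to_nat b < to_nat a" for w u a b v
    using that
  proof (induction "mu w" arbitrary: w u a b v rule: less_induct)
    case less
    have IH: "F (u @ a # b # v) = F (u @ b # a # v) + f u a b v"
      if "length (u @ a # b # v) = m" "to_nat b < to_nat a" "mu (u @ a # b # v) < mu w" for u a b v
      using less.hyps[OF that(3) that(1) refl that(2)] .
    \<comment> \<open>The results at two descents are compared by bringing both to a common word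
      through words of smaller \<open>mu\<close>, where the induction hypothesis supplies every
      swap. The descents coincide, share one letter, or are disjoint.\<close>
    have confl: "F (u @ b # a # v) + f u a b v = F (u' @ b' # a' # v') + f u' a' b' v'"
      if w: "w = u @ a # b # v" "w = u' @ a' # b' # v'" and lt: "to_nat b < to_nat a" "to_nat b' < to_nat a'"
        and le: "length u \<le> length u'" for u a b v u' a' b' v'
      using w(2)[unfolded w(1)] le
    proof (cases rule: append_two_cases)
      case 1
      then show ?thesis by simp
    next
      \<comment> \<open>The decreasing letters \<open>a\<close>, \<open>b\<close>, \<open>b'\<close>
        are reversed to \<open>b'\<close>, \<open>b\<close>, \<open>a\<close> along the two sides of
        a hexagon; \<open>braid\<close> equates the accumulated corrections.\<close>
      case 2
      note [simp] = 2
      have lw: "length u + length v' + 3 = m" using less.prems(1) w by simp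
      have lt2: "to_nat b' < to_nat a" using lt by simp
      have m1: "mu (u @ b # a # b' # v') < mu w" using mu_swap[OF lt(1), of u "b' # v'"] w by simp
      have m2: "mu (u @ b # b' # a # v') < mu w" using m1 mu_swap[OF lt2, of "u @ [b]" v'] by simp
      have m3: "mu (u @ a # b' # b # v') < mu w" using mu_swap[of b' b "u @ [a]" v'] lt w by simp
      have m4: "mu (u @ b' # a # b # v') < mu w" using m3 mu_swap[OF lt2, of u "b # v'"] by simp
      have "F (u @ b # a # b' # v') = F (u @ b # b' # a # v') + f (u @ [b]) a b' v'"
        using IH[of "u @ [b]" a b' v'] lw lt2 m1 by simp
      moreover have "F (u @ b # b' # a # v') = F (u @ b' # b # a # v') + f u b b' (a # v')"
        using IH[of u b b' "a # v'"] lw lt m2 by simp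
      moreover have "F (u @ a # b' # b # v') = F (u @ b' # a # b # v') + f u a b' (b # v')"
        using IH[of u a b' "b # v'"] lw lt2 m3 by simp
      moreover have "F (u @ b' # a # b # v') = F (u @ b' # b # a # v') + f (u @ [b']) a b v'"
        using IH[of "u @ [b']" a b v'] lw lt m4 by simp
      ultimately show ?thesis using braid[OF lw, of a b b'] by (simp add: algebra_simps)
    next
      case (3 z)
      note [simp] = 3
      have lw: "length u + length z + length v' + 4 = m" using less.prems(1) w by simp
      have m1: "mu (u @ b # a # z @ a' # b' # v') < mu w"
        using mu_swap[OF lt(1), of u "z @ a' # b' # v'"] w by simp
      have m2: "mu (u @ a # b # z @ b' # a' # v') < mu w"
        using mu_swap[OF lt(2), of "u @ a # b # z" v'] w by simp
      have "F (u @ b # a # z @ a' # b' # v') = F (u @ b # a # z @ b' # a' # v') + f (u @ b # a # z) a' b' v'"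
        using IH[of "u @ b # a # z" a' b' v'] lw lt m1 by simp
      moreover have "F (u @ a # b # z @ b' # a' # v') = F (u @ b # a # z @ b' # a' # v') + f u a b (z @ b' # a' # v')"
        using IH[of u a b "z @ b' # a' # v'"] lw lt m2 by simp
      ultimately show ?thesis using comm[OF lw, of a b a' b'] by (simp add: algebra_simps)
    qed
    have "\<not> sortw w"
      using less.prems by (auto simp: sortw_def sorted_append)
    then obtain u' a' b' v' where w': "w = u' @ a' # b' # v'" "to_nat b' < to_nat a'"
      and F: "F w = F (u' @ b' # a' # v') + f u' a' b' v'"
      using step less.prems(1) by blast
    show ?case
    proof (cases "length u \<le> length u'")
      case True
      then show ?thesis using confl[OF less.prems(2) w'(1) less.prems(3) w'(2)] F by simp
    next
      case False
      then show ?thesis using confl[OF w'(1) less.prems(2) w'(2) less.prems(3)] F by simp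
    qed
  qed
  \<comment> \<open>An ascending pair is a descending pair read backwards, with the sign from
    \<open>anti\<close>; equal letters are covered by \<open>idem\<close>.\<close>
  consider "to_nat b < to_nat a" | "to_nat a < to_nat b" | "a = b"
    by (metis inj_to_nat injD nat_neq_iff)
  then show ?thesis
  proof cases
    case 1
    then show ?thesis using desc[of "u @ a # b # v"] len by simp
  next
    case 2
    then have eq: "F (u @ b # a # v) = F (u @ a # b # v) + f u b a v"
      using desc[of "u @ b # a # v"] len by simp
    show ?thesis by (simp only: eq anti[OF len, where a = a and b = b]) simp
  next
    case 3
    then show ?thesis using idem[OF len] by simp
  qed
qed

text \<open>An arbitrary descent, fixed once per word so that the recursion for \<open>nf\<close> is
  deterministic; confluence later makes the choice immaterial.\<close>

definition pick :: "('n::finite) list \<Rightarrow> 'n list \<times> 'n \<times> 'n \<times> 'n list" where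
  "pick w = (SOME (u, a, b, v). w = u @ a # b # v \<and> to_nat b < to_nat a)"

lemma pick_descent:
  assumes "\<not> sortw w" "(u, a, b, v) = pick w"
  shows "w = u @ a # b # v \<and> to_nat b < to_nat a"
proof -
  have "\<exists>p. case p of (u, a, b, v) \<Rightarrow> w = u @ a # b # v \<and> to_nat b < to_nat a"
    using not_sortw_descent[OF assms(1)] by auto
  from someI_ex[OF this] show ?thesis
    using assms(2) unfolding pick_def by (auto split: prod.splits)
qed

abbreviation ax :: "'n::finite \<Rightarrow> complex^'n" where "ax i \<equiv> axis i 1"

section \<open>The bracket and the normal form map\<close>

context sra begin

text \<open>The value prescribed for the commutator of \<open>x\<close> and \<open>y\<close>. It has
  degree zero, so replacing a commutator by it shortens words by two letters; the inductions on
  length rest on this drop.\<close>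

definition kap :: "complex^'n \<Rightarrow> complex^'n \<Rightarrow> 'n tg" where
  "kap x y = tg_smul (t * om x y) tg_one
     + (\<Sum>s\<in>refls G. tg_smul (c s * omega_s om s x y) (tg_grp s))"

abbreviation rel :: "complex^'n \<Rightarrow> complex^'n \<Rightarrow> 'n tg" where
  "rel \<equiv> sra_rel om G t c"

lemma rel_eq: "rel x y = tg_vec x \<odot> tg_vec y - tg_vec y \<odot> tg_vec x - kap x y"
  by (simp add: sra_rel_def kap_def algebra_simps)

text \<open>One rewriting step at the picked descent: the swapped word, then the two parts of
  \<open>kap\<close>. In the last part a reflection \<open>s\<close> stands between \<open>u\<close>
  and \<open>v\<close>; moving it to the right end acts on \<open>v\<close>, which produces the sum
  over \<open>v'\<close> and the group element \<open>s ** g\<close>.\<close>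

function nf :: "'n list \<Rightarrow> 'n cmat \<Rightarrow> 'n tg" where
  "nf w g = (if sortw w then bas (w, g) else
     case pick w of (u, a, b, v) \<Rightarrow>
       nf (u @ b # a # v) g + tg_smul (t * om (ax a) (ax b)) (nf (u @ v) g)
       + (\<Sum>s\<in>refls G. tg_smul (c s * omega_s om s (ax a) (ax b))
           (\<Sum>v'\<in>words (length v). tg_smul (act_coeff s v v') (nf (u @ v') (s ** g)))))"
  by pat_completeness auto

termination nf
  \<comment> \<open>The swap keeps the length and lowers \<open>mu\<close>; the bracket terms are
    two letters shorter.\<close>
  by (relation "measures [\<lambda>(w, g). length w, \<lambda>(w, g). mu w]")
    (auto dest!: pick_descent simp: mu_swap words_def)

declare nf.simps [simp del]

definition N :: "'n tg \<Rightarrow> 'n tg" where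
  "N a = (\<Sum>p\<in>supp a. tg_smul (a p) (nf (fst p) (snd p)))"

lemma N_eq:
  assumes "finite S" "supp a \<subseteq> S"
  shows "N a = (\<Sum>p\<in>S. tg_smul (a p) (nf (fst p) (snd p)))"
  unfolding N_def using assms
  by (intro sum.mono_neutral_left) (auto simp: supp_def)

lemma N_add: 
  assumes "fs a" "fs b"
  shows "N (a + b) = N a + N b"
proof -
  let ?S = "supp a \<union> supp b"
  have f: "finite ?S" using assms by simp
  show ?thesis
    using supp_add[of a b]
    by (subst (1 2 3) N_eq[OF f]) (auto simp: sum.distrib tgv.scale_left_distrib plus_fun_apply)
qed

lemma N_smul: "fs a \<Longrightarrow> N (tg_smul k a) = tg_smul k (N a)"
  by (simp only: N_eq[OF _ supp_smul[of k a]] N_eq[OF _ subset_refl] tgv.scale_sum_right tgv.scale_scale)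
    (simp add: tg_smul_def)

lemma N_0 [simp]: "N 0 = 0"
  by (simp add: N_def)

lemma N_diff: "fs a \<Longrightarrow> fs b \<Longrightarrow> N (a - b) = N a - N b"
  using N_add[of "a - b" b] by simp

lemma N_sum: "(\<And>i. i \<in> I \<Longrightarrow> fs (f i)) \<Longrightarrow> N (\<Sum>i\<in>I. f i) = (\<Sum>i\<in>I. N (f i))"
  by (induction I rule: infinite_finite_induct) (auto simp: N_add)

lemma N_bas: "N (bas p) = nf (fst p) (snd p)"
  by (simp add: N_def) (simp add: bas_def)

lemma fs_kap [simp]: "fs (kap x y)"
  by (simp add: kap_def)

lemma fs_rel [simp]: "fs (rel x y)"
  by (simp add: rel_eq)

lemma word_kap_word:
  "bas (u, mat 1) \<odot> kap x y \<odot> bas (v, g) = tg_smul (t * om x y) (bas (u @ v, g))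
     + (\<Sum>s\<in>refls G. tg_smul (c s * omega_s om s x y)
         (\<Sum>v'\<in>words (length v). tg_smul (act_coeff s v v') (bas (u @ v', s ** g))))"
proof -
  have s: "bas (u, mat 1) \<odot> tg_grp s \<odot> bas (v, g)
     = (\<Sum>v'\<in>words (length v). tg_smul (act_coeff s v v') (bas (u @ v', s ** g)))" for s
    by (simp add: tg_grp_bas bas_mult_grp) (rule bas_mult)
  show ?thesis
    unfolding kap_def
    by (simp add: tg_mult_add_left tg_mult_add_right tg_mult_smul_left tg_mult_smul_right
        tg_mult_sum_left tg_mult_sum_right s tg_mult_one_right bas_mult_word)
qed

lemma nf_sorted: "sortw w \<Longrightarrow> nf w g = bas (w, g)"
  by (subst nf.simps) simp

text \<open>The bracket sums in \<open>nf\<close> are recognised as \<open>N\<close> of a single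
  product with \<open>kap\<close> in the middle. The descent is the same for all \<open>g\<close>,
  as inductions over words with arbitrary \<open>g\<close> require.\<close>

lemma nf_unsorted:
  assumes "\<not> sortw w"
  shows "\<exists>u a b v. w = u @ a # b # v \<and> to_nat b < to_nat a \<and>
    (\<forall>g. nf w g = nf (u @ b # a # v) g + N (bas (u, mat 1) \<odot> kap (ax a) (ax b) \<odot> bas (v, g)))"
proof -
  obtain u a b v where p: "pick w = (u, a, b, v)" by (metis prod_cases4)
  have "nf w g = nf (u @ b # a # v) g + N (bas (u, mat 1) \<odot> kap (ax a) (ax b) \<odot> bas (v, g))" for g
    unfolding word_kap_word using assms
    by (subst nf.simps) (simp add: p N_add N_sum N_smul N_bas add.assoc)
  then show ?thesis using pick_descent[OF assms p[symmetric]] by blast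
qed

text \<open>Induction along the recursion of \<open>nf\<close>. The hypothesis for all shorter words
  serves the monomials of the bracket term, whose letters are not controlled individually.\<close>

lemma unsorted_induct [case_names sorted unsorted]:
  assumes "\<And>w. sortw w \<Longrightarrow> P w"
    and "\<And>w u a b v. \<not> sortw w \<Longrightarrow> w = u @ a # b # v \<Longrightarrow> to_nat b < to_nat a \<Longrightarrow>
      (\<And>g. nf w g = nf (u @ b # a # v) g + N (bas (u, mat 1) \<odot> kap (ax a) (ax b) \<odot> bas (v, g))) \<Longrightarrow>
      P (u @ b # a # v) \<Longrightarrow> (\<And>w'. length w' < length w \<Longrightarrow> P w') \<Longrightarrow> P w"
  shows "P w"
proof (induction w rule: wf_induct[OF wf_measures[of "[length, mu]"]])
  case (1 w)
  show ?case
  proof (cases "sortw w")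
    case False
    from nf_unsorted[OF this] obtain u a b v where *: "w = u @ a # b # v" "to_nat b < to_nat a"
      "\<And>g. nf w g = nf (u @ b # a # v) g + N (bas (u, mat 1) \<odot> kap (ax a) (ax b) \<odot> bas (v, g))" by blast
    have "P (u @ b # a # v)" using 1 *(1) mu_swap[OF *(2), of u v] by simp
    moreover have "P w'" if "length w' < length w" for w' using 1 that by simp
    ultimately show ?thesis by (rule assms(2)[OF False *])
  qed (rule assms(1))
qed

lemma one_Fil: "tg_one \<in> Fil G k"
  by (simp add: tg_one_bas bas_Fil one_G)

lemma grp_Fil: "g \<in> G \<Longrightarrow> tg_grp g \<in> Fil G k"
  by (simp add: tg_grp_bas bas_Fil)

lemma vec_Fil: "tg_vec x \<in> Fil G 1"
  unfolding tg_vec_sum using subspace_Fil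
  by (intro tgv.subspace_sum tgv.subspace_scale bas_Fil) (auto simp: one_G)

lemma kap_Fil: "kap x y \<in> Fil G 0"
  unfolding kap_def
  by (intro tgv.subspace_add tgv.subspace_sum tgv.subspace_scale subspace_Fil one_Fil grp_Fil refls_G)

lemma Fil_mult_G: "a \<in> Fil G k \<Longrightarrow> b \<in> Fil G l \<Longrightarrow> a \<odot> b \<in> Fil G (k + l)"
  by (rule Fil_mult[OF mult_G])

lemma rel_Fil: "rel x y \<in> Fil G 2"
proof -
  have "tg_vec x \<odot> tg_vec y \<in> Fil G 2" for x y
    using Fil_mult_G[OF vec_Fil vec_Fil, of x y] by (simp add: numeral_2_eq_2)
  then show ?thesis
    unfolding rel_eq using Fil_mono[OF kap_Fil, of 2 x y]
    by (intro tgv.subspace_diff subspace_Fil) auto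
qed

lemma word_kap_word_Fil:
  "g \<in> G \<Longrightarrow> bas (u, mat 1) \<odot> kap x y \<odot> bas (v, g) \<in> Fil G (length u + length v)"
  using Fil_mult_G[OF Fil_mult_G[OF bas_Fil kap_Fil] bas_Fil, of "(u, mat 1)" "length u" "(v,g)" "length v"]
  by (simp add: one_G)

lemma N_Fil_aux:
  assumes "a \<in> Fil G k" "\<And>p. p \<in> supp a \<Longrightarrow> N (bas p) \<in> Fil G (length (fst p))"
  shows "N a \<in> Fil G k"
proof -
  have "N (bas p) \<in> Fil G k" if "p \<in> supp a" for p
    using assms Fil_mono[OF assms(2)[OF that], of k] that by (auto simp: Fil_iff)
  then have "nf (fst p) (snd p) \<in> Fil G k" if "p \<in> supp a" for p
    using that by (simp add: N_bas)
  then show ?thesis unfolding N_def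
    by (intro tgv.subspace_sum tgv.subspace_scale subspace_Fil)
qed

lemma nf_Fil: "g \<in> G \<Longrightarrow> nf w g \<in> Fil G (length w)"
proof (induction w arbitrary: g rule: unsorted_induct)
  case (sorted w)
  then show ?case by (simp add: nf_sorted bas_Fil)
next
  case (unsorted w u a b v)
  have "N (bas (u, mat 1) \<odot> kap (ax a) (ax b) \<odot> bas (v, g)) \<in> Fil G (length u + length v)"
  proof (rule N_Fil_aux[OF word_kap_word_Fil[OF unsorted.prems]])
    fix p assume "p \<in> supp (bas (u, mat 1) \<odot> kap (ax a) (ax b) \<odot> bas (v, g))"
    then have "length (fst p) \<le> length u + length v" "snd p \<in> G"
      using word_kap_word_Fil[OF unsorted.prems, of u "ax a" "ax b" v] by (auto simp: Fil_iff)
    then show "N (bas p) \<in> Fil G (length (fst p))"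
      using unsorted(6)[of "fst p" "snd p"] unsorted(2) by (simp add: N_bas)
  qed
  then have "N (bas (u, mat 1) \<odot> kap (ax a) (ax b) \<odot> bas (v, g)) \<in> Fil G (length w)"
    using unsorted(2) by (auto elim: Fil_mono)
  moreover have "nf (u @ b # a # v) g \<in> Fil G (length w)"
    using unsorted(5)[OF unsorted.prems] unsorted(2) by simp
  ultimately show ?case unfolding unsorted(4)
    by (intro tgv.subspace_add subspace_Fil)
qed

lemma N_Fil: "a \<in> Fil G k \<Longrightarrow> N a \<in> Fil G k"
  by (rule N_Fil_aux) (simp_all add: N_bas nf_Fil Fil_iff[of a])

lemma N_TG: "a \<in> TG_carrier G \<Longrightarrow> N a \<in> TG_carrier G"
  using N_Fil by (auto simp: TG_carrier_Fil)

text \<open>The span of the sorted words times group elements; it will serve as the model of the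
  quotient.\<close>

definition NF :: "'n tg set" where
  "NF = {a \<in> TG_carrier G. \<forall>p\<in>supp a. sortw (fst p)}"

lemma subspace_NF: "tgv.subspace NF"
proof (rule tgv.subspaceI)
  show "x + y \<in> NF" if "x \<in> NF" "y \<in> NF" for x y
    using that supp_add[of x y] tgv.subspace_add[OF subspace_TG] by (auto simp: NF_def)
  show "tg_smul r x \<in> NF" if "x \<in> NF" for x r
    using that supp_smul[of r x] tgv.subspace_scale[OF subspace_TG] by (auto simp: NF_def)
qed (simp add: NF_def TG_carrier_def)

lemma N_NF_id:
  assumes "a \<in> NF"
  shows "N a = a"
proof -
  have "N a = (\<Sum>p\<in>supp a. tg_smul (a p) (bas p))"
    unfolding N_def using assms by (intro sum.cong) (auto simp: NF_def nf_sorted)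
  also have "\<dots> = a" using assms by (intro tg_decomp[symmetric]) (auto simp: NF_def TG_carrier_def)
  finally show ?thesis .
qed

lemma nf_NF: "g \<in> G \<Longrightarrow> nf w g \<in> NF"
proof (induction w arbitrary: g rule: unsorted_induct)
  case (sorted w)
  then show ?case by (simp add: nf_sorted NF_def TG_carrier_def)
next
  case (unsorted w u a b v)
  have "N (bas (u, mat 1) \<odot> kap (ax a) (ax b) \<odot> bas (v, g)) \<in> NF"
    unfolding N_def using word_kap_word_Fil[OF unsorted.prems, of u "ax a" "ax b" v] unsorted(2)
    by (intro tgv.subspace_sum tgv.subspace_scale subspace_NF unsorted(6)) (fastforce simp: Fil_iff)+
  then show ?case unfolding unsorted(4)
    using unsorted(5)[OF unsorted.prems] by (intro tgv.subspace_add subspace_NF)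
qed

lemma N_NF: "a \<in> TG_carrier G \<Longrightarrow> N a \<in> NF"
  unfolding N_def by (intro tgv.subspace_sum tgv.subspace_scale subspace_NF nf_NF) (auto simp: TG_carrier_def)


lemma kap_add: "kap (x + x') y = kap x y + kap x' y" "kap x (y + y') = kap x y + kap x y'"
  unfolding kap_def
  by (simp_all add: cbilinearD(1,2)[OF om_bil] cbilinearD(1,2)[OF omega_s_bil[OF refls_G]]
      distrib_left tgv.scale_left_distrib sum.distrib)

lemma kap_smul: "kap (k *s x) y = tg_smul k (kap x y)" "kap x (k *s y) = tg_smul k (kap x y)"
  unfolding kap_def
  by (simp_all add: cbilinearD(3,4)[OF om_bil] cbilinearD(3,4)[OF omega_s_bil[OF refls_G]]
      tgv.scale_right_distrib tgv.scale_sum_right mult.left_commute)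

lemma kap_skew: "kap y x = - kap x y"
proof -
  have *: "om y x = - om x y" by (rule om_skew)
  have "(\<Sum>s\<in>refls G. tg_smul (c s * omega_s om s y x) (tg_grp s)) =
     - (\<Sum>s\<in>refls G. tg_smul (c s * omega_s om s x y) (tg_grp s))"
    unfolding sum_negf[symmetric]
  proof (intro sum.cong refl)
    fix s assume "s \<in> refls G"
    then have "omega_s om s y x = - omega_s om s x y" by (intro omega_s_skew refls_G)
    then show "tg_smul (c s * omega_s om s y x) (tg_grp s) = - tg_smul (c s * omega_s om s x y) (tg_grp s)"
      by (simp add: tgv.scale_minus_left)
  qed
  then show ?thesis unfolding kap_def * by (simp add: tgv.scale_minus_left)
qed

lemma kap_self: "kap x x = 0"
proof -
  have "kap x x + kap x x = 0" using kap_skew[of x x] by (metis ab_left_minus)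
  then have "tg_smul 2 (kap x x) = 0" using tgv.scale_left_distrib[of 1 1 "kap x x"] by simp
  then show ?thesis by (simp add: tgv.scale_eq_0_iff)
qed

lemma rel_add: "rel (x + x') y = rel x y + rel x' y" "rel x (y + y') = rel x y + rel x y'"
  and rel_smul: "rel (k *s x) y = tg_smul k (rel x y)" "rel x (k *s y) = tg_smul k (rel x y)"
  unfolding rel_eq
  by (simp_all add: kap_add kap_smul tg_vec_add tg_vec_smul tg_mult_add_left tg_mult_add_right
      tg_mult_smul_left tg_mult_smul_right tgv.scale_right_diff_distrib)

lemma rel_0: "rel 0 y = 0" "rel x 0 = 0"
  using rel_smul(1)[of 0 0 y] rel_smul(2)[of x 0 0] by simp_all

lemma rel_sum: "rel (\<Sum>i\<in>I. h i) y = (\<Sum>i\<in>I. rel (h i) y)" "rel x (\<Sum>i\<in>I. h i) = (\<Sum>i\<in>I. rel x (h i))"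
  by (induction I rule: infinite_finite_induct) (simp_all add: rel_add rel_0)

lemma rel_expand:
  "rel x y = (\<Sum>i\<in>UNIV. \<Sum>j\<in>UNIV. tg_smul (x $ i * y $ j) (rel (ax i) (ax j)))"
proof -
  have "rel x y = rel (\<Sum>i\<in>UNIV. x $ i *s ax i) (\<Sum>j\<in>UNIV. y $ j *s ax j)"
    by (simp add: basis_expansion)
  also have "\<dots> = (\<Sum>i\<in>UNIV. \<Sum>j\<in>UNIV. tg_smul (x $ i * y $ j) (rel (ax i) (ax j)))"
    by (subst rel_sum(1)) (simp add: rel_sum(2) rel_smul tgv.scale_sum_right mult.commute)
  finally show ?thesis .
qed

text \<open>Conjugation by \<open>h\<close> permutes the reflections and leaves \<open>c\<close> and
  the forms \<open>omega_s\<close> invariant, so reindexing the sum over reflections gives the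
  equivariance of the bracket.\<close>

lemma grp_kap:
  assumes h: "h \<in> G"
  shows "tg_grp h \<odot> kap x y = kap (h *v x) (h *v y) \<odot> tg_grp h"
proof -
  have bij: "bij_betw (\<lambda>s. h ** s ** matrix_inv h) (refls G) (refls G)"
  proof (rule bij_betw_byWitness[where f' = "\<lambda>s. matrix_inv h ** s ** h"])
    show "\<forall>s\<in>refls G. matrix_inv h ** (h ** s ** matrix_inv h) ** h = s"
      "\<forall>s\<in>refls G. h ** (matrix_inv h ** s ** h) ** matrix_inv h = s"
      by (auto simp: matrix_mul_assoc inverse_G[OF h])
        (auto simp: inverse_G[OF h] simp flip: matrix_mul_assoc)
    show "(\<lambda>s. h ** s ** matrix_inv h) ` refls G \<subseteq> refls G"
      using refls_conj[OF h] by auto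
    have "matrix_inv (matrix_inv h) = h"
      using inverse_G[OF h] inverse_G[OF inv_G[OF h]] by (metis matrix_mul_assoc matrix_mul_lid matrix_mul_rid)
    then show "(\<lambda>s. matrix_inv h ** s ** h) ` refls G \<subseteq> refls G"
      using refls_conj[OF inv_G[OF h]] by auto
  qed
  have om: "om (h *v x) (h *v y) = om x y" using Sp_G[OF h] by (simp add: in_Sp_def)
  have "(\<Sum>s\<in>refls G. tg_smul (c s * omega_s om s (h *v x) (h *v y)) (tg_grp (s ** h)))
     = (\<Sum>s\<in>refls G. tg_smul (c (h ** s ** matrix_inv h) * omega_s om (h ** s ** matrix_inv h) (h *v x) (h *v y))
         (tg_grp (h ** s ** matrix_inv h ** h)))"
    by (rule sum.reindex_bij_betw[OF bij, symmetric])
  also have "\<dots> = (\<Sum>s\<in>refls G. tg_smul (c s * omega_s om s x y) (tg_grp (h ** s)))"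
    by (intro sum.cong refl)
      (simp add: c_conj[OF h] omega_s_conj[OF h refls_G] inverse_G[OF h] flip: matrix_mul_assoc[of _ "matrix_inv h" h])
  finally show ?thesis
    unfolding kap_def om
    by (simp add: tg_mult_add_left tg_mult_add_right tg_mult_smul_left tg_mult_smul_right
        tg_mult_sum_left tg_mult_sum_right grp_mult_grp tg_mult_one_left tg_mult_one_right)
qed

lemma grp_rel:
  assumes h: "h \<in> G"
  shows "tg_grp h \<odot> rel x y = rel (h *v x) (h *v y) \<odot> tg_grp h"
proof -
  have "tg_grp h \<odot> (tg_vec x \<odot> tg_vec y) = tg_vec (h *v x) \<odot> tg_vec (h *v y) \<odot> tg_grp h" for x y
    by (simp add: tg_mult_assoc[symmetric] grp_mult_vec) (simp add: tg_mult_assoc grp_mult_vec)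
  then show ?thesis
    unfolding rel_eq by (simp add: tg_mult_diff_left tg_mult_diff_right grp_kap[OF h])
qed

text \<open>The scalar part of \<open>kap\<close> is central. Commuting \<open>z\<close> with a
  reflection \<open>s\<close> leaves, up to sign, the factor \<open>z - s z\<close>, so for each
  \<open>s\<close> the cyclic sum is \<open>jacobi\<close> multiplied by \<open>s\<close>.\<close>

lemma kap_jacobi:
  "(kap x y \<odot> tg_vec z - tg_vec z \<odot> kap x y) + (kap y z \<odot> tg_vec x - tg_vec x \<odot> kap y z)
     + (kap z x \<odot> tg_vec y - tg_vec y \<odot> kap z x) = 0"
proof -
  have comm: "kap x y \<odot> tg_vec z - tg_vec z \<odot> kap x y =
     - (\<Sum>s\<in>refls G. tg_smul (c s) (tg_vec (omega_s om s x y *s (z - s *v z)) \<odot> tg_grp s))" for x y z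
  proof -
    have vd: "tg_vec (z - w) = tg_vec z - tg_vec w" for z w :: "complex^'n"
      using tg_vec_add[of "z - w" w] by simp
    show ?thesis
      unfolding kap_def
      by (simp add: tg_mult_add_left tg_mult_add_right tg_mult_smul_left tg_mult_smul_right
        tg_mult_sum_left tg_mult_sum_right grp_mult_vec tg_mult_one_left tg_mult_one_right
        tg_vec_smul vd tg_mult_diff_left tgv.scale_right_diff_distrib sum_subtractf)
  qed
  have z: "tg_vec (omega_s om s x y *s (z - s *v z)) \<odot> tg_grp s
      + tg_vec (omega_s om s y z *s (x - s *v x)) \<odot> tg_grp s
      + tg_vec (omega_s om s z x *s (y - s *v y)) \<odot> tg_grp s = 0" if "s \<in> refls G" for s
  proof -
    have "tg_vec (0 :: complex^'n) = 0" using tg_vec_smul[of 0 "0 :: complex^'n"] by simp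
    then show ?thesis
      using jacobi[OF that, of x y z]
      by (simp add: tg_mult_add_left[symmetric] tg_vec_add[symmetric])
  qed
  have "(\<Sum>s\<in>refls G. tg_smul (c s) (tg_vec (omega_s om s x y *s (z - s *v z)) \<odot> tg_grp s))
     + (\<Sum>s\<in>refls G. tg_smul (c s) (tg_vec (omega_s om s y z *s (x - s *v x)) \<odot> tg_grp s))
     + (\<Sum>s\<in>refls G. tg_smul (c s) (tg_vec (omega_s om s z x *s (y - s *v y)) \<odot> tg_grp s)) = 0"
    unfolding sum.distrib[symmetric] tgv.scale_right_distrib[symmetric]
    by (intro sum.neutral ballI) (simp only: z tgv.scale_zero_right)
  then show ?thesis by (simp only: comm minus_add_distrib[symmetric] neg_equal_0_iff_equal)
qed

end

section \<open>The Poincare-Birkhoff-Witt property\<close>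

context sra begin

text \<open>A group element at the end of \<open>p\<close> is moved past the relation by
  equivariance. This changes the two vectors, which is why the relation is first extended bilinearly
  from basis vectors to all \<open>x\<close>, \<open>y\<close>. The budget \<open>m\<close> survives
  because group elements have degree zero.\<close>

lemma N_rel_extend:
  assumes D: "\<And>u a b v g. length u + length v + 2 \<le> m \<Longrightarrow> g \<in> G \<Longrightarrow>
      N (bas (u, mat 1) \<odot> rel (ax a) (ax b) \<odot> bas (v, g)) = 0"
    and p: "p \<in> Fil G i" and q: "q \<in> Fil G j" and m: "i + j + 2 \<le> m"
  shows "N (p \<odot> rel x y \<odot> q) = 0"
proof -
  have 1: "N (bas (u, mat 1) \<odot> rel x y \<odot> bas (v, g)) = 0"
    if "length u + length v + 2 \<le> m" "g \<in> G" for u v g x y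
    unfolding rel_expand[of x y]
    by (simp add: tg_mult_sum_left tg_mult_sum_right tg_mult_smul_left tg_mult_smul_right
        N_sum N_smul D[OF that])
  have 2: "N (bas (u, mat 1) \<odot> rel x y \<odot> q) = 0"
    if q: "q \<in> Fil G j" and "length u + j + 2 \<le> m" for u q x y
  proof -
    have "supp q \<subseteq> {r. length (fst r) \<le> j \<and> snd r \<in> G}" using q by (auto simp: Fil_iff)
    with Fil_fs[OF q] show ?thesis
    proof (induction q rule: fs_induct)
      case (bas k r)
      then show ?case using 1[of u "fst r" "snd r" x y] that(2)
        by (simp add: tg_mult_smul_right N_smul)
    qed (simp_all add: tg_mult_add_right N_add)
  qed
  have "supp p \<subseteq> {r. length (fst r) \<le> i \<and> snd r \<in> G}" using p by (auto simp: Fil_iff)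
  with Fil_fs[OF p] show ?thesis
  proof (induction p rule: fs_induct)
    case (bas k r)
    then obtain u h where r: "r = (u, h)" "length u \<le> i" "h \<in> G" by (cases r) auto
    have fsq: "fs q" using Fil_fs[OF q] .
    have "bas r = bas (u, mat 1) \<odot> tg_grp h"
      by (simp add: r tg_grp_bas bas_mult_word)
    then have "bas r \<odot> rel x y \<odot> q = bas (u, mat 1) \<odot> (tg_grp h \<odot> rel x y) \<odot> q"
      by (simp add: tg_mult_assoc)
    also have "\<dots> = bas (u, mat 1) \<odot> rel (h *v x) (h *v y) \<odot> (tg_grp h \<odot> q)"
      unfolding grp_rel[OF r(3)] by (simp add: tg_mult_assoc fsq)
    finally have "bas r \<odot> rel x y \<odot> q = bas (u, mat 1) \<odot> rel (h *v x) (h *v y) \<odot> (tg_grp h \<odot> q)" .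
    moreover have "tg_grp h \<odot> q \<in> Fil G j"
      using Fil_mult_G[OF grp_Fil[OF r(3), of 0] q] by simp
    ultimately have "N (bas r \<odot> rel x y \<odot> q) = 0" using 2 r(2) m by simp
    then show ?case using fsq by (simp add: tg_mult_smul_left N_smul)
  qed (simp_all add: tg_mult_add_left N_add Fil_fs[OF q])
qed

lemma word_expand:
  "bas (u @ [a], mat 1) = bas (u, mat 1) \<odot> tg_vec (ax a)"
  "bas (a # v, g) = tg_vec (ax a) \<odot> bas (v, g)"
  "bas (u @ v, g) = bas (u, mat 1) \<odot> bas (v, g)"
  by (simp_all add: tg_vec_axis bas_mult_word)

text \<open>For fixed total length this is \<open>swap_cocycle\<close> with
  \<open>F w = nf w g\<close> and the bracket terms as \<open>f\<close>. Only the condition on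
  disjoint swaps uses relations in shorter words, hence the strong induction; the other three follow
  from skewness and \<open>kap_jacobi\<close>.\<close>

lemma N_rel_words:
  assumes "length u + length v + 2 = m" "g \<in> G"
  shows "N (bas (u, mat 1) \<odot> rel (ax a) (ax b) \<odot> bas (v, g)) = 0"
  using assms
proof (induction m arbitrary: u a b v g rule: less_induct)
  case (less m)
  have kill: "N (p \<odot> rel x y \<odot> q) = 0"
    if "p \<in> Fil G i" "q \<in> Fil G j" "i + j + 2 < m" for p q i j x y
  proof (rule N_rel_extend[OF _ that(1,2)])
    show "i + j + 2 \<le> m - 1" using that(3) by simp
    show "N (bas (u, mat 1) \<odot> rel (ax a) (ax b) \<odot> bas (v, g)) = 0"
      if "length u + length v + 2 \<le> m - 1" "g \<in> G" for u a b v g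
      using less.IH[OF _ refl that(2)] that(1) less.prems(1) by force
  qed
  define f where "f u a b v = N (bas (u, mat 1) \<odot> kap (ax a) (ax b) \<odot> bas (v, g))" for u a b v
  have "nf (u @ a # b # v) g = nf (u @ b # a # v) g + f u a b v"
  proof (rule swap_cocycle[where m = m and F = "\<lambda>w. nf w g"])
    show "\<exists>u a b v. w = u @ a # b # v \<and> to_nat b < to_nat a \<and> nf w g = nf (u @ b # a # v) g + f u a b v"
      if "length w = m" "\<not> sortw w" for w
      using nf_unsorted[OF that(2)] unfolding f_def by blast
    show "f u a a v = 0" for u a v
      by (simp add: f_def kap_self)
    show "f u b a v = - f u a b v" for u a b v
    proof -
      have "f u a b v + f u b a v = N (bas (u, mat 1) \<odot> (kap (ax a) (ax b) + kap (ax b) (ax a)) \<odot> bas (v, g))"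
        unfolding f_def by (simp add: tg_mult_add_left tg_mult_add_right N_add)
      also have "kap (ax a) (ax b) + kap (ax b) (ax a) = 0" using kap_skew[of "ax b" "ax a"] by simp
      finally show ?thesis by (simp add: eq_neg_iff_add_eq_0 add.commute)
    qed
    show "f u a b (v @ d # e # z) + f (u @ b # a # v) d e z = f (u @ a # b # v) d e z + f u a b (v @ e # d # z)"
      if len: "length u + length v + length z + 4 = m" for u a b v d e z
    proof -
      let ?U = "bas (u, mat 1)" and ?V = "bas (v, mat 1)" and ?Z = "bas (z, g)"
      let ?k = "kap (ax a) (ax b)" and ?l = "kap (ax d) (ax e)"
      have U: "?U \<in> Fil G (length u)" and V: "?V \<in> Fil G (length v)" and Z: "?Z \<in> Fil G (length z)"
        using less.prems(2) by (auto intro!: bas_Fil one_G)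
      \<comment> \<open>Both sides of the condition rearrange to differences equal to
        \<open>N (?U \<odot> ?k \<odot> ?V \<odot> ?l \<odot> ?Z)\<close>, once by resolving the
        commutator of \<open>d\<close> and \<open>e\<close>, once that of \<open>a\<close> and
        \<open>b\<close>. The bracket already present leaves total length \<open>m - 2\<close>,
        within reach of \<open>kill\<close>.\<close>
      have "N (?U \<odot> ?k \<odot> ?V \<odot> rel (ax d) (ax e) \<odot> ?Z) = 0"
        using Fil_mult_G[OF Fil_mult_G[OF U kap_Fil] V] len by (intro kill[OF _ Z]) auto
      moreover have "N (?U \<odot> rel (ax a) (ax b) \<odot> (?V \<odot> ?l \<odot> ?Z)) = 0"
        using Fil_mult_G[OF Fil_mult_G[OF V kap_Fil] Z] len by (intro kill[OF U]) auto
      ultimately show ?thesis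
        unfolding f_def word_expand rel_eq
        by (simp add: tg_mult_diff_left tg_mult_diff_right N_diff tg_mult_assoc)
          (simp add: algebra_simps)
    qed
    show "f u a b (d # v) + f (u @ [b]) a d v + f u b d (a # v)
        = f (u @ [a]) b d v + f u a d (b # v) + f (u @ [d]) a b v" for u a b d v
    proof -
      let ?U = "bas (u, mat 1)" and ?V = "bas (v, g)"
      let ?J = "\<lambda>x y z. kap (ax x) (ax y) \<odot> tg_vec (ax z) - tg_vec (ax z) \<odot> kap (ax x) (ax y)"
      \<comment> \<open>The cyclic identity contains the pair \<open>d\<close>, \<open>a\<close>,
        the braid condition the pair \<open>a\<close>, \<open>d\<close>; hence the minus
        sign.\<close>
      have "kap (ax d) (ax a) = - kap (ax a) (ax d)" by (rule kap_skew)
      then have "?J a b d + ?J b d a - ?J a d b = 0"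
        using kap_jacobi[of "ax a" "ax b" "ax d"]
        by (simp add: tg_mult_uminus_left tg_mult_uminus_right algebra_simps)
      then have "N (?U \<odot> (?J a b d + ?J b d a - ?J a d b) \<odot> ?V) = 0" by simp
      then show ?thesis
        unfolding f_def word_expand tg_one_bas[symmetric]
        by (simp add: tg_mult_one_left tg_mult_diff_left tg_mult_diff_right tg_mult_add_left tg_mult_add_right
            N_diff N_add tg_mult_assoc algebra_simps)
    qed
    show "length u + length v + 2 = m" by (rule less.prems(1))
  qed
  moreover have "bas (u, mat 1) \<odot> rel (ax a) (ax b) \<odot> bas (v, g) =
     bas (u @ a # b # v, g) - bas (u @ b # a # v, g) - bas (u, mat 1) \<odot> kap (ax a) (ax b) \<odot> bas (v, g)"
    unfolding rel_eq word_expand by (simp add: tg_mult_diff_left tg_mult_diff_right tg_mult_assoc)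
  ultimately show ?case by (simp add: N_diff N_bas f_def)
qed

lemma N_rel: "p \<in> TG_carrier G \<Longrightarrow> q \<in> TG_carrier G \<Longrightarrow> N (p \<odot> rel x y \<odot> q) = 0"
  unfolding TG_carrier_Fil using N_rel_extend[OF N_rel_words[OF refl]] by blast

section \<open>The ideal as the kernel of the normal form map\<close>

abbreviation I :: "'n tg set" where "I \<equiv> sra_ideal om G t c"

lemma TG_mult: "a \<in> TG_carrier G \<Longrightarrow> b \<in> TG_carrier G \<Longrightarrow> a \<odot> b \<in> TG_carrier G"
  using Fil_mult_G unfolding TG_carrier_Fil by blast

lemma rel_TG: "rel x y \<in> TG_carrier G"
  using rel_Fil TG_carrier_Fil by blast

lemma I_TG: "i \<in> I \<Longrightarrow> i \<in> TG_carrier G"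
  by (induction rule: sra_ideal.induct)
    (auto intro!: TG_mult rel_TG tgv.subspace_0 tgv.subspace_add tgv.subspace_scale subspace_TG)

lemma N_I: "i \<in> I \<Longrightarrow> N i = 0"
proof (induction rule: sra_ideal.induct)
  case (id_add i j)
  then show ?case by (simp add: N_add TG_fs[OF I_TG])
next
  case (id_smul i k)
  then show ?case by (simp add: N_smul TG_fs[OF I_TG])
qed (simp_all add: N_rel)

lemma subspace_I: "tgv.subspace I"
  by (rule tgv.subspaceI) (auto intro: sra_ideal.intros)

lemma I_mult:
  assumes "i \<in> I" "a \<in> TG_carrier G"
  shows "a \<odot> i \<in> I" "i \<odot> a \<in> I"
proof -
  have "a \<odot> i \<in> I \<and> i \<odot> a \<in> I" using assms(1)
  proof (induction rule: sra_ideal.induct)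
    case (id_gen p q x y)
    note fss = TG_fs[OF assms(2)] TG_fs[OF id_gen(1)] TG_fs[OF id_gen(2)]
    have "a \<odot> (p \<odot> rel x y \<odot> q) = (a \<odot> p) \<odot> rel x y \<odot> q" "p \<odot> rel x y \<odot> q \<odot> a = p \<odot> rel x y \<odot> (q \<odot> a)"
      by (simp_all add: tg_mult_assoc fss)
    then show ?case using id_gen assms(2) by (auto intro!: sra_ideal.id_gen TG_mult)
  next
    case (id_add i j)
    then show ?case using TG_fs[OF I_TG] TG_fs[OF assms(2)]
      by (simp add: tg_mult_add_left tg_mult_add_right sra_ideal.id_add)
  next
    case (id_smul i k)
    then show ?case using TG_fs[OF I_TG] TG_fs[OF assms(2)]
      by (simp add: tg_mult_smul_left tg_mult_smul_right sra_ideal.id_smul)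
  qed (simp add: sra_ideal.id_zero)
  then show "a \<odot> i \<in> I" "i \<odot> a \<in> I" by auto
qed

lemma diff_N_aux:
  assumes "a \<in> TG_carrier G" "\<And>p. p \<in> supp a \<Longrightarrow> bas p - nf (fst p) (snd p) \<in> I"
  shows "a - N a \<in> I"
proof -
  have "a - N a = (\<Sum>p\<in>supp a. tg_smul (a p) (bas p)) - N a"
    using tg_decomp[OF TG_fs[OF assms(1)] subset_refl] by simp
  also have "\<dots> = (\<Sum>p\<in>supp a. tg_smul (a p) (bas p - nf (fst p) (snd p)))"
    unfolding N_def by (simp add: sum_subtractf tgv.scale_right_diff_distrib)
  also have "\<dots> \<in> I" using assms(2)
    by (intro tgv.subspace_sum tgv.subspace_scale subspace_I)
  finally show ?thesis .
qed

text \<open>Each rewriting step subtracts a relation placed between a word and a monomial, so a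
  monomial and its normal form are congruent.\<close>

lemma bas_diff_nf: "g \<in> G \<Longrightarrow> bas (w, g) - nf w g \<in> I"
proof (induction w arbitrary: g rule: unsorted_induct)
  case (sorted w)
  then show ?case by (simp add: nf_sorted sra_ideal.id_zero)
next
  case (unsorted w u a b v)
  let ?K = "bas (u, mat 1) \<odot> kap (ax a) (ax b) \<odot> bas (v, g)"
  have K: "?K \<in> Fil G (length u + length v)" by (rule word_kap_word_Fil[OF unsorted.prems])
  have 1: "?K - N ?K \<in> I"
  proof (rule diff_N_aux)
    show "?K \<in> TG_carrier G" using K TG_carrier_Fil by blast
    fix p assume "p \<in> supp ?K"
    then have "length (fst p) \<le> length u + length v" "snd p \<in> G"
      using K by (auto simp: Fil_iff)
    then show "bas p - nf (fst p) (snd p) \<in> I"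
      using unsorted(6)[of "fst p" "snd p"] unsorted(2) by simp
  qed
  have 2: "bas (u @ b # a # v, g) - nf (u @ b # a # v) g \<in> I"
    by (rule unsorted(5)[OF unsorted.prems])
  have "bas (u, mat 1) \<in> TG_carrier G" "bas (v, g) \<in> TG_carrier G"
    using unsorted.prems by (auto simp: TG_carrier_def one_G)
  then have 3: "bas (u, mat 1) \<odot> rel (ax a) (ax b) \<odot> bas (v, g) \<in> I" by (rule sra_ideal.id_gen)
  have "bas (w, g) - nf w g = bas (u, mat 1) \<odot> rel (ax a) (ax b) \<odot> bas (v, g)
     + (bas (u @ b # a # v, g) - nf (u @ b # a # v) g) + (?K - N ?K)"
    unfolding unsorted(4) unfolding unsorted(2) rel_eq word_expand
    by (simp add: tg_mult_diff_left tg_mult_diff_right tg_mult_assoc)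
  then show ?case using 1 2 3 by (auto intro: sra_ideal.id_add)
qed

lemma diff_N: "a \<in> TG_carrier G \<Longrightarrow> a - N a \<in> I"
  by (rule diff_N_aux) (auto simp: TG_carrier_def intro!: bas_diff_nf)

text \<open>Combines two facts: \<open>N\<close> kills the ideal, and \<open>a - N a\<close> lies in
  it. Thus \<open>N\<close> is a complete invariant of cosets, which contains the linear
  independence in the Poincare-Birkhoff-Witt property.\<close>

lemma N_eq_iff:
  assumes "a \<in> TG_carrier G" "b \<in> TG_carrier G"
  shows "N a = N b \<longleftrightarrow> a - b \<in> I"
proof
  assume "N a = N b"
  then have "a - b = (a - N a) - (b - N b)" by simp
  then show "a - b \<in> I" using assms by (metis diff_N tgv.subspace_diff[OF subspace_I])
next
  assume "a - b \<in> I"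
  from N_I[OF this] show "N a = N b" by (simp add: N_diff TG_fs[OF assms(1)] TG_fs[OF assms(2)])
qed

definition srt :: "'n list \<Rightarrow> 'n list" where "srt w = sort_key to_nat w"

lemma sortw_srt: "sortw (srt w)" and length_srt [simp]: "length (srt w) = length w"
  by (simp_all add: sortw_def srt_def)

lemma srt_eq: "mset u = mset w \<Longrightarrow> sortw w \<Longrightarrow> srt u = w"
  unfolding srt_def sortw_def
  by (rule properties_for_sort_key) (auto simp: inj_on_def replicate_count_mset_eq_filter_eq[symmetric])

text \<open>Swaps permute letters and bracket terms are shorter, so the top-degree part of a normal
  form is the sorted word with coefficient one: in the associated graded algebra the vectors
  commute.\<close>

lemma nf_leading: "g \<in> G \<Longrightarrow> nf w g - bas (srt w, g) \<in> Fil G (length w - 1)"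
proof (induction w arbitrary: g rule: unsorted_induct)
  case (sorted w)
  then show ?case using tgv.subspace_0[OF subspace_Fil] by (simp add: nf_sorted srt_eq)
next
  case (unsorted w u a b v)
  have "srt w = srt (u @ b # a # v)"
    by (rule srt_eq) (simp_all add: sortw_srt unsorted(2), simp add: srt_def)
  moreover have "N (bas (u, mat 1) \<odot> kap (ax a) (ax b) \<odot> bas (v, g)) \<in> Fil G (length w - 1)"
    using N_Fil[OF word_kap_word_Fil[OF unsorted.prems, of u "ax a" "ax b" v]] unsorted(2)
    by (auto elim: Fil_mono)
  moreover have "nf (u @ b # a # v) g - bas (srt (u @ b # a # v), g) \<in> Fil G (length w - 1)"
    using unsorted(5)[OF unsorted.prems] unsorted(2) by simp
  ultimately have "(nf (u @ b # a # v) g - bas (srt (u @ b # a # v), g))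
    + N (bas (u, mat 1) \<odot> kap (ax a) (ax b) \<odot> bas (v, g)) \<in> Fil G (length w - 1)"
    by (intro tgv.subspace_add subspace_Fil)
  then show ?case unfolding unsorted(4) \<open>srt w = srt (u @ b # a # v)\<close> by (simp add: algebra_simps)
qed

end

section \<open>Isoperimetry and leading monomials\<close>

text \<open>\<open>x powr \<theta>\<close> is \<open>x\<close> times
  \<open>x powr (\<theta> - 1)\<close>, and the second factor does not increase with
  \<open>x\<close>. This gives a lower bound linear in the slice size \<open>x\<close>, which can be
  summed over slices of size at most \<open>M\<close>.\<close>

lemma powr_weighted_le:
  fixes M :: real
  assumes "0 \<le> x" "x \<le> M" "\<theta> \<le> 1"
  shows "x * M powr (\<theta> - 1) \<le> x powr \<theta>"
proof (cases "x = 0")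
  case False
  then have "M powr (\<theta> - 1) \<le> x powr (\<theta> - 1)"
    using assms by (intro powr_mono2') auto
  then have "x * M powr (\<theta> - 1) \<le> x powr 1 * x powr (\<theta> - 1)"
    using assms False by (simp add: mult_left_mono)
  then show ?thesis unfolding powr_add[symmetric] by simp
qed simp

text \<open>A sum form of the discrete Loomis-Whitney inequality, by slicing along one coordinate.\<close>

lemma sum_card_projections_ge:
  fixes A :: "('i \<Rightarrow> nat) set"
  assumes "finite I" "I \<noteq> {}" "finite A"
  shows "real (card A) powr ((real (card I) - 1) / real (card I))
     \<le> (\<Sum>i\<in>I. real (card ((\<lambda>a. a(i := 0)) ` A)))"
  using assms
proof (induction I arbitrary: A rule: finite_ne_induct)
  case (singleton i)
  show ?case
  proof (cases "A = {}")
    case False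
    then have "card ((\<lambda>a. a(i := 0)) ` A) \<noteq> 0" using singleton by simp
    then have "1 \<le> real (card ((\<lambda>a. a(i := 0)) ` A))" by linarith
    moreover have "real (card A) powr ((real (card {i}) - 1) / real (card {i})) \<le> 1" by simp
    ultimately show ?thesis by (simp del: fun_upd_apply)
  qed simp
next
  case (insert j F)
  let ?p = "\<lambda>i (a :: 'i \<Rightarrow> nat). a(i := 0)"
  show ?case
  proof (cases "A = {}")
    case False
    define k where "k = real (card F)"
    define n where "n = real (card A)"
    define M where "M = real (card (?p j ` A))"
    define V where "V = (\<lambda>a. a j) ` A"
    define B where "B v = {a \<in> A. a j = v}" for v
    have k1: "k \<ge> 1" using insert.hyps by (simp add: k_def Suc_le_eq card_gt_0_iff)
    have n1: "n > 0" using False insert.prems by (simp add: n_def card_gt_0_iff)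
    have M1: "M > 0" using False insert.prems by (simp add: M_def card_gt_0_iff)
    have finV: "finite V" and finB: "finite (B v)" for v
      using insert.prems by (simp_all add: V_def B_def)
    have A: "A = (\<Union>v\<in>V. B v)" by (auto simp: V_def B_def)
    have BM: "real (card (B v)) \<le> M" for v
    proof -
      have "inj_on (?p j) (B v)"
        by (rule inj_on_inverseI[where g = "\<lambda>a. a(j := v)"]) (auto simp: B_def)
      then have "card (B v) = card (?p j ` B v)" by (simp add: card_image)
      also have "\<dots> \<le> card (?p j ` A)" using insert.prems by (intro card_mono) (auto simp: B_def)
      finally show ?thesis by (simp add: M_def)
    qed
    have "n = (\<Sum>v\<in>V. real (card (B v)))"
      unfolding n_def by (subst A, subst card_UN_disjoint) (use finV finB in \<open>auto simp: B_def\<close>)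
    then have "n * M powr ((k - 1) / k - 1) = (\<Sum>v\<in>V. real (card (B v)) * M powr ((k - 1) / k - 1))"
      by (simp add: sum_distrib_right)
    also have "\<dots> \<le> (\<Sum>v\<in>V. real (card (B v)) powr ((k - 1) / k))"
      using k1 BM by (intro sum_mono powr_weighted_le) (auto simp: divide_simps)
    also have "\<dots> \<le> (\<Sum>v\<in>V. \<Sum>i\<in>F. real (card (?p i ` B v)))"
      unfolding k_def by (intro sum_mono insert.IH finB)
    also have "\<dots> = (\<Sum>i\<in>F. \<Sum>v\<in>V. real (card (?p i ` B v)))"
      by (rule sum.swap)
    also have "\<dots> = (\<Sum>i\<in>F. real (card (?p i ` A)))"
    proof (intro sum.cong refl)
      fix i assume i: "i \<in> F"
      then have ij: "i \<noteq> j" using insert.hyps by auto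
      have "?p i ` B v \<inter> ?p i ` B w = {}" if "v \<noteq> w" for v w
        using that ij by (auto simp: B_def fun_eq_iff split: if_splits)
      moreover have "?p i ` A = (\<Union>v\<in>V. ?p i ` B v)" by (subst A) auto
      ultimately show "(\<Sum>v\<in>V. real (card (?p i ` B v))) = real (card (?p i ` A))"
        using finV finB by (simp add: card_UN_disjoint)
    qed
    finally have F: "n * M powr ((k - 1) / k - 1) \<le> (\<Sum>i\<in>F. real (card (?p i ` A)))" .
    have e1: "(k - 1) / k - 1 = - 1 / k" using k1 by (simp add: field_simps)
    \<comment> \<open>Either the projection along \<open>j\<close> is already large enough, or
      \<open>M\<close> is so small that \<open>n * M powr (- 1 / k)\<close> is. The threshold is the
      value of \<open>M\<close> at which the two terms balance.\<close>
    have "n powr (k / (k + 1)) \<le> M + n * M powr (- 1 / k)"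
    proof (cases "n powr (k / (k + 1)) \<le> M")
      case True
      then show ?thesis using n1 by (simp add: add_increasing2)
    next
      case False
      then have "(n powr (k / (k + 1))) powr (- 1 / k) \<le> M powr (- 1 / k)"
        using M1 k1 by (intro powr_mono2') auto
      moreover have "(n powr (k / (k + 1))) powr (- 1 / k) = n powr (- 1 / (k + 1))"
        using k1 by (simp add: powr_powr)
      ultimately have "n powr 1 * n powr (- 1 / (k + 1)) \<le> n * M powr (- 1 / k)"
        using n1 by simp
      moreover have "1 + - 1 / (k + 1) = k / (k + 1)" using k1 by (simp add: field_simps)
      ultimately show ?thesis using M1 unfolding powr_add[symmetric] by simp
    qed
    also have "\<dots> \<le> M + (\<Sum>i\<in>F. real (card (?p i ` A)))" using F e1 by simp
    finally show ?thesis
      using insert.hyps by (simp add: k_def n_def M_def add.commute del: fun_upd_apply)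
  qed simp
qed

text \<open>On each line in direction \<open>i\<close> that meets \<open>A\<close>, the highest
  point of \<open>A\<close> is shifted out of \<open>A\<close>. New points on different lines
  differ, and the lines correspond to the points of the projection.\<close>

lemma card_shift_ge:
  fixes A :: "('i \<Rightarrow> nat) set"
  assumes "finite A" "finite S" "A \<subseteq> S" "(\<lambda>a. a(i := Suc (a i))) ` A \<subseteq> S"
  shows "card A + card ((\<lambda>a. a(i := 0)) ` A) \<le> card S"
proof -
  let ?p = "\<lambda>a. a(i := 0 :: nat)"
  have "\<exists>b. b \<in> S - A \<and> ?p b = q" if q: "q \<in> ?p ` A" for q
  proof -
    define L where "L = {a \<in> A. ?p a = q}"
    have L: "finite L" "L \<noteq> {}" using assms(1) q by (auto simp: L_def)
    define m where "m = Max ((\<lambda>a. a i) ` L)"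
    have "m \<in> (\<lambda>a. a i) ` L" unfolding m_def using L by (intro Max_in) auto
    then obtain a where a: "a \<in> L" "a i = m" by auto
    let ?b = "a(i := Suc (a i))"
    have "?b \<notin> A"
    proof
      assume "?b \<in> A"
      then have "?b \<in> L" using a by (auto simp: L_def)
      then have "?b i \<in> (\<lambda>a. a i) ` L" by (rule imageI)
      then have "?b i \<le> m" unfolding m_def using L by (intro Max_ge) auto
      then show False using a by simp
    qed
    moreover have "?b \<in> S" using assms(4) a by (auto simp: L_def)
    moreover have "?p ?b = q" using a by (auto simp: L_def)
    ultimately show ?thesis by blast
  qed
  then have "?p ` A \<subseteq> ?p ` (S - A)" by (metis (no_types, lifting) image_eqI subsetI)
  then have "card (?p ` A) \<le> card (S - A)"
    using assms(2) by (meson card_image_le card_mono finite_Diff finite_imageI order_trans)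
  also have "\<dots> = card S - card A" using assms by (simp add: card_Diff_subset)
  finally show ?thesis using card_mono[OF assms(2,3)] by simp
qed

section \<open>Leading monomials and dimension\<close>

definition leads :: "('n list \<times> 'n cmat \<Rightarrow> 'k::linorder) \<Rightarrow> ('n::finite) tg set \<Rightarrow> ('n list \<times> 'n cmat) set" where
  "leads key X = {p. \<exists>x\<in>X. p \<in> supp x \<and> (\<forall>q\<in>supp x. key q \<le> key p)}"

lemma subspace_vanish: "tgv.subspace {a. a p = 0}"
  by (rule tgv.subspaceI) (auto simp: tg_apply)

text \<open>Echelon form: an element whose leading monomial is the largest of \<open>S\<close> is
  not in the span of elements supported strictly below it. The bound on supports in the conclusion
  keeps this available through the induction.\<close>

lemma leads_independent:
  fixes key :: "('n::finite) list \<times> 'n cmat \<Rightarrow> 'k::linorder"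
  assumes "finite S" "S \<subseteq> leads key X" "inj_on key S"
  shows "\<exists>B\<subseteq>X. finite B \<and> tgv.independent B \<and> card B = card S \<and>
    (\<forall>x\<in>B. \<forall>q\<in>supp x. \<exists>p\<in>S. key q \<le> key p)"
  using assms
proof (induction "card S" arbitrary: S)
  case 0
  then show ?case by (intro exI[of _ "{}"]) (auto simp: tgv.independent_empty)
next
  case (Suc n)
  then have "S \<noteq> {}" "finite (key ` S)" by auto
  then have "Max (key ` S) \<in> key ` S" by (intro Max_in) auto
  then obtain p where p: "p \<in> S" "key p = Max (key ` S)" by auto
  have "key q \<le> key p" if "q \<in> S" for q
    unfolding p(2) using Suc.prems that by (intro Max_ge) auto
  then have lt: "key q < key p" if "q \<in> S - {p}" for q
    using that p(1) Suc.prems(3) unfolding inj_on_def by (metis Diff_iff insertI1 order_le_less)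
  have "n = card (S - {p})" using Suc.hyps(2) Suc.prems(1) p(1) by simp
  have "finite (S - {p})" "S - {p} \<subseteq> leads key X" "inj_on key (S - {p})"
    using Suc.prems by (auto simp: inj_on_diff)
  from Suc.hyps(1)[OF \<open>n = card (S - {p})\<close> this]
  obtain B where B: "B \<subseteq> X" "finite B" "tgv.independent B" "card B = card (S - {p})"
    "\<forall>x\<in>B. \<forall>q\<in>supp x. \<exists>p'\<in>S - {p}. key q \<le> key p'"
    by blast
  obtain x where x: "x \<in> X" "p \<in> supp x" "\<And>q. q \<in> supp x \<Longrightarrow> key q \<le> key p"
    using Suc.prems(2) p(1) unfolding leads_def by blast
  have "B \<subseteq> {a. a p = 0}"
  proof (intro subsetI CollectI, rule ccontr)
    fix b assume "b \<in> B" "b p \<noteq> 0"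
    then obtain q where "q \<in> S - {p}" "key p \<le> key q" using B(5) unfolding supp_def by blast
    then show False using lt[of q] by simp
  qed
  then have "tgv.span B \<subseteq> {a. a p = 0}"
    by (intro tgv.span_minimal subspace_vanish)
  then have nx: "x \<notin> tgv.span B" using x(2) by (auto simp: supp_def)
  then have "x \<notin> B" using tgv.span_base by blast
  have "tgv.independent (insert x B)" using nx B(3) by (simp add: tgv.independent_insert)
  moreover have "card (insert x B) = card S"
    using \<open>x \<notin> B\<close> B(2,4) Suc.hyps(2) \<open>n = card (S - {p})\<close> by simp
  moreover have "\<forall>y\<in>insert x B. \<forall>q\<in>supp y. \<exists>p\<in>S. key q \<le> key p"
    using x(3) p(1) B(5) by blast
  ultimately show ?case using B(1,2) x(1) by (intro exI[of _ "insert x B"]) auto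
qed

lemma card_leads_le_dim:
  fixes key :: "('n::finite) list \<times> 'n cmat \<Rightarrow> 'k::linorder"
  assumes "S \<subseteq> leads key X" "finite S" "inj_on key S"
    and "finite B" "X \<subseteq> tgv.span B"
  shows "card S \<le> tgv.dim X"
proof -
  obtain C where C: "C \<subseteq> X" "finite C" "tgv.independent C" "card C = card S"
    using leads_independent[OF assms(2,1,3)] by blast
  obtain D where D: "D \<subseteq> X" "tgv.independent D" "X \<subseteq> tgv.span D" "card D = tgv.dim X"
    using tgv.basis_exists by blast
  have "finite D" using tgv.independent_span_bound[OF assms(4) D(2)] D(1) assms(5) by auto
  then show ?thesis
    using tgv.independent_span_bound[OF _ C(3)] C(1,4) D(3,4) by (metis order_trans)
qed

text \<open>Gaussian elimination: subtracting a multiple of a chosen element with the same leading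
  monomial removes the leading term. The measure counts the members of the finite set
  \<open>Q\<close> at or below some monomial of the support.\<close>

lemma dim_le_card_leads:
  fixes key :: "('n::finite) list \<times> 'n cmat \<Rightarrow> 'k::linorder"
  assumes X: "tgv.subspace X" and Q: "finite Q" "inj_on key Q" "\<And>x. x \<in> X \<Longrightarrow> supp x \<subseteq> Q"
  shows "tgv.dim X \<le> card (leads key X)"
proof -
  have LQ: "leads key X \<subseteq> Q" using Q(3) by (auto simp: leads_def)
  then have fL: "finite (leads key X)" using Q(1) finite_subset by blast
  obtain g where g: "\<And>p. p \<in> leads key X \<Longrightarrow> g p \<in> X \<and> p \<in> supp (g p) \<and> (\<forall>q\<in>supp (g p). key q \<le> key p)"
    using bchoice[of "leads key X" "\<lambda>p y. y \<in> X \<and> p \<in> supp y \<and> (\<forall>q\<in>supp y. key q \<le> key p)"]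
    unfolding leads_def by blast
  let ?m = "\<lambda>x. card {q \<in> Q. \<exists>r\<in>supp x. key q \<le> key r}"
  have "x \<in> tgv.span (g ` leads key X)" if "x \<in> X" for x
    using that
  proof (induction "?m x" arbitrary: x rule: less_induct)
    case less
    show ?case
    proof (cases "supp x = {}")
      case True
      then have "x = 0" by (auto simp: supp_def fun_eq_iff tg_apply)
      then show ?thesis by (simp add: tgv.span_zero)
    next
      case False
      have fx: "finite (supp x)" using Q(1,3) less.prems finite_subset by blast
      have "Max (key ` supp x) \<in> key ` supp x" using False fx by (intro Max_in) auto
      then obtain p where p: "p \<in> supp x" "key p = Max (key ` supp x)" by auto
      have le: "key q \<le> key p" if "q \<in> supp x" for q
        unfolding p(2) using fx that by (intro Max_ge) auto
      have pL: "p \<in> leads key X" using p(1) le less.prems by (auto simp: leads_def)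
      define y where "y = x - tg_smul (x p / g p p) (g p)"
      have gp: "g p p \<noteq> 0" using g[OF pL] by (simp add: supp_def)
      have yX: "y \<in> X" unfolding y_def
        using less.prems g[OF pL] X by (intro tgv.subspace_diff tgv.subspace_scale) auto
      have yp: "y p = 0" using gp by (simp add: y_def tg_apply)
      have sy: "key r < key p" if r: "r \<in> supp y" for r
      proof -
        have "r \<in> supp x \<union> supp (g p)"
          using r supp_diff[of x "tg_smul (x p / g p p) (g p)"] supp_smul[of "x p / g p p" "g p"]
          unfolding y_def by blast
        then have "key r \<le> key p" using le g[OF pL] by blast
        moreover have "key r \<noteq> key p"
        proof
          assume "key r = key p"
          moreover have "r \<in> Q" "p \<in> Q" using r yX Q(3) pL LQ by auto
          ultimately have "r = p" using Q(2) by (auto dest: inj_onD)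
          then show False using r yp by (simp add: supp_def)
        qed
        ultimately show ?thesis by simp
      qed
      have "?m y < ?m x"
      proof (rule psubset_card_mono)
        show "finite {q \<in> Q. \<exists>r\<in>supp x. key q \<le> key r}" using Q(1) by simp
        have "{q \<in> Q. \<exists>r\<in>supp y. key q \<le> key r} \<subseteq> {q \<in> Q. \<exists>r\<in>supp x. key q \<le> key r}"
        proof clarify
          fix u g r assume "key (u, g) \<le> key r" "r \<in> supp y"
          then have "key (u, g) \<le> key p" using sy by (meson less_imp_le order_trans)
          then show "\<exists>r\<in>supp x. key (u, g) \<le> key r" using p(1) by blast
        qed
        moreover have "p \<in> {q \<in> Q. \<exists>r\<in>supp x. key q \<le> key r}" using p(1) pL LQ by auto
        moreover have "p \<notin> {q \<in> Q. \<exists>r\<in>supp y. key q \<le> key r}" using sy by (auto simp: not_le)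
        ultimately show "{q \<in> Q. \<exists>r\<in>supp y. key q \<le> key r} \<subset> {q \<in> Q. \<exists>r\<in>supp x. key q \<le> key r}" by blast
      qed
      from less.hyps[OF this yX] have "y \<in> tgv.span (g ` leads key X)" .
      moreover have "tg_smul (x p / g p p) (g p) \<in> tgv.span (g ` leads key X)"
        using pL by (intro tgv.span_scale tgv.span_base) auto
      ultimately have "y + tg_smul (x p / g p p) (g p) \<in> tgv.span (g ` leads key X)"
        by (rule tgv.span_add)
      then show ?thesis by (simp add: y_def)
    qed
  qed
  then have "tgv.dim X \<le> card (g ` leads key X)"
    using fL by (intro tgv.dim_le_card) auto
  also have "\<dots> \<le> card (leads key X)" using fL by (rule card_image_le)
  finally show ?thesis .
qed

text \<open>\<open>cspan\<close>, \<open>lin_indep\<close> and \<open>cdim\<close> are built from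
  lists over an abstract carrier. An injective linear map into the function space lets them be
  computed by \<open>tgv.span\<close>, \<open>tgv.independent\<close> and
  \<open>tgv.dim\<close>.\<close>

locale calg_embedding =
  fixes A :: "'a calg" and \<phi> :: "'a \<Rightarrow> ('n::finite) tg"
  assumes inj: "inj_on \<phi> (ca_carrier A)"
    and zero_in: "ca_zero A \<in> ca_carrier A"
    and add_in: "x \<in> ca_carrier A \<Longrightarrow> y \<in> ca_carrier A \<Longrightarrow> ca_add A x y \<in> ca_carrier A"
    and smul_in: "x \<in> ca_carrier A \<Longrightarrow> ca_smul A k x \<in> ca_carrier A"
    and phi_zero: "\<phi> (ca_zero A) = 0"
    and phi_add: "x \<in> ca_carrier A \<Longrightarrow> y \<in> ca_carrier A \<Longrightarrow> \<phi> (ca_add A x y) = \<phi> x + \<phi> y"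
    and phi_smul: "x \<in> ca_carrier A \<Longrightarrow> \<phi> (ca_smul A k x) = tg_smul k (\<phi> x)"
begin

lemma lincomb_phi:
  "set xs \<subseteq> UNIV \<times> ca_carrier A \<Longrightarrow> lincomb A xs \<in> ca_carrier A \<and>
     \<phi> (lincomb A xs) = (\<Sum>(k, x)\<leftarrow>xs. tg_smul k (\<phi> x))"
  by (induction xs) (auto simp: zero_in add_in smul_in phi_zero phi_add phi_smul)

lemma cspan_in: "F \<subseteq> ca_carrier A \<Longrightarrow> cspan A F \<subseteq> ca_carrier A"
  using lincomb_phi unfolding cspan_def by blast

lemma phi_cspan:
  assumes F: "F \<subseteq> ca_carrier A"
  shows "\<phi> ` cspan A F = tgv.span (\<phi> ` F)"
proof
  have "(\<Sum>(k, x)\<leftarrow>xs. tg_smul k (\<phi> x)) \<in> tgv.span (\<phi> ` F)" if "set xs \<subseteq> UNIV \<times> F" for xs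
    using that
  proof (induction xs)
    case (Cons y xs)
    then show ?case by (cases y) (auto intro: tgv.span_add[OF tgv.span_scale[OF tgv.span_base]])
  qed (simp add: tgv.span_zero)
  then show "\<phi> ` cspan A F \<subseteq> tgv.span (\<phi> ` F)"
    using lincomb_phi F unfolding cspan_def by fastforce
  have im: "\<phi> ` cspan A F = {\<Sum>(k, x)\<leftarrow>xs. tg_smul k (\<phi> x) | xs. set xs \<subseteq> UNIV \<times> F}"
  proof -
    have "\<phi> (lincomb A xs) = (\<Sum>(k, x)\<leftarrow>xs. tg_smul k (\<phi> x))" if "set xs \<subseteq> UNIV \<times> F" for xs
      using lincomb_phi[of xs] that F by blast
    then show ?thesis unfolding cspan_def by (auto simp: image_iff) metis
  qed
  show "tgv.span (\<phi> ` F) \<subseteq> \<phi> ` cspan A F"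
  proof (rule tgv.span_minimal)
    show "\<phi> ` F \<subseteq> \<phi> ` cspan A F"
      unfolding im by (auto intro!: exI[of _ "[(1, _)]"])
    show "tgv.subspace (\<phi> ` cspan A F)"
    proof (rule tgv.subspaceI)
      show "0 \<in> \<phi> ` cspan A F" unfolding im by (auto intro!: exI[of _ "[]"])
      show "x + y \<in> \<phi> ` cspan A F" if xy: "x \<in> \<phi> ` cspan A F" "y \<in> \<phi> ` cspan A F" for x y
      proof -
        obtain xs ys where "set xs \<subseteq> UNIV \<times> F" "set ys \<subseteq> UNIV \<times> F"
          "x = (\<Sum>(k, x)\<leftarrow>xs. tg_smul k (\<phi> x))" "y = (\<Sum>(k, x)\<leftarrow>ys. tg_smul k (\<phi> x))"
          using xy unfolding im by blast
        then show ?thesis unfolding im by (auto intro!: exI[of _ "xs @ ys"])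
      qed
      show "tg_smul r x \<in> \<phi> ` cspan A F" if x: "x \<in> \<phi> ` cspan A F" for r x
      proof -
        obtain xs where xs: "set xs \<subseteq> UNIV \<times> F" "x = (\<Sum>(k, x)\<leftarrow>xs. tg_smul k (\<phi> x))"
          using x unfolding im by blast
        have "tg_smul r (\<Sum>(k, x)\<leftarrow>xs. tg_smul k (\<phi> x)) = (\<Sum>(k, x)\<leftarrow>map (\<lambda>(k, x). (r * k, x)) xs. tg_smul k (\<phi> x))"
          by (induction xs) (auto simp: tgv.scale_right_distrib)
        then show ?thesis unfolding im using xs
          by (auto intro!: exI[of _ "map (\<lambda>(k, x). (r * k, x)) xs"])
      qed
    qed
  qed
qed

lemma cspan_eqI:
  assumes "F \<subseteq> ca_carrier A" "U \<subseteq> ca_carrier A" "tgv.span (\<phi> ` F) = \<phi> ` U"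
  shows "cspan A F = U"
  using inj_on_image_eq_iff[OF inj cspan_in[OF assms(1)] assms(2)] phi_cspan[OF assms(1)] assms(3)
  by simp

text \<open>Coefficient lists are converted to coefficient functions on the image and back.
  Injectivity of \<open>\<phi>\<close> keeps distinct list entries distinct, so a vector of the
  image determines its position in the list.\<close>

lemma lin_indep_phi:
  assumes F: "finite F" "F \<subseteq> ca_carrier A"
  shows "lin_indep A F \<longleftrightarrow> tgv.independent (\<phi> ` F)"
proof
  have injF: "inj_on \<phi> F" using inj F inj_on_subset by blast
  have lc: "lincomb A (zip cs xs) = ca_zero A \<longleftrightarrow> (\<Sum>(k, x)\<leftarrow>zip cs xs. tg_smul k (\<phi> x)) = 0"
    if "set xs \<subseteq> F" for cs xs
  proof -
    have "set (zip cs xs) \<subseteq> UNIV \<times> ca_carrier A"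
      using that F(2) by (auto dest: set_zip_rightD)
    from lincomb_phi[OF this] show ?thesis
      using inj_on_eq_iff[OF inj _ zero_in] phi_zero by metis
  qed
  {
    assume li: "lin_indep A F"
    show "tgv.independent (\<phi> ` F)"
      unfolding tgv.independent_explicit_finite_subsets
    proof (intro allI impI ballI)
      fix T u v assume T: "T \<subseteq> \<phi> ` F" "finite T" "(\<Sum>v\<in>T. tg_smul (u v) v) = 0" "v \<in> T"
      define R where "R = {x \<in> F. \<phi> x \<in> T}"
      have R: "\<phi> ` R = T" "inj_on \<phi> R" "finite R" "R \<subseteq> F"
        using T(1) F(1) injF by (auto simp: R_def inj_on_def)
      obtain xs where xs: "set xs = R" "distinct xs" using R(3) finite_distinct_list by blast
      let ?cs = "map (\<lambda>x. u (\<phi> x)) xs"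
      have "(\<Sum>(k, x)\<leftarrow>zip ?cs xs. tg_smul k (\<phi> x)) = (\<Sum>x\<leftarrow>xs. tg_smul (u (\<phi> x)) (\<phi> x))"
        by (induction xs) auto
      also have "\<dots> = (\<Sum>x\<in>R. tg_smul (u (\<phi> x)) (\<phi> x))"
        using xs by (simp add: sum_list_distinct_conv_sum_set)
      also have "\<dots> = (\<Sum>v\<in>T. tg_smul (u v) v)"
        using R by (subst R(1)[symmetric], subst sum.reindex) auto
      finally have "lincomb A (zip ?cs xs) = ca_zero A" using lc[of xs ?cs] xs(1) R(4) T(3) by simp
      then have "\<forall>k\<in>set ?cs. k = 0" using li xs R(4) unfolding lin_indep_def by (metis length_map)
      then show "u v = 0" using T(4) R(1) xs(1) by auto
    qed
  }
  {
    assume ind: "tgv.independent (\<phi> ` F)"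
    show "lin_indep A F"
      unfolding lin_indep_def
    proof (intro allI impI ballI; elim conjE)
      fix xs cs k
      assume xs: "distinct xs" "set xs \<subseteq> F" "length cs = length xs"
        and 0: "lincomb A (zip cs xs) = ca_zero A" and k: "k \<in> set cs"
      obtain i where i: "i < length cs" "cs ! i = k" using k by (metis in_set_conv_nth)
      have inj': "inj_on (\<lambda>j. \<phi> (xs ! j)) {..<length xs}"
        using xs injF by (intro inj_onI) (metis inj_onD lessThan_iff nth_eq_iff_index_eq nth_mem subsetD)
      define u where "u v = cs ! (the_inv_into {..<length xs} (\<lambda>j. \<phi> (xs ! j)) v)" for v
      have u: "u (\<phi> (xs ! j)) = cs ! j" if "j < length xs" for j
        unfolding u_def using the_inv_into_f_f[OF inj', of j] that by simp
      have "(\<Sum>(k, x)\<leftarrow>zip cs xs. tg_smul k (\<phi> x)) = (\<Sum>j<length xs. tg_smul (cs ! j) (\<phi> (xs ! j)))"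
        using xs(3) by (simp add: sum_list_sum_nth split_beta atLeast0LessThan)
      then have "(\<Sum>j<length xs. tg_smul (u (\<phi> (xs ! j))) (\<phi> (xs ! j))) = 0"
        using lc[OF xs(2), of cs] 0 u by simp
      then have "(\<Sum>v\<in>(\<lambda>j. \<phi> (xs ! j)) ` {..<length xs}. tg_smul (u v) v) = 0"
        by (subst sum.reindex[OF inj']) simp
      moreover have "(\<lambda>j. \<phi> (xs ! j)) ` {..<length xs} \<subseteq> \<phi> ` F"
        using xs(2) by (auto intro!: imageI dest: nth_mem)
      moreover have "\<phi> (xs ! i) \<in> (\<lambda>j. \<phi> (xs ! j)) ` {..<length xs}"
        using i(1) xs(3) by (intro imageI) simp
      ultimately have "u (\<phi> (xs ! i)) = 0"
        using ind[unfolded tgv.independent_explicit_finite_subsets, rule_format] by blast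
      then show "k = 0" using u i xs(3) by simp
    qed
  }
qed

text \<open>\<open>cdim\<close> is a definite description, so a finite basis has to be exhibited and
  every other one shown to have the same size; both come from the image. The set \<open>D\<close>
  ensures finiteness.\<close>

lemma cdim_phi:
  assumes U: "U \<subseteq> ca_carrier A" "tgv.subspace (\<phi> ` U)" and D: "finite D" "\<phi> ` U \<subseteq> tgv.span D"
  shows "cdim A U = tgv.dim (\<phi> ` U)"
  unfolding cdim_def
proof (rule the_equality)
  obtain B where B: "B \<subseteq> \<phi> ` U" "tgv.independent B" "\<phi> ` U \<subseteq> tgv.span B" "card B = tgv.dim (\<phi> ` U)"
    using tgv.basis_exists by blast
  have fB: "finite B" using tgv.independent_span_bound[OF D(1) B(2)] B(1) D(2) by blast
  have sB: "tgv.span B = \<phi> ` U" using B(1,3) U(2) by (simp add: tgv.span_minimal subset_antisym)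
  obtain F where F: "F \<subseteq> U" "inj_on \<phi> F" "\<phi> ` F = B"
    using B(1) unfolding subset_image_inj by blast
  have "finite F" using F fB finite_imageD by blast
  moreover have "lin_indep A F" using lin_indep_phi[of F] \<open>finite F\<close> F U(1) B(2) by auto
  moreover have "cspan A F = U" using F U(1) sB by (intro cspan_eqI) auto
  moreover have "card F = tgv.dim (\<phi> ` U)" using card_image[OF F(2)] F(3) B(4) by simp
  ultimately show "\<exists>F. finite F \<and> F \<subseteq> U \<and> lin_indep A F \<and> cspan A F = U \<and> card F = tgv.dim (\<phi> ` U)"
    using F(1) by blast
next
  fix k assume "\<exists>F. finite F \<and> F \<subseteq> U \<and> lin_indep A F \<and> cspan A F = U \<and> card F = k"
  then obtain F where F: "finite F" "F \<subseteq> U" "lin_indep A F" "cspan A F = U" "card F = k" by blast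
  have FA: "F \<subseteq> ca_carrier A" using F(2) U(1) by blast
  have "tgv.independent (\<phi> ` F)" using lin_indep_phi[OF F(1) FA] F(3) by simp
  moreover have "tgv.span (\<phi> ` F) = \<phi> ` U" using phi_cspan[OF FA] F(4) by simp
  ultimately have "tgv.dim (\<phi> ` U) = card (\<phi> ` F)"
    by (metis tgv.dim_span tgv.dim_eq_card_independent)
  also have "\<dots> = k" using card_image[OF inj_on_subset[OF inj FA]] F(5) by simp
  finally show "k = tgv.dim (\<phi> ` U)" by simp
qed

lemma fd_subspaceD:
  assumes "fd_subspace A U"
  shows "U \<subseteq> ca_carrier A" "tgv.subspace (\<phi> ` U)" "\<exists>D. finite D \<and> \<phi> ` U = tgv.span D"
proof -
  obtain F where F: "finite F" "F \<subseteq> U" "cspan A F = U" and U: "U \<subseteq> ca_carrier A"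
    using assms by (auto simp: fd_subspace_def csubspace_def)
  show "U \<subseteq> ca_carrier A" by fact
  have "\<phi> ` U = tgv.span (\<phi> ` F)" using phi_cspan[of F] F U by auto
  then show "tgv.subspace (\<phi> ` U)" "\<exists>D. finite D \<and> \<phi> ` U = tgv.span D"
    using F(1) by auto
qed

lemma fd_subspace_cspan:
  assumes F: "finite F" "F \<subseteq> ca_carrier A"
  shows "fd_subspace A (cspan A F)"
proof -
  have "cspan A (cspan A F) = cspan A F"
    using cspan_in[OF F(2)] by (intro cspan_eqI) (auto simp: phi_cspan[OF F(2)] tgv.span_span)
  moreover have "F \<subseteq> cspan A F"
  proof
    fix x assume x: "x \<in> F"
    then have "\<phi> x \<in> \<phi> ` cspan A F" unfolding phi_cspan[OF F(2)] by (intro tgv.span_base) auto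
    then show "x \<in> cspan A F"
      using inj_on_image_mem_iff[OF inj _ cspan_in[OF F(2)]] x F(2) by blast
  qed
  ultimately show ?thesis using F cspan_in[OF F(2)] by (auto simp: fd_subspace_def csubspace_def)
qed

end

section \<open>Growth in the symplectic reflection algebra\<close>

text \<open>Adding the same unit vector to two exponents respects the lexicographic order; this is
  what makes \<open>key\<close> below a monomial order.\<close>

lemma map_increment_mono:
  fixes f h :: "'i \<Rightarrow> nat"
  shows "map f L \<le> map h L \<Longrightarrow> map (f(j := Suc (f j))) L \<le> map (h(j := Suc (h j))) L"
  by (induction L) (auto simp: Cons_le_Cons)

lemma (in calg_embedding) fd_subspaceI:
  assumes U: "U \<subseteq> ca_carrier A" "tgv.subspace (\<phi> ` U)" and D: "finite D" "\<phi> ` U \<subseteq> tgv.span D"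
  shows "fd_subspace A U"
proof -
  obtain B where B: "B \<subseteq> \<phi> ` U" "tgv.independent B" "\<phi> ` U \<subseteq> tgv.span B" "card B = tgv.dim (\<phi> ` U)"
    using tgv.basis_exists by blast
  have fB: "finite B" using tgv.independent_span_bound[OF D(1) B(2)] B(1) D(2) by blast
  have sB: "tgv.span B = \<phi> ` U" using B(1,3) U(2) by (simp add: tgv.span_minimal subset_antisym)
  obtain F where F: "F \<subseteq> U" "inj_on \<phi> F" "\<phi> ` F = B"
    using B(1) unfolding subset_image_inj by blast
  have "finite F" using F fB finite_imageD by blast
  moreover have "cspan A F = U" using F U(1) sB by (intro cspan_eqI) auto
  moreover have "cspan A U = U"
    using U by (intro cspan_eqI) (auto simp: tgv.span_eq_iff)
  ultimately show ?thesis using U(1) F(1) by (auto simp: fd_subspace_def csubspace_def)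
qed

section \<open>Normal forms as a model of the algebra\<close>

context sra begin

abbreviation SRAlg :: "'n tg set calg" where "SRAlg \<equiv> SRA om G t c"

text \<open>The coordinate map on cosets; by \<open>N_eq_iff\<close> its value is independent of the
  representative that \<open>rep\<close> selects.\<close>

abbreviation \<Phi> :: "'n tg set \<Rightarrow> 'n tg" where "\<Phi> X \<equiv> N (rep X)"

lemma SRA_simps:
  "ca_carrier SRAlg = coset I ` TG_carrier G"
  "ca_add SRAlg X Y = coset I (rep X + rep Y)"
  "ca_smul SRAlg k X = coset I (tg_smul k (rep X))"
  "ca_mul SRAlg X Y = coset I (rep X \<odot> rep Y)"
  "ca_zero SRAlg = coset I 0"
  "ca_one SRAlg = coset I tg_one"
  by (simp_all add: SRA_def Let_def)

lemma rep_coset: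
  assumes "a \<in> TG_carrier G"
  shows "rep (coset I a) - a \<in> I" "rep (coset I a) \<in> TG_carrier G" "\<Phi> (coset I a) = N a"
proof -
  have "a + 0 \<in> coset I a" unfolding coset_def using sra_ideal.id_zero by blast
  then have "rep (coset I a) \<in> coset I a" unfolding rep_def by (rule someI[where P = "\<lambda>x. x \<in> coset I a"])
  then obtain i where i: "i \<in> I" "rep (coset I a) = a + i" by (auto simp: coset_def)
  then show 1: "rep (coset I a) - a \<in> I" by simp
  show 2: "rep (coset I a) \<in> TG_carrier G"
    unfolding i(2) by (rule tgv.subspace_add[OF subspace_TG assms I_TG[OF i(1)]])
  show "\<Phi> (coset I a) = N a" using N_eq_iff[OF 2 assms] 1 by simp
qed

lemma coset_eqI:
  assumes "a - b \<in> I"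
  shows "coset I a = coset I b"
proof -
  have "coset I a \<subseteq> coset I b" if "a - b \<in> I" for a b
  proof
    fix x assume "x \<in> coset I a"
    then obtain i where i: "i \<in> I" "x = a + i" by (auto simp: coset_def)
    then have "x = b + ((a - b) + i)" "(a - b) + i \<in> I" using that by (auto intro: sra_ideal.id_add)
    then show "x \<in> coset I b" unfolding coset_def by blast
  qed
  moreover have "b - a \<in> I" using tgv.subspace_neg[OF subspace_I assms] by simp
  ultimately show ?thesis using assms by blast
qed

lemma rep_TG: "x \<in> ca_carrier SRAlg \<Longrightarrow> rep x \<in> TG_carrier G"
  by (auto simp: SRA_simps rep_coset)

text \<open>Injectivity is the substance: equal normal forms mean a difference in the ideal, hence
  equal cosets.\<close>

sublocale emb: calg_embedding SRAlg \<Phi>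
proof
  show "inj_on \<Phi> (ca_carrier SRAlg)"
  proof (rule inj_onI)
    fix x y assume "x \<in> ca_carrier SRAlg" "y \<in> ca_carrier SRAlg" "\<Phi> x = \<Phi> y"
    then obtain a b where "x = coset I a" "y = coset I b" "a - b \<in> I"
      by (auto simp: SRA_simps rep_coset(3) N_eq_iff)
    then show "x = y" by (simp add: coset_eqI)
  qed
  show "ca_zero SRAlg \<in> ca_carrier SRAlg" "\<Phi> (ca_zero SRAlg) = 0"
    using tgv.subspace_0[OF subspace_TG[of G]] by (auto simp: SRA_simps rep_coset(3))
  fix x y k assume x: "x \<in> ca_carrier SRAlg"
  note rx = rep_TG[OF x]
  show "ca_smul SRAlg k x \<in> ca_carrier SRAlg" "\<Phi> (ca_smul SRAlg k x) = tg_smul k (\<Phi> x)"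
    using tgv.subspace_scale[OF subspace_TG rx] TG_fs[OF rx]
    by (auto simp: SRA_simps rep_coset(3) N_smul)
  assume "y \<in> ca_carrier SRAlg"
  note ry = rep_TG[OF this]
  show "ca_add SRAlg x y \<in> ca_carrier SRAlg" "\<Phi> (ca_add SRAlg x y) = \<Phi> x + \<Phi> y"
    using tgv.subspace_add[OF subspace_TG rx ry] TG_fs[OF rx] TG_fs[OF ry]
    by (auto simp: SRA_simps rep_coset(3) N_add)
qed

text \<open>Replacing the chosen representatives by their normal forms changes the product by an
  element of the two-sided ideal, which \<open>N\<close> does not see.\<close>

lemma Phi_mult:
  assumes "x \<in> ca_carrier SRAlg" "y \<in> ca_carrier SRAlg"
  shows "ca_mul SRAlg x y \<in> ca_carrier SRAlg" "\<Phi> (ca_mul SRAlg x y) = N (\<Phi> x \<odot> \<Phi> y)"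
proof -
  note r = rep_TG[OF assms(1)] rep_TG[OF assms(2)]
  note n = N_TG[OF r(1)] N_TG[OF r(2)]
  note f = r[THEN TG_fs] n[THEN TG_fs]
  show "ca_mul SRAlg x y \<in> ca_carrier SRAlg" using TG_mult[OF r] by (auto simp: SRA_simps)
  have "rep x \<odot> rep y - \<Phi> x \<odot> \<Phi> y = (rep x - \<Phi> x) \<odot> rep y + \<Phi> x \<odot> (rep y - \<Phi> y)"
    using f by (simp add: tg_mult_diff_left tg_mult_diff_right)
  also have "\<dots> \<in> I"
    by (intro sra_ideal.id_add I_mult diff_N r n)
  finally show "\<Phi> (ca_mul SRAlg x y) = N (\<Phi> x \<odot> \<Phi> y)"
    using N_eq_iff[OF TG_mult[OF r] TG_mult[OF n]] TG_mult[OF r]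
    by (simp add: SRA_simps rep_coset(3))
qed

lemma one_NF: "tg_one \<in> NF" and vec_NF: "tg_vec (ax i) \<in> NF"
  by (auto simp: NF_def tg_one_bas tg_vec_axis TG_carrier_def one_G sortw_def)

lemma one_in: "ca_one SRAlg \<in> ca_carrier SRAlg" and Phi_one: "\<Phi> (ca_one SRAlg) = tg_one"
  using one_NF N_NF_id[OF one_NF] by (auto simp: SRA_simps rep_coset(3) NF_def)

lemma Phi_NF: "x \<in> ca_carrier SRAlg \<Longrightarrow> \<Phi> x \<in> NF"
  by (rule N_NF[OF rep_TG])

lemma set_prod_Phi:
  assumes "W \<subseteq> ca_carrier SRAlg" "X \<subseteq> ca_carrier SRAlg"
  shows "set_prod SRAlg W X \<subseteq> ca_carrier SRAlg"
    "\<Phi> ` set_prod SRAlg W X = tgv.span {N (w \<odot> x) | w x. w \<in> \<Phi> ` W \<and> x \<in> \<Phi> ` X}"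
proof -
  let ?F = "{ca_mul SRAlg w x | w x. w \<in> W \<and> x \<in> X}"
  have F: "?F \<subseteq> ca_carrier SRAlg" using Phi_mult(1) assms by blast
  have eq: "\<Phi> (ca_mul SRAlg w x) = N (\<Phi> w \<odot> \<Phi> x)" if "w \<in> W" "x \<in> X" for w x
    using that assms by (intro Phi_mult(2)) auto
  have "\<Phi> ` ?F = {N (w \<odot> x) | w x. w \<in> \<Phi> ` W \<and> x \<in> \<Phi> ` X}"
  proof (intro equalityI subsetI)
    fix y assume "y \<in> \<Phi> ` ?F"
    then obtain w x where "w \<in> W" "x \<in> X" "y = \<Phi> (ca_mul SRAlg w x)" by blast
    then show "y \<in> {N (w \<odot> x) | w x. w \<in> \<Phi> ` W \<and> x \<in> \<Phi> ` X}" using eq by auto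
  next
    fix y assume "y \<in> {N (w \<odot> x) | w x. w \<in> \<Phi> ` W \<and> x \<in> \<Phi> ` X}"
    then obtain w x where "w \<in> W" "x \<in> X" "y = N (\<Phi> w \<odot> \<Phi> x)" by blast
    then have "y = \<Phi> (ca_mul SRAlg w x)" "ca_mul SRAlg w x \<in> ?F" using eq by auto
    then show "y \<in> \<Phi> ` ?F" by blast
  qed
  then show "\<Phi> ` set_prod SRAlg W X = tgv.span {N (w \<odot> x) | w x. w \<in> \<Phi> ` W \<and> x \<in> \<Phi> ` X}"
    unfolding set_prod_def emb.phi_cspan[OF F] by simp
  show "set_prod SRAlg W X \<subseteq> ca_carrier SRAlg"
    unfolding set_prod_def by (rule emb.cspan_in[OF F])
qed

definition NW :: "nat \<Rightarrow> ('n list \<times> 'n cmat) set" where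
  "NW k = {p. sortw (fst p) \<and> length (fst p) \<le> k \<and> snd p \<in> G}"

lemma sortw_mset_eq:
  fixes u w :: "'n list"
  shows "sortw u \<Longrightarrow> sortw w \<Longrightarrow> mset u = mset w \<Longrightarrow> u = w"
  by (metis srt_eq)

text \<open>A sorted word is determined by its letter counts, each at most \<open>k\<close>. This
  crude box count already has the right degree in \<open>k\<close>.\<close>

lemma NW_bound: "finite (NW k)" "card (NW k) \<le> (k + 1) ^ CARD('n) * card G"
proof -
  define T where "T = (PiE (UNIV :: 'n set) (\<lambda>_. {..k})) \<times> G"
  have T: "finite T" "card T = (k + 1) ^ CARD('n) * card G"
    unfolding T_def using finite_G by (auto simp: finite_PiE card_PiE card_cartesian_product)
  have inj: "inj_on (\<lambda>p. (count_list (fst p), snd p)) (NW k)"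
  proof (rule inj_onI)
    fix p q assume pq: "p \<in> NW k" "q \<in> NW k" "(count_list (fst p), snd p) = (count_list (fst q), snd q)"
    then have "mset (fst p) = mset (fst q)" by (intro multiset_eqI) (simp add: count_mset)
    then show "p = q" using pq sortw_mset_eq[of "fst p" "fst q"] by (simp add: NW_def prod_eq_iff)
  qed
  have sub: "(\<lambda>p. (count_list (fst p), snd p)) ` NW k \<subseteq> T"
    using count_le_length by (fastforce simp: T_def NW_def intro: order_trans)
  show "finite (NW k)" using inj_on_finite[OF inj sub T(1)] .
  show "card (NW k) \<le> (k + 1) ^ CARD('n) * card G"
    using card_inj_on_le[OF inj sub T(1)] T(2) by simp
qed

lemma NF_Fil_supp: "a \<in> NF \<Longrightarrow> a \<in> Fil G k \<Longrightarrow> supp a \<subseteq> NW k"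
  by (auto simp: NF_def Fil_iff NW_def)

lemma NF_Fil_span:
  assumes "a \<in> NF" "a \<in> Fil G k"
  shows "a \<in> tgv.span (bas ` NW k)"
proof -
  have "a = (\<Sum>p\<in>NW k. tg_smul (a p) (bas p))"
    by (rule tg_decomp[OF NW_bound(1) NF_Fil_supp[OF assms]])
  also have "\<dots> \<in> tgv.span (bas ` NW k)"
    by (intro tgv.span_sum tgv.span_scale tgv.span_base imageI)
  finally show ?thesis .
qed

text \<open>Finitely many spanning elements have a common degree bound. It is taken positive for the
  later estimate of \<open>(k * m + 1) ^ CARD('n)\<close>.\<close>

lemma fd_in_Fil:
  assumes "fd_subspace SRAlg U"
  shows "\<exists>k\<ge>1. \<Phi> ` U \<subseteq> NF \<inter> Fil G k"
proof -
  note U = emb.fd_subspaceD[OF assms]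
  obtain D where D: "finite D" "\<Phi> ` U = tgv.span D" using U(3) by blast
  have NF: "\<Phi> ` U \<subseteq> NF" using U(1) Phi_NF by blast
  have "D \<subseteq> NF" using NF D(2) tgv.span_superset by blast
  then have "\<exists>k. a \<in> Fil G k" if "a \<in> D" for a
    unfolding TG_carrier_Fil[symmetric] using that by (auto simp: NF_def)
  then obtain f where f: "\<And>a. a \<in> D \<Longrightarrow> a \<in> Fil G (f a)" by metis
  define k where "k = Suc (\<Sum>a\<in>D. f a)"
  have "f a \<le> k" if "a \<in> D" for a
    unfolding k_def using member_le_sum[OF that, of f] D(1) by simp
  then have "D \<subseteq> Fil G k" using f Fil_mono by blast
  then have "\<Phi> ` U \<subseteq> Fil G k" unfolding D(2) by (rule tgv.span_minimal[OF _ subspace_Fil])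
  then show ?thesis using NF by (intro exI[of _ k]) (auto simp: k_def)
qed

lemma star_Fil:
  assumes "w \<in> NF \<inter> Fil G k" "x \<in> NF \<inter> Fil G l"
  shows "N (w \<odot> x) \<in> NF \<inter> Fil G (k + l)"
  using assms N_Fil[OF Fil_mult_G, of w k x l] N_NF[OF TG_mult, of w x] by (auto simp: NF_def)

lemma subspace_NF_Fil: "tgv.subspace (NF \<inter> Fil G k)"
  by (rule tgv.subspace_inter[OF subspace_NF subspace_Fil])

lemma set_prod_Fil:
  assumes "W \<subseteq> ca_carrier SRAlg" "X \<subseteq> ca_carrier SRAlg"
    and "\<Phi> ` W \<subseteq> NF \<inter> Fil G k" "\<Phi> ` X \<subseteq> NF \<inter> Fil G l"
  shows "\<Phi> ` set_prod SRAlg W X \<subseteq> NF \<inter> Fil G (k + l)"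
  unfolding set_prod_Phi[OF assms(1,2)]
  using assms(3,4) star_Fil by (intro tgv.span_minimal subspace_NF_Fil) blast

lemma fd_cdim_NF_Fil:
  assumes "U \<subseteq> ca_carrier SRAlg" "tgv.subspace (\<Phi> ` U)" "\<Phi> ` U \<subseteq> NF \<inter> Fil G k"
  shows "fd_subspace SRAlg U" "cdim SRAlg U = tgv.dim (\<Phi> ` U)" "cdim SRAlg U \<le> (k + 1) ^ CARD('n) * card G"
proof -
  have D: "finite (bas ` NW k)" "\<Phi> ` U \<subseteq> tgv.span (bas ` NW k)"
    using NW_bound(1) NF_Fil_span assms(3) by (simp, blast)
  show "fd_subspace SRAlg U" by (rule emb.fd_subspaceI[OF assms(1,2) D])
  show e: "cdim SRAlg U = tgv.dim (\<Phi> ` U)" by (rule emb.cdim_phi[OF assms(1,2) D])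
  have "cdim SRAlg U \<le> card (bas ` NW k)" unfolding e by (rule tgv.dim_le_card[OF D(2,1)])
  also have "\<dots> \<le> card (NW k)" by (rule card_image_le[OF NW_bound(1)])
  finally show "cdim SRAlg U \<le> (k + 1) ^ CARD('n) * card G" using NW_bound(2)[of k] by linarith
qed

lemma set_prod_fd:
  assumes "fd_subspace SRAlg W" "fd_subspace SRAlg X"
  shows "fd_subspace SRAlg (set_prod SRAlg W X)"
    "cdim SRAlg (set_prod SRAlg W X) = tgv.dim (\<Phi> ` set_prod SRAlg W X)"
proof -
  obtain k l where kl: "\<Phi> ` W \<subseteq> NF \<inter> Fil G k" "\<Phi> ` X \<subseteq> NF \<inter> Fil G l"
    using fd_in_Fil assms by meson
  note WX = emb.fd_subspaceD(1)[OF assms(1)] emb.fd_subspaceD(1)[OF assms(2)]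
  have s: "tgv.subspace (\<Phi> ` set_prod SRAlg W X)"
    unfolding set_prod_Phi(2)[OF WX] by simp
  show "fd_subspace SRAlg (set_prod SRAlg W X)"
    "cdim SRAlg (set_prod SRAlg W X) = tgv.dim (\<Phi> ` set_prod SRAlg W X)"
    by (rule fd_cdim_NF_Fil[OF set_prod_Phi(1)[OF WX] s set_prod_Fil[OF WX kl]])+
qed

lemma set_pow_bound:
  assumes W: "W \<subseteq> ca_carrier SRAlg" "\<Phi> ` W \<subseteq> NF \<inter> Fil G k"
  shows "set_pow SRAlg W m \<subseteq> ca_carrier SRAlg \<and> tgv.subspace (\<Phi> ` set_pow SRAlg W m) \<and>
    \<Phi> ` set_pow SRAlg W m \<subseteq> NF \<inter> Fil G (k * m)"
proof (induction m)
  case 0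
  have o: "{ca_one SRAlg} \<subseteq> ca_carrier SRAlg" using one_in by simp
  have "{tg_one} \<subseteq> NF \<inter> Fil G 0" using one_NF one_Fil by simp
  then have "tgv.span {tg_one} \<subseteq> NF \<inter> Fil G 0" by (intro tgv.span_minimal subspace_NF_Fil)
  then show ?case using emb.cspan_in[OF o] emb.phi_cspan[OF o] by (simp add: Phi_one)
next
  case (Suc m)
  then have X: "set_pow SRAlg W m \<subseteq> ca_carrier SRAlg" "\<Phi> ` set_pow SRAlg W m \<subseteq> NF \<inter> Fil G (k * m)"
    by auto
  show ?case
    using set_prod_Phi[OF W(1) X(1)] set_prod_Fil[OF W(1) X(1) W(2) X(2)] by simp
qed

text \<open>The exponent vector of a sorted monomial. The coordinate \<open>None\<close> stores a
  number for the group element, so that exponents determine monomials; only the coordinates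
  \<open>Some i\<close> are ever shifted.\<close>

definition expo :: "'n list \<times> 'n cmat \<Rightarrow> 'n option \<Rightarrow> nat" where
  "expo p = case_option (to_nat_on G (snd p)) (count_list (fst p))"

definition coords :: "'n option list" where "coords = (SOME xs. set xs = UNIV)"

text \<open>Degree first, then lexicographic in the exponents: the lower-degree terms created by
  reordering a word can never be leading.\<close>

definition key :: "'n list \<times> 'n cmat \<Rightarrow> nat list" where
  "key p = length (fst p) # map (expo p) coords"

definition sh :: "'n \<Rightarrow> 'n list \<times> 'n cmat \<Rightarrow> 'n list \<times> 'n cmat" where
  "sh i p = (srt (i # fst p), snd p)"

lemma set_coords: "set coords = UNIV"
  unfolding coords_def by (rule someI_ex) (rule finite_list, simp)

abbreviation NWs :: "('n list \<times> 'n cmat) set" where "NWs \<equiv> {p. sortw (fst p) \<and> snd p \<in> G}"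

lemma expo_inj: "inj_on expo NWs"
proof (rule inj_onI)
  fix p q assume pq: "p \<in> NWs" "q \<in> NWs" "expo p = expo q"
  have "count_list (fst p) i = count_list (fst q) i" for i
    using fun_cong[OF pq(3), of "Some i"] by (simp add: expo_def)
  then have "mset (fst p) = mset (fst q)" by (intro multiset_eqI) (simp add: count_mset)
  moreover have "snd p = snd q"
    using fun_cong[OF pq(3), of None] pq(1,2) countable_finite[OF finite_G]
    by (simp add: expo_def to_nat_on_inj)
  ultimately show "p = q" using pq(1,2) sortw_mset_eq[of "fst p" "fst q"] by (simp add: prod_eq_iff)
qed

lemma key_inj: "inj_on key NWs"
proof (rule inj_onI)
  fix p q assume pq: "p \<in> NWs" "q \<in> NWs" "key p = key q"
  then have "expo p = expo q" using set_coords by (auto simp: key_def fun_eq_iff map_eq_conv)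
  then show "p = q" using pq(1,2) inj_onD[OF expo_inj] by blast
qed

lemma expo_sh: "expo (sh i p) = (expo p)(Some i := Suc (expo p (Some i)))"
proof
  fix j
  show "expo (sh i p) j = ((expo p)(Some i := Suc (expo p (Some i)))) j"
    by (cases j) (auto simp: expo_def sh_def srt_def count_mset[symmetric])
qed

lemma sh_NWs: "p \<in> NWs \<Longrightarrow> sh i p \<in> NWs"
  by (simp add: sh_def sortw_srt)

lemma key_sh_mono: "key p \<le> key q \<Longrightarrow> key (sh i p) \<le> key (sh i q)"
  unfolding key_def expo_sh using map_increment_mono[of "expo p" coords "expo q" "Some i"]
  by (auto simp: Cons_le_Cons sh_def)

lemma sh_inj: "p \<in> NWs \<Longrightarrow> q \<in> NWs \<Longrightarrow> sh i p = sh i q \<Longrightarrow> p = q"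
proof -
  assume pq: "p \<in> NWs" "q \<in> NWs" "sh i p = sh i q"
  then have "expo (sh i p) = expo (sh i q)" by simp
  then have "expo p j = expo q j" for j
    unfolding expo_sh by (cases "j = Some i") (auto simp: fun_eq_iff dest: spec[of _ j])
  then show "p = q" using inj_onD[OF expo_inj _ pq(1,2)] by blast
qed

lemma key_length: "key p \<le> key q \<Longrightarrow> length (fst p) \<le> length (fst q)"
  by (auto simp: key_def Cons_le_Cons)

lemma key_less_length: "length (fst p) < length (fst q) \<Longrightarrow> key p < key q"
  by (auto simp: key_def)

text \<open>To leading order, multiplication by the basis vector is the injective, order-preserving
  map \<open>sh i\<close> on monomials. The errors \<open>R q\<close> have degree at most that of
  \<open>p\<close>, one less than that of \<open>sh i p\<close>, so they neither cancel the new
  leading term nor exceed it.\<close>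

lemma lead_shift:
  assumes x: "x \<in> NF" and p: "p \<in> supp x" "\<And>q. q \<in> supp x \<Longrightarrow> key q \<le> key p"
  shows "sh i p \<in> supp (N (tg_vec (ax i) \<odot> x))"
    "\<And>r. r \<in> supp (N (tg_vec (ax i) \<odot> x)) \<Longrightarrow> key r \<le> key (sh i p)"
proof -
  have fx: "fs x" and sx: "supp x \<subseteq> NWs" using x by (auto simp: NF_def TG_carrier_def)
  define R where "R q = nf (i # fst q) (snd q) - bas (sh i q)" for q
  have "tg_vec (ax i) \<odot> x = tg_vec (ax i) \<odot> (\<Sum>q\<in>supp x. tg_smul (x q) (bas q))"
    using tg_decomp[OF fx subset_refl] by simp
  also have "\<dots> = (\<Sum>q\<in>supp x. tg_smul (x q) (bas (i # fst q, snd q)))"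
    by (simp add: tg_mult_sum_right tg_mult_smul_right)
      (intro sum.cong refl, metis word_expand(2) prod.collapse)
  finally have "N (tg_vec (ax i) \<odot> x) = (\<Sum>q\<in>supp x. tg_smul (x q) (bas (sh i q) + R q))"
    by (simp add: N_sum N_smul N_bas R_def)
  then have eq: "N (tg_vec (ax i) \<odot> x) r = (\<Sum>q\<in>supp x. x q * bas (sh i q) r + x q * R q r)" for r
    by (simp add: sum_fun_apply tg_apply distrib_left)
  have R: "length (fst r) \<le> length (fst q)" if "q \<in> supp x" "R q r \<noteq> 0" for q r
  proof -
    have "snd q \<in> G" using that(1) sx by auto
    then have "R q \<in> Fil G (length (fst q))"
      using nf_leading[of "snd q" "i # fst q"] by (simp add: R_def sh_def)
    moreover have "r \<in> supp (R q)" using that(2) by (simp add: supp_def)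
    ultimately show ?thesis unfolding Fil_iff by blast
  qed
  have lsh: "length (fst (sh i q)) = Suc (length (fst q))" for q by (simp add: sh_def)
  have "x q * bas (sh i q) (sh i p) + x q * R q (sh i p) = (if q = p then x p else 0)"
    if q: "q \<in> supp x" for q
  proof -
    have "R q (sh i p) = 0"
      using R[OF q, of "sh i p"] key_length[OF p(2)[OF q]] by (auto simp: lsh)
    moreover have "bas (sh i q) (sh i p) = (if q = p then 1 else 0)"
    proof -
      have "q \<in> NWs" "p \<in> NWs" using q p(1) sx by blast+
      then show ?thesis using sh_inj[of q p i] unfolding bas_def by metis
    qed
    ultimately show ?thesis by simp
  qed
  then have "N (tg_vec (ax i) \<odot> x) (sh i p) = x p"
    unfolding eq using fx p(1) by simp
  then show "sh i p \<in> supp (N (tg_vec (ax i) \<odot> x))" using p(1) by (simp add: supp_def)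
  fix r assume "r \<in> supp (N (tg_vec (ax i) \<odot> x))"
  then obtain q where q: "q \<in> supp x" "x q * bas (sh i q) r + x q * R q r \<noteq> 0"
    unfolding supp_def eq by (auto elim: sum.not_neutral_contains_not_neutral simp del: sum.distrib)
  show "key r \<le> key (sh i p)"
  proof (cases "r = sh i q")
    case True
    then show ?thesis using key_sh_mono[OF p(2)[OF q(1)]] by simp
  next
    case False
    then have "R q r \<noteq> 0" using q(2) by (auto simp: bas_def)
    then have "length (fst r) < length (fst (sh i p))"
      using R[OF q(1)] key_length[OF p(2)[OF q(1)]] by (fastforce simp: lsh)
    then show ?thesis using key_less_length by (simp add: order_less_imp_le)
  qed
qed

definition gens :: "'n tg set" where
  "gens = insert tg_one (range (\<lambda>i. tg_vec (ax i)))"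

lemma growth_NF:
  fixes X :: "'n tg set"
  assumes X: "tgv.subspace X" "X \<subseteq> NF \<inter> Fil G k" and W: "gens \<subseteq> W"
    and Y: "Y = tgv.span {N (w \<odot> x) | w x. w \<in> W \<and> x \<in> X}" "Y \<subseteq> NF \<inter> Fil G l"
  shows "real (tgv.dim Y) \<ge> real (tgv.dim X)
     + 1 / real CARD('n) * real (tgv.dim X) powr ((real CARD('n) - 1) / real CARD('n))"
proof -
  define L where "L = leads key X"
  define d where "d = real CARD('n)"
  have d1: "d \<ge> 1" unfolding d_def using zero_less_card_finite[where 'a = 'n] by linarith
  have suppX: "supp x \<subseteq> NW k" if "x \<in> X" for x using that X(2) NF_Fil_supp by blast
  have NWs: "NW k \<subseteq> NWs" for k by (auto simp: NW_def)
  have LN: "L \<subseteq> NW k" using suppX by (auto simp: L_def leads_def)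
  then have fL: "finite L" using NW_bound(1) finite_subset by blast
  have dimX: "tgv.dim X \<le> card L"
    unfolding L_def using X(1) NW_bound(1) inj_on_subset[OF key_inj NWs] suppX
    by (rule dim_le_card_leads)
  define S where "S = L \<union> (\<Union>i. sh i ` L)"
  have fS: "finite S" using fL by (simp add: S_def)
  have SN: "S \<subseteq> NWs" using LN NWs sh_NWs by (auto simp: S_def dest!: subsetD[OF LN] subsetD[OF NWs])
  have XY: "x \<in> Y" if "x \<in> X" for x
  proof -
    have xN: "x \<in> NF" using that X(2) by blast
    have "N (tg_one \<odot> x) = x"
      using N_NF_id[OF xN] TG_fs[of x G] xN by (simp add: tg_mult_one_left NF_def)
    moreover have "tg_one \<in> W" using W by (auto simp: gens_def)
    ultimately have "x \<in> {N (w \<odot> x) | w x. w \<in> W \<and> x \<in> X}" using that by force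
    then show ?thesis unfolding Y(1) by (rule tgv.span_base)
  qed
  have VY: "N (tg_vec (ax i) \<odot> x) \<in> Y" if "x \<in> X" for x i
  proof -
    have "tg_vec (ax i) \<in> W" using W by (auto simp: gens_def)
    then show ?thesis unfolding Y(1) using that by (intro tgv.span_base) blast
  qed
  \<comment> \<open>The element \<open>tg_one\<close> of \<open>W\<close> keeps the leading
    monomials of \<open>X\<close>; the basis vectors contribute their shifts.\<close>
  have "S \<subseteq> leads key Y"
  proof
    fix r assume "r \<in> S"
    then consider "r \<in> L" | i p where "p \<in> L" "r = sh i p" by (auto simp: S_def)
    then show "r \<in> leads key Y"
    proof cases
      case 1
      then show ?thesis using XY unfolding L_def leads_def by blast
    next
      case 2
      then obtain x where x: "x \<in> X" "p \<in> supp x" "\<And>q. q \<in> supp x \<Longrightarrow> key q \<le> key p"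
        unfolding L_def leads_def by blast
      have "x \<in> NF" using x(1) X(2) by blast
      from lead_shift[OF this x(2,3)] show ?thesis
        using VY[OF x(1)] unfolding 2(2) leads_def by blast
    qed
  qed
  then have dimY: "card S \<le> tgv.dim Y"
  proof (rule card_leads_le_dim)
    show "finite S" by fact
    show "inj_on key S" by (rule inj_on_subset[OF key_inj SN])
    show "finite (bas ` NW l)" using NW_bound(1) by simp
    show "Y \<subseteq> tgv.span (bas ` NW l)" using Y(2) NF_Fil_span by blast
  qed
  define A where "A = expo ` L"
  have cA: "card A = card L"
    unfolding A_def using LN NWs by (intro card_image inj_on_subset[OF expo_inj]) blast
  have cS: "card (expo ` S) = card S"
    by (rule card_image[OF inj_on_subset[OF expo_inj SN]])
  \<comment> \<open>One bound per direction \<open>Some i\<close>, all with the same right-hand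
    side; summing them over the \<open>d\<close> directions and dividing by \<open>d\<close> gives
    the constant \<open>1 / d\<close>.\<close>
  have each: "card A + card ((\<lambda>a. a(Some i := 0)) ` A) \<le> card S" for i
    unfolding cS[symmetric]
  proof (rule card_shift_ge)
    show "finite A" "finite (expo ` S)" "A \<subseteq> expo ` S" using fL fS by (auto simp: A_def S_def)
    show "(\<lambda>a. a(Some i := Suc (a (Some i)))) ` A \<subseteq> expo ` S"
      unfolding A_def image_image expo_sh[symmetric] by (auto simp: S_def)
  qed
  have card_range: "card (range (Some :: 'n \<Rightarrow> 'n option)) = CARD('n)"
    by (rule card_image) simp
  have "real (card A) powr ((d - 1) / d)
     \<le> (\<Sum>j\<in>range (Some :: 'n \<Rightarrow> _). real (card ((\<lambda>a. a(j := 0)) ` A)))"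
    using sum_card_projections_ge[of "range (Some :: 'n \<Rightarrow> _)" A] fL
    unfolding card_range d_def[symmetric] A_def by simp
  also have "\<dots> \<le> (\<Sum>j\<in>range (Some :: 'n \<Rightarrow> _). real (card S) - real (card A))"
  proof (rule sum_mono)
    fix j :: "'n option" assume "j \<in> range Some"
    then obtain i where "j = Some i" by blast
    then show "real (card ((\<lambda>a. a(j := 0)) ` A)) \<le> real (card S) - real (card A)"
      using each[of i] by simp
  qed
  also have "\<dots> = d * (real (card S) - real (card A))"
    by (simp add: card_range d_def)
  finally have main: "real (card A) + 1 / d * real (card A) powr ((d - 1) / d) \<le> real (card S)"
    using d1 by (simp add: field_simps)
  have "real (tgv.dim X) powr ((d - 1) / d) \<le> real (card A) powr ((d - 1) / d)"
    using dimX d1 cA by (intro powr_mono2) auto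
  then have "1 / d * real (tgv.dim X) powr ((d - 1) / d) \<le> 1 / d * real (card A) powr ((d - 1) / d)"
    using d1 by (intro mult_left_mono) auto
  then show ?thesis using main dimX dimY cA unfolding d_def[symmetric] by linarith
qed

end

section \<open>The two dimensions\<close>

text \<open>Mean value theorem; the intermediate point is below \<open>m + 1 \<le> 2 * m\<close>,
  whence the factor \<open>2 powr (d - 1)\<close>.\<close>

lemma powr_Suc_le:
  fixes m d :: real
  assumes "m \<ge> 1" "d \<ge> 1"
  shows "(m + 1) powr d \<le> m powr d + d * 2 powr (d - 1) * m powr (d - 1)"
proof -
  have "\<And>x. m \<le> x \<Longrightarrow> x \<le> m + 1 \<Longrightarrow> ((\<lambda>x. x powr d) has_real_derivative d * x powr (d - 1)) (at x)"
    using assms by (intro has_real_derivative_powr) auto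
  then obtain z where z: "m < z" "z < m + 1"
    "(m + 1) powr d - m powr d = (m + 1 - m) * (d * z powr (d - 1))"
    using MVT2[of m "m + 1" "\<lambda>x. x powr d" "\<lambda>x. d * x powr (d - 1)"] by auto
  have "z powr (d - 1) \<le> (2 * m) powr (d - 1)"
    using z assms by (intro powr_mono2) auto
  also have "\<dots> = 2 powr (d - 1) * m powr (d - 1)" using assms by (simp add: powr_mult)
  finally have "d * z powr (d - 1) \<le> d * (2 powr (d - 1) * m powr (d - 1))"
    using assms by (intro mult_left_mono) auto
  then show ?thesis using z(3) by simp
qed

text \<open>A discrete version of comparing \<open>a' = c a^((d-1)/d)\<close> with a solution
  growing like \<open>m^d\<close>. The condition on \<open>\<delta>\<close> makes one increment of
  \<open>(\<delta> * m) powr d\<close> at most \<open>c\<close> times its power with exponent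
  \<open>(d - 1) / d\<close>; the right-hand side is monotone in \<open>a\<close>.\<close>

lemma isoperimetric_step:
  fixes d c a \<delta> :: real
  assumes "d \<ge> 1" "c > 0" "0 < \<delta>" "\<delta> \<le> c / (d * 2 powr (d - 1))" "m \<ge> (1::nat)"
    and a: "(\<delta> * real m) powr d \<le> a"
  shows "(\<delta> * real (Suc m)) powr d \<le> a + c * a powr ((d - 1) / d)"
proof -
  let ?m = "real m" and ?B = "(\<delta> * real m) powr d"
  have B: "?B > 0" using assms by simp
  have "\<delta> * (d * 2 powr (d - 1)) \<le> c" using assms by (simp add: field_simps)
  then have "\<delta> powr (d - 1) * (\<delta> * (d * 2 powr (d - 1))) \<le> \<delta> powr (d - 1) * c"
    by (intro mult_left_mono) auto
  moreover have "\<delta> powr (d - 1) * \<delta> = \<delta> powr d"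
    using assms powr_add[of \<delta> "d - 1" 1] by simp
  ultimately have k: "\<delta> powr d * (d * 2 powr (d - 1)) \<le> \<delta> powr (d - 1) * c"
    by (simp add: mult.assoc[symmetric])
  have "(\<delta> * real (Suc m)) powr d = \<delta> powr d * (?m + 1) powr d"
    using assms by (simp add: powr_mult add.commute)
  also have "\<dots> \<le> \<delta> powr d * (?m powr d + d * 2 powr (d - 1) * ?m powr (d - 1))"
    using assms by (intro mult_left_mono powr_Suc_le) auto
  also have "\<dots> = ?B + \<delta> powr d * (d * 2 powr (d - 1)) * ?m powr (d - 1)"
    using assms by (simp add: powr_mult algebra_simps)
  also have "\<dots> \<le> ?B + \<delta> powr (d - 1) * c * ?m powr (d - 1)"
    by (intro add_left_mono mult_right_mono k) auto
  also have "\<dots> = ?B + c * (\<delta> * ?m) powr (d - 1)"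
    using assms by (simp add: powr_mult ac_simps)
  also have "(\<delta> * ?m) powr (d - 1) = ?B powr ((d - 1) / d)"
    using assms by (simp add: powr_powr)
  also have "?B + c * ?B powr ((d - 1) / d) \<le> a + c * a powr ((d - 1) / d)"
    using a B assms by (intro add_mono mult_left_mono powr_mono2) auto
  finally show ?thesis .
qed

lemma const_over_ln_tendsto_0: "(\<lambda>m. K / ln (real m)) \<longlonglongrightarrow> 0"
proof (rule tendsto_divide_0[OF tendsto_const])
  show "filterlim (\<lambda>m. ln (real m)) at_infinity sequentially"
    by (rule filterlim_at_top_imp_at_infinity)
      (rule filterlim_compose[OF ln_at_top filterlim_real_sequentially])
qed

lemma limsup_log_ge:
  fixes a :: "nat \<Rightarrow> nat"
  assumes "\<delta> > 0" "\<And>m. m \<ge> 1 \<Longrightarrow> (\<delta> * real m) powr d \<le> real (a m)"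
  shows "limsup (\<lambda>m. ereal (ln (real (a m)) / ln (real m))) \<ge> ereal d"
proof -
  have "(\<lambda>m. ereal (d * ln \<delta> / ln (real m) + d)) \<longlonglongrightarrow> ereal (0 + d)"
    by (intro tendsto_ereal tendsto_add const_over_ln_tendsto_0 tendsto_const)
  from lim_imp_Limsup[OF sequentially_bot this]
  have "ereal d = limsup (\<lambda>m. ereal (d * ln \<delta> / ln (real m) + d))" by simp
  also have "\<dots> \<le> limsup (\<lambda>m. ereal (ln (real (a m)) / ln (real m)))"
  proof (rule Limsup_mono, rule eventually_sequentiallyI)
    fix m :: nat assume m: "m \<ge> 2"
    then have lm: "ln (real m) > 0" by simp
    have pos: "\<delta> * real m > 0" using assms(1) m by simp
    have "(\<delta> * real m) powr d > 0" "(\<delta> * real m) powr d \<le> real (a m)"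
      using pos m assms(2)[of m] by auto
    then have "ln ((\<delta> * real m) powr d) \<le> ln (real (a m))"
      by (subst ln_le_cancel_iff) linarith+
    then have "d * (ln \<delta> + ln (real m)) \<le> ln (real (a m))"
      using assms(1) m pos by (simp add: ln_powr ln_mult)
    then have "(d * ln \<delta> + d * ln (real m)) / ln (real m) \<le> ln (real (a m)) / ln (real m)"
      using lm by (intro divide_right_mono) (auto simp: distrib_left)
    then show "ereal (d * ln \<delta> / ln (real m) + d) \<le> ereal (ln (real (a m)) / ln (real m))"
      using lm by (simp add: add_divide_distrib)
  qed
  finally show ?thesis .
qed

lemma limsup_log_le:
  fixes a :: "nat \<Rightarrow> nat"
  assumes "k \<ge> 1" "C \<ge> 1" "\<And>m. a m \<le> (k * m + 1) ^ n * C"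
  shows "limsup (\<lambda>m. ereal (ln (real (a m)) / ln (real m))) \<le> ereal (real n)"
proof -
  \<comment> \<open>\<open>K\<close> collects the constants in the logarithm of
    \<open>(2 * k * m) ^ n * C\<close>; divided by \<open>ln m\<close> it vanishes in the
    limit.\<close>
  define K where "K = real n * ln (2 * real k) + ln (real C)"
  have "(\<lambda>m. ereal (K / ln (real m) + real n)) \<longlonglongrightarrow> ereal (0 + real n)"
    by (intro tendsto_ereal tendsto_add const_over_ln_tendsto_0 tendsto_const)
  from lim_imp_Limsup[OF sequentially_bot this]
  have "ereal (real n) = limsup (\<lambda>m. ereal (K / ln (real m) + real n))" by simp
  moreover have "limsup (\<lambda>m. ereal (ln (real (a m)) / ln (real m))) \<le> limsup (\<lambda>m. ereal (K / ln (real m) + real n))"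
  proof (rule Limsup_mono, rule eventually_sequentiallyI)
    fix m :: nat assume m: "m \<ge> 2"
    then have lm: "ln (real m) > 0" by simp
    have "k * m + 1 \<le> 2 * k * m" using assms(1) m by (simp add: Suc_le_eq)
    then have "(k * m + 1) ^ n * C \<le> (2 * k * m) ^ n * C" by (intro mult_right_mono power_mono) auto
    then have am: "real (a m) \<le> (2 * real k * real m) ^ n * real C"
      using assms(3)[of m] by (metis (no_types, lifting) of_nat_le_iff of_nat_mult of_nat_numeral of_nat_power order_trans)
    have "ln (real (a m)) \<le> ln ((2 * real k * real m) ^ n * real C)"
    proof (cases "a m = 0")
      \<comment> \<open>Here \<open>ln 0 = 0\<close> by convention, so the bound must be shown to
        have a non-negative logarithm.\<close>
      case True
      have "(2 * real k * real m) ^ n * real C \<ge> 1 * 1"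
      proof (rule mult_mono)
        have "1 * 1 \<le> (2 * real k) * real m" using assms(1) m by (intro mult_mono) auto
        then show "1 \<le> (2 * real k * real m) ^ n" by (intro one_le_power) simp
      qed (use assms(2) in auto)
      then show ?thesis using True by simp
    next
      case False
      then show ?thesis using am by (subst ln_le_cancel_iff) auto
    qed
    also have "\<dots> = K + real n * ln (real m)"
      using assms(1,2) m by (simp add: K_def ln_mult ln_realpow algebra_simps)
    finally have "ln (real (a m)) / ln (real m) \<le> (K + real n * ln (real m)) / ln (real m)"
      using lm by (intro divide_right_mono) auto
    then show "ereal (ln (real (a m)) / ln (real m)) \<le> ereal (K / ln (real m) + real n)"
      using lm by (simp add: add_divide_distrib)
  qed
  ultimately show ?thesis by simp
qed

section \<open>Growth of the powers of a frame\<close>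

context sra begin

lemma fd_nonzero_cdim:
  assumes "fd_subspace SRAlg X"
  shows "cdim SRAlg X = tgv.dim (\<Phi> ` X)" "X \<noteq> {ca_zero SRAlg} \<longleftrightarrow> cdim SRAlg X \<ge> 1"
proof -
  note X = emb.fd_subspaceD[OF assms]
  obtain D where D: "finite D" "\<Phi> ` X = tgv.span D" using X(3) by blast
  show e: "cdim SRAlg X = tgv.dim (\<Phi> ` X)"
    by (rule emb.cdim_phi[OF X(1,2) D(1)]) (simp add: D(2))
  obtain B where B: "B \<subseteq> \<Phi> ` X" "tgv.independent B" "\<Phi> ` X \<subseteq> tgv.span B" "card B = tgv.dim (\<Phi> ` X)"
    using tgv.basis_exists by blast
  have fB: "finite B" using tgv.independent_span_bound[OF D(1) B(2)] B(1) D(2) by blast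
  have "X = {ca_zero SRAlg} \<longleftrightarrow> \<Phi> ` X = {0}"
  proof
    assume "\<Phi> ` X = {0}"
    then have "\<Phi> ` X = \<Phi> ` {ca_zero SRAlg}" by (simp only: image_insert image_empty emb.phi_zero)
    then show "X = {ca_zero SRAlg}"
      using inj_on_image_eq_iff[OF emb.inj X(1)] emb.zero_in by blast
  qed (simp only: image_insert image_empty emb.phi_zero)
  also have "\<dots> \<longleftrightarrow> tgv.dim (\<Phi> ` X) = 0"
  proof
    assume "tgv.dim (\<Phi> ` X) = 0"
    then have "B = {}" using B(4) fB by simp
    then have "\<Phi> ` X \<subseteq> {0}" using B(3) by simp
    then show "\<Phi> ` X = {0}" using tgv.subspace_0[OF X(2)] by blast
  next
    assume "\<Phi> ` X = {0}"
    then show "tgv.dim (\<Phi> ` X) = 0" using tgv.dim_le_card[of "{0}" "{}"] by simp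
  qed
  finally show "X \<noteq> {ca_zero SRAlg} \<longleftrightarrow> cdim SRAlg X \<ge> 1" using e by linarith
qed

lemma set_pow_fd:
  assumes "subframe SRAlg W"
  shows "fd_subspace SRAlg (set_pow SRAlg W m)"
    and "\<exists>k\<ge>1. \<forall>m. cdim SRAlg (set_pow SRAlg W m) \<le> (k * m + 1) ^ CARD('n) * card G"
proof -
  have W: "fd_subspace SRAlg W" using assms by (simp add: subframe_def)
  obtain k where k: "k \<ge> 1" "\<Phi> ` W \<subseteq> NF \<inter> Fil G k" using fd_in_Fil[OF W] by blast
  note p = set_pow_bound[OF emb.fd_subspaceD(1)[OF W] k(2)]
  show "fd_subspace SRAlg (set_pow SRAlg W m)"
    using p[of m] fd_cdim_NF_Fil(1) by blast
  show "\<exists>k\<ge>1. \<forall>m. cdim SRAlg (set_pow SRAlg W m) \<le> (k * m + 1) ^ CARD('n) * card G"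
    using p fd_cdim_NF_Fil(3) k(1) by blast
qed

text \<open>The starting value for the growth estimate: \<open>tg_one\<close> is its own normal form
  and nonzero, so the algebra is not trivial.\<close>

lemma set_pow_0_dim: "cdim SRAlg (set_pow SRAlg W 0) \<ge> 1"
proof -
  have F: "{ca_one SRAlg} \<subseteq> ca_carrier SRAlg" using one_in by simp
  have fd: "fd_subspace SRAlg (cspan SRAlg {ca_one SRAlg})"
    by (rule emb.fd_subspace_cspan[OF _ F]) simp
  have "tg_one \<in> \<Phi> ` cspan SRAlg {ca_one SRAlg}"
    unfolding emb.phi_cspan[OF F] by (simp add: Phi_one tgv.span_base)
  moreover have "tg_one \<noteq> (0 :: 'n tg)"
  proof
    assume "tg_one = (0 :: 'n tg)"
    from fun_cong[OF this, of "([], mat 1)"] show False by (simp add: tg_one_def tg_apply)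
  qed
  ultimately have "cspan SRAlg {ca_one SRAlg} \<noteq> {ca_zero SRAlg}"
    using emb.phi_zero by force
  then show ?thesis using fd_nonzero_cdim(2)[OF fd] by simp
qed

text \<open>The isoperimetric inequality is applied to the powers of \<open>W\<close> itself, one
  step per power. It serves twice: with the generating frame it bounds the Gelfand-Kirillov
  dimension from below, and with an arbitrary frame it bounds the admissible exponents
  \<open>d\<close> from above.\<close>

lemma growth_limsup_ge:
  assumes W: "subframe SRAlg W" and d: "d \<ge> 1" and c': "c' > 0"
    and iso: "\<And>X. fd_subspace SRAlg X \<Longrightarrow> X \<noteq> {ca_zero SRAlg} \<Longrightarrow>
      real (cdim SRAlg (set_prod SRAlg W X)) \<ge> real (cdim SRAlg X) + c' * real (cdim SRAlg X) powr ((d - 1) / d)"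
  shows "limsup (\<lambda>m. ereal (ln (real (cdim SRAlg (set_pow SRAlg W m))) / ln (real m))) \<ge> ereal d"
proof -
  let ?a = "\<lambda>m. cdim SRAlg (set_pow SRAlg W m)"
  \<comment> \<open>The bound by 1 starts the induction at \<open>m = 1\<close>, where the dimension
    is only known to be positive; the other bound is what \<open>isoperimetric_step\<close> asks
    for.\<close>
  define \<delta> where "\<delta> = min 1 (c' / (d * 2 powr (d - 1)))"
  have \<delta>: "\<delta> > 0" "\<delta> \<le> 1" "\<delta> \<le> c' / (d * 2 powr (d - 1))"
    using d c' by (auto simp: \<delta>_def)
  have step: "real (?a m) + c' * real (?a m) powr ((d - 1) / d) \<le> real (?a (Suc m))" if "?a m \<ge> 1" for m
    using iso[OF set_pow_fd(1)[OF W, of m]] fd_nonzero_cdim(2)[OF set_pow_fd(1)[OF W, of m]] that by simp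
  have a1: "?a m \<ge> 1" for m
  proof (induction m)
    case 0
    show ?case by (rule set_pow_0_dim)
  next
    case (Suc m)
    have "real (?a m) \<le> real (?a (Suc m))"
      using step[OF Suc.IH] c' by (smt (verit) mult_nonneg_nonneg powr_ge_zero)
    then show ?case using Suc.IH by linarith
  qed
  have "(\<delta> * real m) powr d \<le> real (?a m)" if "m \<ge> 1" for m
    using that
  proof (induction m rule: dec_induct)
    case base
    have "(\<delta> * real 1) powr d \<le> 1" using \<delta> d by (simp add: powr_le1)
    then show ?case using a1[of 1] by linarith
  next
    case (step m)
    then show ?case
      using isoperimetric_step[OF d c' \<delta>(1,3), of m "real (?a m)"] \<open>?a m \<ge> 1 \<Longrightarrow> _\<close>[OF a1[of m]] by linarith
  qed
  then show ?thesis by (rule limsup_log_ge[OF \<delta>(1)])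
qed

lemma limsup_le:
  assumes "subframe SRAlg W"
  shows "limsup (\<lambda>m. ereal (ln (real (cdim SRAlg (set_pow SRAlg W m))) / ln (real m))) \<le> ereal (real CARD('n))"
proof -
  obtain k where k: "k \<ge> 1" "\<And>m. cdim SRAlg (set_pow SRAlg W m) \<le> (k * m + 1) ^ CARD('n) * card G"
    using set_pow_fd(2)[OF assms] by blast
  have "card G \<ge> 1" using one_G finite_G by (auto simp: Suc_le_eq card_gt_0_iff)
  from limsup_log_le[OF k(1) this k(2)] show ?thesis .
qed

lemma generating_subframe:
  obtains W where "subframe SRAlg W"
    "\<And>X. fd_subspace SRAlg X \<Longrightarrow> X \<noteq> {ca_zero SRAlg} \<Longrightarrow>
      real (cdim SRAlg (set_prod SRAlg W X)) \<ge> real (cdim SRAlg X)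
        + 1 / real CARD('n) * real (cdim SRAlg X) powr ((real CARD('n) - 1) / real CARD('n))"
proof -
  define F where "F = coset I ` gens"
  have gN: "gens \<subseteq> NF" using one_NF vec_NF by (auto simp: gens_def)
  have F: "finite F" "F \<subseteq> ca_carrier SRAlg"
    using gN by (auto simp: F_def gens_def SRA_simps NF_def)
  \<comment> \<open>The generators are combinations of words with at most one letter, hence already
    in normal form.\<close>
  have "\<Phi> (coset I a) = a" if "a \<in> gens" for a
    using gN that N_NF_id[of a] rep_coset(3)[of a] by (auto simp: NF_def)
  then have PF: "\<Phi> ` F = gens" by (auto simp: F_def image_image)
  define W where "W = cspan SRAlg F"
  have PW: "\<Phi> ` W = tgv.span gens" unfolding W_def emb.phi_cspan[OF F(2)] PF ..
  have fdW: "fd_subspace SRAlg W" unfolding W_def by (rule emb.fd_subspace_cspan[OF F])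
  have Win: "W \<subseteq> ca_carrier SRAlg" by (rule emb.fd_subspaceD(1)[OF fdW])
  have "tg_one \<in> \<Phi> ` W" unfolding PW by (rule tgv.span_base) (simp add: gens_def)
  then have "ca_one SRAlg \<in> W"
    using inj_on_image_mem_iff[OF emb.inj one_in Win] Phi_one by simp
  then have "subframe SRAlg W" using fdW by (simp add: subframe_def)
  moreover have "real (cdim SRAlg (set_prod SRAlg W X)) \<ge> real (cdim SRAlg X)
        + 1 / real CARD('n) * real (cdim SRAlg X) powr ((real CARD('n) - 1) / real CARD('n))"
    if X: "fd_subspace SRAlg X" for X
  proof -
    obtain k where k: "\<Phi> ` X \<subseteq> NF \<inter> Fil G k" using fd_in_Fil[OF X] by blast
    obtain l where l: "\<Phi> ` set_prod SRAlg W X \<subseteq> NF \<inter> Fil G l"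
      using fd_in_Fil[OF set_prod_fd(1)[OF fdW X]] by blast
    show ?thesis
      unfolding set_prod_fd(2)[OF fdW X] fd_nonzero_cdim(1)[OF X]
      by (rule growth_NF[OF emb.fd_subspaceD(2)[OF X] k _ set_prod_Phi(2)[OF Win emb.fd_subspaceD(1)[OF X]] l])
        (simp add: PW tgv.span_superset)
  qed
  ultimately show thesis using that by blast
qed

lemma GKdim_SRA: "GKdim SRAlg = ereal (real CARD('n))"
  and LDdeg_SRA: "LDdeg SRAlg = ereal (real CARD('n))"
proof -
  define n where "n = real CARD('n)"
  have n1: "n \<ge> 1" unfolding n_def using zero_less_card_finite[where 'a = 'n] by linarith
  let ?L = "\<lambda>W. limsup (\<lambda>m. ereal (ln (real (cdim SRAlg (set_pow SRAlg W m))) / ln (real m)))"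
  let ?iso = "\<lambda>W d. \<exists>c'>0. \<forall>X. fd_subspace SRAlg X \<and> X \<noteq> {ca_zero SRAlg} \<longrightarrow>
      real (cdim SRAlg (set_prod SRAlg W X)) \<ge> real (cdim SRAlg X) + c' * real (cdim SRAlg X) powr ((d - 1) / d)"
  obtain W where W: "subframe SRAlg W" and Wiso: "\<And>X. fd_subspace SRAlg X \<Longrightarrow> X \<noteq> {ca_zero SRAlg} \<Longrightarrow>
      real (cdim SRAlg (set_prod SRAlg W X)) \<ge> real (cdim SRAlg X) + 1 / n * real (cdim SRAlg X) powr ((n - 1) / n)"
    using generating_subframe unfolding n_def by blast
  have n0: "1 / n > 0" using n1 by simp
  have Wn: "?iso W n" using Wiso n0 by blast
  show "GKdim SRAlg = ereal (real CARD('n))"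
    unfolding n_def[symmetric]
  proof (rule antisym)
    show "GKdim SRAlg \<le> ereal n"
      unfolding GKdim_def n_def by (rule SUP_least) (simp add: limsup_le)
    have "ereal n \<le> ?L W" by (rule growth_limsup_ge[OF W n1 n0 Wiso])
    also have "\<dots> \<le> GKdim SRAlg"
      unfolding GKdim_def by (rule SUP_upper) (simp add: W)
    finally show "ereal n \<le> GKdim SRAlg" .
  qed
  \<comment> \<open>Growth forces \<open>d \<le> n\<close> only for \<open>d \<ge> 1\<close>, the
    range of \<open>growth_limsup_ge\<close>; smaller \<open>d\<close> lie below \<open>n\<close>
    anyway.\<close>
  have ub: "d \<le> n" if V: "subframe SRAlg V" and d: "d > 0" "?iso V d" for V d
  proof (cases "d \<ge> 1")
    case True
    obtain c' where c': "c' > 0" "\<And>X. fd_subspace SRAlg X \<Longrightarrow> X \<noteq> {ca_zero SRAlg} \<Longrightarrow>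
      real (cdim SRAlg (set_prod SRAlg V X)) \<ge> real (cdim SRAlg X) + c' * real (cdim SRAlg X) powr ((d - 1) / d)"
      using d(2) by blast
    have "ereal d \<le> ?L V" by (rule growth_limsup_ge[OF V True c'])
    also have "\<dots> \<le> ereal n" unfolding n_def by (rule limsup_le[OF V])
    finally show ?thesis by simp
  next
    case False
    then show ?thesis using n1 by simp
  qed
  \<comment> \<open>The generating frame excludes the zero branch of \<open>LDdeg\<close>: its
    isoperimetric surplus is positive for every nonzero \<open>X\<close>.\<close>
  have not0: "\<not> (\<forall>W. subframe SRAlg W \<longrightarrow> (\<exists>X. fd_subspace SRAlg X \<and> X \<noteq> {ca_zero SRAlg} \<and>
      cdim SRAlg (set_prod SRAlg W X) = cdim SRAlg X))"
  proof
    assume "\<forall>W. subframe SRAlg W \<longrightarrow> (\<exists>X. fd_subspace SRAlg X \<and> X \<noteq> {ca_zero SRAlg} \<and>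
      cdim SRAlg (set_prod SRAlg W X) = cdim SRAlg X)"
    then obtain X where X: "fd_subspace SRAlg X" "X \<noteq> {ca_zero SRAlg}"
      "cdim SRAlg (set_prod SRAlg W X) = cdim SRAlg X" using W by blast
    have "real (cdim SRAlg X) > 0" using fd_nonzero_cdim(2)[OF X(1)] X(2) by simp
    then have "1 / n * real (cdim SRAlg X) powr ((n - 1) / n) > 0" using n0 by (intro mult_pos_pos) simp_all
    then show False using Wiso[OF X(1,2)] X(3) by simp
  qed
  have LD: "LDdeg SRAlg = (SUP W\<in>{W. subframe SRAlg W}. Sup (ereal ` {d. d > 0 \<and> ?iso W d}))"
    unfolding LDdeg_def by (rule if_not_P[OF not0])
  show "LDdeg SRAlg = ereal (real CARD('n))"
    unfolding LD n_def[symmetric]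
  proof (rule antisym)
    show "(SUP W\<in>{W. subframe SRAlg W}. Sup (ereal ` {d. d > 0 \<and> ?iso W d})) \<le> ereal n"
    proof (intro SUP_least)
      fix V d assume "V \<in> {W. subframe SRAlg W}" "d \<in> {d. d > 0 \<and> ?iso V d}"
      then have "subframe SRAlg V" "d > 0" "?iso V d" by blast+
      then show "ereal d \<le> ereal n" using ub by simp
    qed
    have "n \<in> {d. d > 0 \<and> ?iso W d}" using Wn n1 by simp
    then have "ereal n \<le> Sup (ereal ` {d. d > 0 \<and> ?iso W d})" by (intro Sup_upper imageI)
    also have "\<dots> \<le> (SUP W\<in>{W. subframe SRAlg W}. Sup (ereal ` {d. d > 0 \<and> ?iso W d}))"
      by (rule SUP_upper) (simp add: W)
    finally show "ereal n \<le> (SUP W\<in>{W. subframe SRAlg W}. Sup (ereal ` {d. d > 0 \<and> ?iso W d}))" .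
  qed
qed

end

theorem theorem8p8:
  fixes om :: "complex^'n \<Rightarrow> complex^'n \<Rightarrow> complex"
    and G :: "(complex^'n^'n) set"
    and t :: complex
    and c :: "complex^'n^'n \<Rightarrow> complex"
  assumes "symplectic_triple om G"
    and "indecomposable om G"
    and "\<forall>g\<in>G. \<forall>s\<in>refls G. c (g ** s ** matrix_inv g) = c s"
  shows "LD_stable (SRA om G t c) \<and> LDdeg (SRA om G t c) = ereal (real CARD('n))"
proof -
  interpret sra om G t c
    using assms by unfold_locales auto
  show ?thesis by (simp add: LD_stable_def GKdim_SRA LDdeg_SRA)
qed

end
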